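(* Let $V$ be a superspace over $\mathbb{C}$ with $\dim V=(n,n)$ and let $p,q\ge0$. The inner products $(v_s,v_t)$, $s,t\in S$, form a basic set for the $\mathfrak{pe}(V)$-invariants in $\mathfrak{A}^{p,q}$.
   Context: All superspaces are over $\mathbb{C}$; $\dim V=(n,n)$ means $\dim V_{\bar 0}=\dim V_{\bar 1}=n$; $\Pi$ is the parity shift. Let $W$ be a superspace with $\dim W=(p,q)$ and $$\mathfrak{A}^{p,q}=S^{\bullet}(V^{*p}\oplus\Pi(V)^{*q})=S^{\bullet}(V^*\otimes W)$$ (symmetric algebra in the super sense), on which $\mathfrak{gl}(V)$ and $\mathfrak{gl}(W)$ act by superderivations. For a Lie subsuperalgebra $\mathfrak g\subset\mathfrak{gl}(V)$, an element is $\mathfrak g$-invariant if annihilated by $\mathfrak g$. Polarization operators are the operators given by elements of $U(\mathfrak{gl}(W))$. A set $\mathfrak M$ of $\mathfrak g$-invariants is basic if the algebra of $\mathfrak g$-invariants coincides with the least subalgebra containing $\mathfrak M$ and stable under all polarization operators. (The existence of an odd $\mathfrak{pe}(V)$-invariant form identifies $S^{\bullet}(V^{k}\oplus\Pi(V)^{l}\oplus V^{*p}\oplus\Pi(V)^{*q})$ with $\mathfrak{A}^{p+l,q+k}$, so only $\mathfrak A^{p,q}$ need be considered.) Index sets: $S=\{1,\dots,p,\bar1,\dots,\bar q\}$, $I=\{1,\dots,n,\bar1,\dots,\bar n\}$, $I_{\bar0}=\{1,\dots,n\}$; barred indices are odd, unbarred even; $p(s)\in\{0,1\}$ is the parity of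 $s$. $\{e_i\}_{i\in I}$ and $\{w_s\}_{s\in S}$ are homogeneous bases of $V$ and $W$ with parities of their indices, $\{e^*_i\}$ is the dual basis of $V^*$, $e_i^*(e_j)=\delta_{ij}$, and $x^*_{is}=e^*_i\otimes w_s$. $\mathfrak{pe}(V)\subset\mathfrak{gl}(V)$ is the Lie superalgebra preserving the tensor $\sum_{i\in I_{\bar0}}(e^*_i\otimes e^*_{\bar i}+e^*_{\bar i}\otimes e^*_i)$. The inner products are $$(v_s,v_t)=\sum_{i\in I_{\bar0}}\bigl((-1)^{p(s)}x^*_{is}x^*_{\bar i t}+x^*_{\bar i s}x^*_{it}\bigr).$$ *)

theory Defs
  imports Complex_Main "HOL-Library.Poly_Mapping" "HOL-Library.Z2"
begin

class cvector = ab_group_add +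
  fixes cscale :: "complex \<Rightarrow> 'a \<Rightarrow> 'a"  (infixr "*\<^sub>C" 75)
  assumes cscale_add_right: "a *\<^sub>C (x + y) = a *\<^sub>C x + a *\<^sub>C y"
    and cscale_add_left: "(a + b) *\<^sub>C x = a *\<^sub>C x + b *\<^sub>C x"
    and cscale_cscale: "a *\<^sub>C b *\<^sub>C x = (a * b) *\<^sub>C x"
    and cscale_one: "1 *\<^sub>C x = x"

global_interpretation cvs: vector_space "cscale :: complex \<Rightarrow> 'a \<Rightarrow> 'a::cvector"
  by unfold_locales (simp_all add: cscale_add_right cscale_add_left cscale_cscale cscale_one)

abbreviation clinear :: "('a::cvector \<Rightarrow> 'b::cvector) \<Rightarrow> bool"
  where "clinear \<equiv> Vector_Spaces.linear cscale cscale"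

lemma clinearI:
  assumes "\<And>x y. f (x + y) = f x + f y" and "\<And>c x. f (c *\<^sub>C x) = c *\<^sub>C f x"
  shows "clinear f"
  using assms by unfold_locales auto

lemma clinear_add: "clinear f \<Longrightarrow> f (x + y) = f x + f y"
  and clinear_cscale: "clinear f \<Longrightarrow> f (c *\<^sub>C x) = c *\<^sub>C f x"
  by (simp_all add: Vector_Spaces.linear_iff)

text \<open>A superspace \<open>V = V\<^sub>0 \<oplus> V\<^sub>1\<close> is given by its two projections \<open>hcomp 0\<close> and \<open>hcomp 1\<close>; the
  homogeneous vectors of parity \<open>k\<close> are those fixed by \<open>hcomp k\<close>. Parities live in the two-element
  field \<^typ>\<open>bit\<close>.\<close>

class superspace = cvector +
  fixes hcomp :: "bit \<Rightarrow> 'a \<Rightarrow> 'a"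
  assumes hcomp_add: "hcomp k (x + y) = hcomp k x + hcomp k y"
    and hcomp_cscale: "hcomp k (c *\<^sub>C x) = c *\<^sub>C hcomp k x"
    and hcomp_sum: "hcomp 0 x + hcomp 1 x = x"
    and hcomp_hcomp: "hcomp j (hcomp k x) = (if j = k then hcomp k x else 0)"

definition homog :: "bit \<Rightarrow> 'a::superspace set"
  where "homog k = {x. hcomp k x = x}"

definition bsign :: "bit \<Rightarrow> complex"
  where "bsign k = (if k = 0 then 1 else - 1)"

text \<open>\<open>twist k\<close> multiplies a homogeneous vector \<open>v\<close> by \<open>(-1)\<close> to the power \<open>k p(v)\<close>.\<close>

definition twist :: "bit \<Rightarrow> 'a::superspace \<Rightarrow> 'a"
  where "twist k v = hcomp 0 v + bsign k *\<^sub>C hcomp 1 v"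

definition gl :: "('a::superspace \<Rightarrow> 'a) set"
  where "gl = {A. clinear A}"

text \<open>\<open>gl_part k A\<close> is the component of parity \<open>k\<close> of an endomorphism \<open>A\<close>, so the action formulas
  below apply to arbitrary, not only homogeneous, elements of \<open>gl(V)\<close>.\<close>

definition gl_part :: "bit \<Rightarrow> ('a::superspace \<Rightarrow> 'a) \<Rightarrow> 'a \<Rightarrow> 'a"
  where "gl_part k A v = hcomp k (A (hcomp 0 v)) + hcomp (k + 1) (A (hcomp 1 v))"

lemma bit_cases: "(k::bit) = 0 \<or> k = 1"
  by (cases k) auto

lemma hcomp_zero [simp]: "hcomp k (0::'a::superspace) = 0"
  using hcomp_cscale[of k 0 "0::'a"] by simp

lemma clinear_hcomp: "clinear (hcomp k :: 'a::superspace \<Rightarrow> 'a)"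
  by (rule clinearI) (simp_all add: hcomp_add hcomp_cscale)

lemma clinear_twist: "clinear (twist k :: 'a::superspace \<Rightarrow> 'a)"
  by (rule clinearI)
     (simp_all add: twist_def hcomp_add hcomp_cscale cscale_add_right cscale_cscale ac_simps)

lemma clinear_gl_part: "clinear A \<Longrightarrow> clinear (gl_part k A)"
  by (rule clinearI)
     (simp_all add: gl_part_def hcomp_add hcomp_cscale cscale_add_right clinear_add clinear_cscale
        ac_simps)

lemma hcomp_homog: "v \<in> homog j \<Longrightarrow> hcomp k v = (if k = j then v else 0)"
  unfolding homog_def using hcomp_hcomp[of k j v] by auto

lemma twist_homog: "v \<in> homog j \<Longrightarrow> twist k v = bsign (k * j) *\<^sub>C v"
  using bit_cases[of j] by (auto simp: twist_def hcomp_homog bsign_def cscale_one)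

lemma gl_part_homog:
  assumes "clinear A" "v \<in> homog j"
  shows "gl_part k A v = hcomp (k + j) (A v)"
proof -
  have A0: "A 0 = 0"
    using clinear_cscale[OF assms(1), of 0 0] by simp
  show ?thesis
    using assms(2) bit_cases[of j] by (auto simp: gl_part_def hcomp_homog A0)
qed

lemma gl_part_sum:
  assumes "clinear A"
  shows "gl_part 0 A v + gl_part 1 A v = A v"
proof -
  have "gl_part 0 A v + gl_part 1 A v
      = (hcomp 0 (A (hcomp 0 v)) + hcomp 1 (A (hcomp 0 v)))
        + (hcomp 0 (A (hcomp 1 v)) + hcomp 1 (A (hcomp 1 v)))"
    by (simp add: gl_part_def ac_simps)
  also have "\<dots> = A (hcomp 0 v + hcomp 1 v)"
    by (simp only: hcomp_sum[of "A _"] clinear_add[OF assms])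
  finally show ?thesis unfolding hcomp_sum .
qed

typedef (overloaded) 'a dual = "{f :: 'a::cvector \<Rightarrow> complex. Vector_Spaces.linear cscale (*) f}"
  morphisms dual_app Abs_dual
proof -
  have "Vector_Spaces.linear cscale (*) (\<lambda>x::'a. 0::complex)"
    by unfold_locales (auto simp: algebra_simps)
  then show ?thesis by blast
qed

setup_lifting type_definition_dual

lemma linear_fun_iff:
  "Vector_Spaces.linear cscale (*) (f :: 'a::cvector \<Rightarrow> complex) \<longleftrightarrow>
     (\<forall>x y. f (x + y) = f x + f y) \<and> (\<forall>c x. f (c *\<^sub>C x) = c * f x)"
proof -
  have "vector_space ((*) :: complex \<Rightarrow> complex \<Rightarrow> complex)"
    by unfold_locales (auto simp: algebra_simps)
  then show ?thesis
    by (auto simp: Vector_Spaces.linear_iff cvs.vector_space_axioms)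
qed

lemma dual_app_add: "dual_app f (x + y) = dual_app f x + dual_app f y"
  and dual_app_cscale: "dual_app f (c *\<^sub>C x) = c * dual_app f x"
  using dual_app[of f] by (simp_all add: linear_fun_iff)

instantiation dual :: (cvector) cvector
begin

lift_definition zero_dual :: "'a dual" is "\<lambda>x. 0"
  by (simp add: linear_fun_iff)
lift_definition plus_dual :: "'a dual \<Rightarrow> 'a dual \<Rightarrow> 'a dual" is "\<lambda>f g x. f x + g x"
  by (simp add: linear_fun_iff algebra_simps)
lift_definition minus_dual :: "'a dual \<Rightarrow> 'a dual \<Rightarrow> 'a dual" is "\<lambda>f g x. f x - g x"
  by (simp add: linear_fun_iff algebra_simps)
lift_definition uminus_dual :: "'a dual \<Rightarrow> 'a dual" is "\<lambda>f x. - f x"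
  by (simp add: linear_fun_iff algebra_simps)
lift_definition cscale_dual :: "complex \<Rightarrow> 'a dual \<Rightarrow> 'a dual" is "\<lambda>c f x. c * f x"
  by (simp add: linear_fun_iff algebra_simps)

instance
  by standard (transfer; simp add: fun_eq_iff algebra_simps)+

end

text \<open>A functional has parity \<open>k\<close> iff it vanishes on vectors of the other parity.\<close>

instantiation dual :: (superspace) superspace
begin

lift_definition hcomp_dual :: "bit \<Rightarrow> 'a dual \<Rightarrow> 'a dual" is "\<lambda>k f x. f (hcomp k x)"
  by (simp add: linear_fun_iff hcomp_add hcomp_cscale)

instance
proof
  fix k j :: bit and f g :: "'a dual" and c :: complex
  show "hcomp k (f + g) = hcomp k f + hcomp k g" by transfer simp
  show "hcomp k (c *\<^sub>C f) = c *\<^sub>C hcomp k f" by transfer simp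
  show "hcomp 0 f + hcomp 1 f = f"
    by transfer (simp add: fun_eq_iff linear_fun_iff hcomp_sum, metis hcomp_sum)
  show "hcomp j (hcomp k f) = (if j = k then hcomp k f else 0)"
  proof (transfer, rule ext)
    fix j k and f :: "'a \<Rightarrow> complex" and x :: 'a
    assume f: "Vector_Spaces.linear cscale (*) f"
    have "f 0 = 0" using f by (auto simp: linear_fun_iff)
         (metis cvs.scale_zero_left mult_zero_left)
    then show "f (hcomp k (hcomp j x)) = (if j = k then \<lambda>x. f (hcomp k x) else (\<lambda>x. 0)) x"
      by (simp add: hcomp_hcomp)
  qed
qed

end

text \<open>For homogeneous \<open>A\<close> and \<open>f\<close> this is \<open>(A f)(v) = - (-1)\<^bsup>p(A) p(f)\<^esup> f (A v)\<close>.\<close>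

definition dual_act :: "('a::superspace \<Rightarrow> 'a) \<Rightarrow> 'a dual \<Rightarrow> 'a dual"
  where "dual_act A f = Abs_dual (\<lambda>v. - (\<Sum>k\<in>{0, 1}. dual_app (twist k f) (gl_part k A v)))"

lemma dual_app_dual_act:
  assumes "clinear A"
  shows "dual_app (dual_act A f) v = - (\<Sum>k\<in>{0, 1}. dual_app (twist k f) (gl_part k A v))"
  unfolding dual_act_def
  by (subst Abs_dual_inverse)
     (auto simp: linear_fun_iff dual_app_add dual_app_cscale clinear_add[OF clinear_gl_part[OF assms]]
        clinear_cscale[OF clinear_gl_part[OF assms]] algebra_simps)

lemma clinear_dual_act:
  assumes "clinear A"
  shows "clinear (dual_act A)"
proof (rule clinearI)
  have add: "dual_app (f + g) v = dual_app f v + dual_app g v" for f g :: "'a dual" and v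
    by transfer simp
  have scale: "dual_app (c *\<^sub>C f) v = c * dual_app f v" for f :: "'a dual" and c v
    by transfer simp
  fix f g :: "'a dual" and c
  show "dual_act A (f + g) = dual_act A f + dual_act A g"
    by (rule dual_app_inject[THEN iffD1], rule ext)
       (simp add: dual_app_dual_act[OF assms] add clinear_add[OF clinear_twist] algebra_simps)
  show "dual_act A (c *\<^sub>C f) = c *\<^sub>C dual_act A f"
    by (rule dual_app_inject[THEN iffD1], rule ext)
       (simp add: dual_app_dual_act[OF assms] scale clinear_cscale[OF clinear_twist] algebra_simps)
qed

definition pmscale :: "complex \<Rightarrow> ('k \<Rightarrow>\<^sub>0 complex) \<Rightarrow> ('k \<Rightarrow>\<^sub>0 complex)"
  where "pmscale c = Poly_Mapping.map ((*) c)"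

lemma lookup_pmscale [simp]: "Poly_Mapping.lookup (pmscale c a) k = c * Poly_Mapping.lookup a k"
  unfolding pmscale_def by transfer (auto simp: when_def)

global_interpretation pmv: vector_space "pmscale :: complex \<Rightarrow> ('k \<Rightarrow>\<^sub>0 complex) \<Rightarrow> _"
  by unfold_locales (auto intro!: poly_mapping_eqI simp: lookup_add algebra_simps)

definition lext :: "('k \<Rightarrow> 'b::cvector) \<Rightarrow> ('k \<Rightarrow>\<^sub>0 complex) \<Rightarrow> 'b"
  where "lext g a = (\<Sum>x\<in>Poly_Mapping.keys a. Poly_Mapping.lookup a x *\<^sub>C g x)"

lemma lext_superset:
  assumes "finite X" "Poly_Mapping.keys a \<subseteq> X"
  shows "lext g a = (\<Sum>x\<in>X. Poly_Mapping.lookup a x *\<^sub>C g x)"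
  unfolding lext_def using assms
  by (intro sum.mono_neutral_left) (auto simp: in_keys_iff)

lemma lext_add: "lext g (a + b) = lext g a + lext g b"
proof -
  let ?X = "Poly_Mapping.keys a \<union> Poly_Mapping.keys b"
  have "lext g (a + b) = (\<Sum>x\<in>?X. Poly_Mapping.lookup (a + b) x *\<^sub>C g x)"
    by (rule lext_superset) (use keys_add[of a b] in auto)
  moreover have "lext g a = (\<Sum>x\<in>?X. Poly_Mapping.lookup a x *\<^sub>C g x)"
    by (rule lext_superset) auto
  moreover have "lext g b = (\<Sum>x\<in>?X. Poly_Mapping.lookup b x *\<^sub>C g x)"
    by (rule lext_superset) auto
  ultimately show ?thesis
    by (simp add: lookup_add cscale_add_left sum.distrib)
qed

lemma lext_single [simp]: "lext g (Poly_Mapping.single k c) = c *\<^sub>C g k"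
  by (subst lext_superset[of "{k}"]) auto

lemma lext_pmscale: "lext g (pmscale c a) = c *\<^sub>C lext g a"
proof -
  have "lext g (pmscale c a)
      = (\<Sum>x\<in>Poly_Mapping.keys a. Poly_Mapping.lookup (pmscale c a) x *\<^sub>C g x)"
    by (rule lext_superset) (auto simp: in_keys_iff)
  then show ?thesis
    by (simp add: lext_def cvs.scale_sum_right cscale_cscale)
qed

lemma lext_zero [simp]: "lext g 0 = 0"
  by (simp add: lext_def)

lemma lext_diff: "lext g (a - b) = lext g a - lext g b"
  using lext_add[of g "a - b" b] by simp

lemma pm_induct [case_names single add]:
  fixes a :: "'k \<Rightarrow>\<^sub>0 complex"
  assumes "\<And>k c. P (Poly_Mapping.single k c)" and "\<And>a b. P a \<Longrightarrow> P b \<Longrightarrow> P (a + b)"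
  shows "P a"
proof -
  have *: "a = (\<Sum>k\<in>Poly_Mapping.keys a. Poly_Mapping.single k (Poly_Mapping.lookup a k))"
    by (rule poly_mapping_eqI)
       (auto simp: lookup_sum lookup_single when_def in_keys_iff)
  have zero: "P 0" using assms(1)[of undefined 0] by simp
  have "finite X \<Longrightarrow> P (\<Sum>k\<in>X. Poly_Mapping.single k (Poly_Mapping.lookup a k))" for X
    by (induction X rule: finite_induct) (auto intro: assms zero)
  then show ?thesis using * by (metis finite_keys)
qed

inductive_set tensor_rels :: "(('a::cvector \<times> 'b::cvector) \<Rightarrow>\<^sub>0 complex) set"
  where
    "Poly_Mapping.single (v + v', w) 1 - Poly_Mapping.single (v, w) 1 - Poly_Mapping.single (v', w) 1
       \<in> tensor_rels"
  | "Poly_Mapping.single (v, w + w') 1 - Poly_Mapping.single (v, w) 1 - Poly_Mapping.single (v, w') 1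
       \<in> tensor_rels"
  | "Poly_Mapping.single (c *\<^sub>C v, w) 1 - Poly_Mapping.single (v, w) c \<in> tensor_rels"
  | "Poly_Mapping.single (v, c *\<^sub>C w) 1 - Poly_Mapping.single (v, w) c \<in> tensor_rels"

definition tensor_eq ::
    "(('a::cvector \<times> 'b::cvector) \<Rightarrow>\<^sub>0 complex) \<Rightarrow> (('a \<times> 'b) \<Rightarrow>\<^sub>0 complex) \<Rightarrow> bool"
  where "tensor_eq a b \<longleftrightarrow> a - b \<in> pmv.span tensor_rels"

lemma tensor_eq_refl: "tensor_eq a a"
  by (simp add: tensor_eq_def pmv.span_zero)

lemma tensor_eq_sym: "tensor_eq a b \<Longrightarrow> tensor_eq b a"
  using pmv.span_neg[of "a - b" tensor_rels] by (simp add: tensor_eq_def)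

lemma tensor_eq_trans: "tensor_eq a b \<Longrightarrow> tensor_eq b c \<Longrightarrow> tensor_eq a c"
  using pmv.span_add[of "a - b" tensor_rels "b - c"] by (simp add: tensor_eq_def)

lemma tensor_eq_add: "tensor_eq a b \<Longrightarrow> tensor_eq c d \<Longrightarrow> tensor_eq (a + c) (b + d)"
  using pmv.span_add[of "a - b" tensor_rels "c - d"] by (simp add: tensor_eq_def add_diff_add)

lemma tensor_eq_scale: "tensor_eq a b \<Longrightarrow> tensor_eq (pmscale c a) (pmscale c b)"
  using pmv.span_scale[of "a - b" tensor_rels c]
  by (simp add: tensor_eq_def pmv.scale_right_diff_distrib)

lemma tensor_eq_uminus: "tensor_eq a b \<Longrightarrow> tensor_eq (- a) (- b)"
  using tensor_eq_scale[of a b "- 1"] by simp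

quotient_type (overloaded) ('a, 'b) tensor =
    "('a::cvector \<times> 'b::cvector) \<Rightarrow>\<^sub>0 complex" / tensor_eq
  by (rule equivpI; unfold reflp_def symp_def transp_def)
     (blast intro: tensor_eq_refl tensor_eq_sym tensor_eq_trans)+

lift_definition tens :: "'a::cvector \<Rightarrow> 'b::cvector \<Rightarrow> ('a, 'b) tensor"  (infixr "\<otimes>\<^sub>C" 76)
  is "\<lambda>v w. Poly_Mapping.single (v, w) 1" .

instantiation tensor :: (cvector, cvector) cvector
begin

lift_definition zero_tensor :: "('a, 'b) tensor" is 0 .
lift_definition plus_tensor :: "('a, 'b) tensor \<Rightarrow> ('a, 'b) tensor \<Rightarrow> ('a, 'b) tensor" is "(+)"
  by (rule tensor_eq_add)
lift_definition uminus_tensor :: "('a, 'b) tensor \<Rightarrow> ('a, 'b) tensor" is uminus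
  by (rule tensor_eq_uminus)
lift_definition minus_tensor :: "('a, 'b) tensor \<Rightarrow> ('a, 'b) tensor \<Rightarrow> ('a, 'b) tensor"
  is "\<lambda>a b. a + - b"
  by (intro tensor_eq_add tensor_eq_uminus)
lift_definition cscale_tensor :: "complex \<Rightarrow> ('a, 'b) tensor \<Rightarrow> ('a, 'b) tensor" is pmscale
  by (rule tensor_eq_scale)

instance
proof
  fix a b c :: "('a, 'b) tensor" and r t :: complex
  show "a + b + c = a + (b + c)" by transfer (simp add: add.assoc tensor_eq_refl)
  show "a + b = b + a" by transfer (simp add: add.commute tensor_eq_refl)
  show "0 + a = a" by transfer (simp add: tensor_eq_refl)
  show "- a + a = 0" by transfer (simp add: tensor_eq_refl)
  show "a - b = a + - b" by transfer (simp add: tensor_eq_refl)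
  show "r *\<^sub>C (a + b) = r *\<^sub>C a + r *\<^sub>C b"
    by transfer (simp add: pmv.scale_right_distrib tensor_eq_refl)
  show "(r + t) *\<^sub>C a = r *\<^sub>C a + t *\<^sub>C a"
    by transfer (simp add: pmv.scale_left_distrib tensor_eq_refl)
  show "r *\<^sub>C t *\<^sub>C a = (r * t) *\<^sub>C a" by transfer (simp add: tensor_eq_refl)
  show "1 *\<^sub>C a = a" by transfer (simp add: tensor_eq_refl)
qed

end

lemma tens_add_left: "(v + v') \<otimes>\<^sub>C w = v \<otimes>\<^sub>C w + v' \<otimes>\<^sub>C w"
  by transfer
     (use pmv.span_base[OF tensor_rels.intros(1)] in \<open>simp add: tensor_eq_def diff_diff_eq\<close>)

lemma tens_add_right: "v \<otimes>\<^sub>C (w + w') = v \<otimes>\<^sub>C w + v \<otimes>\<^sub>C w'"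
  by transfer
     (use pmv.span_base[OF tensor_rels.intros(2)] in \<open>simp add: tensor_eq_def diff_diff_eq\<close>)

lemma pmscale_single: "pmscale c (Poly_Mapping.single k d) = Poly_Mapping.single k (c * d)"
  by (rule poly_mapping_eqI) (auto simp: lookup_single when_def)

lemma tens_cscale_left: "(c *\<^sub>C v) \<otimes>\<^sub>C w = c *\<^sub>C (v \<otimes>\<^sub>C w)"
  by transfer
     (simp add: pmscale_single tensor_eq_def pmv.span_base tensor_rels.intros(3))

lemma tens_cscale_right: "v \<otimes>\<^sub>C (c *\<^sub>C w) = c *\<^sub>C (v \<otimes>\<^sub>C w)"
  by transfer
     (simp add: pmscale_single tensor_eq_def pmv.span_base tensor_rels.intros(4))

lemma tens_zero_left [simp]: "0 \<otimes>\<^sub>C w = 0"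
  using tens_cscale_left[of 0 0 w] by simp

lemma tens_zero_right [simp]: "v \<otimes>\<^sub>C 0 = 0"
  using tens_cscale_right[of v 0 0] by simp

lemma tensor_induct [case_names tens add]:
  assumes "\<And>v w. P (v \<otimes>\<^sub>C w)" and "\<And>a b. P a \<Longrightarrow> P b \<Longrightarrow> P (a + b)"
  shows "P (t :: ('a::cvector, 'b::cvector) tensor)"
proof -
  have "P (abs_tensor a)" for a :: "('a \<times> 'b) \<Rightarrow>\<^sub>0 complex"
  proof (induction a rule: pm_induct)
    case (single k c)
    obtain v w where k: "k = (v, w)" by (cases k)
    have "abs_tensor (Poly_Mapping.single k c) = (c *\<^sub>C v) \<otimes>\<^sub>C w"
      unfolding tens_cscale_left by (simp add: k tens.abs_eq cscale_tensor.abs_eq pmscale_single)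
    then show ?case using assms(1) by simp
  next
    case (add a b)
    then show ?case using assms(2) by (metis plus_tensor.abs_eq)
  qed
  then show ?thesis by (metis Quotient_abs_rep[OF Quotient_tensor])
qed

text \<open>The linear map on the tensor product induced by a bilinear map, computed on a representative.\<close>

definition tensor_lift ::
    "('a::cvector \<Rightarrow> 'b::cvector \<Rightarrow> 'c::cvector) \<Rightarrow> ('a, 'b) tensor \<Rightarrow> 'c"
  where "tensor_lift f t = lext (\<lambda>(v, w). f v w) (rep_tensor t)"

definition cbilinear :: "('a::cvector \<Rightarrow> 'b::cvector \<Rightarrow> 'c::cvector) \<Rightarrow> bool"
  where "cbilinear f \<longleftrightarrow> (\<forall>w. clinear (\<lambda>v. f v w)) \<and> (\<forall>v. clinear (f v))"

lemma cbilinearI: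
  assumes "\<And>v v' w. f (v + v') w = f v w + f v' w" "\<And>v w w'. f v (w + w') = f v w + f v w'"
    "\<And>c v w. f (c *\<^sub>C v) w = c *\<^sub>C f v w" "\<And>c v w. f v (c *\<^sub>C w) = c *\<^sub>C f v w"
  shows "cbilinear f"
  unfolding cbilinear_def by (auto intro!: clinearI simp: assms)

lemma tensor_lift_abs:
  assumes "cbilinear f"
  shows "tensor_lift f (abs_tensor a) = lext (\<lambda>(v, w). f v w) a"
proof -
  have lin: "f (v + v') w = f v w + f v' w" "f v (w + w') = f v w + f v w'"
    "f (c *\<^sub>C v) w = c *\<^sub>C f v w" "f v (c *\<^sub>C w) = c *\<^sub>C f v w" for v v' w w' c
    using assms unfolding cbilinear_def
    by (auto simp: Vector_Spaces.linear_iff)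
  have "lext (\<lambda>(v, w). f v w) r = 0" if "r \<in> pmv.span tensor_rels" for r
    using that
  proof (induction rule: pmv.span_induct_alt)
    case (step c x y)
    from step(1) have "lext (\<lambda>(v, w). f v w) x = 0"
      by cases (simp_all add: lext_diff lin cscale_one)
    then show ?case using step by (simp add: lext_add lext_pmscale)
  qed simp
  moreover have "tensor_eq (rep_tensor (abs_tensor a)) a"
    by (rule Quotient3_rep_abs[OF Quotient3_tensor]) (simp add: tensor_eq_def pmv.span_zero)
  ultimately show ?thesis
    unfolding tensor_lift_def tensor_eq_def by (metis lext_diff right_minus_eq)
qed

lemma tensor_lift_tens:
  assumes "cbilinear f"
  shows "tensor_lift f (v \<otimes>\<^sub>C w) = f v w"
  by (simp add: tens.abs_eq tensor_lift_abs[OF assms] cscale_one)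

lemma clinear_tensor_lift:
  fixes f :: "'a::cvector \<Rightarrow> 'b::cvector \<Rightarrow> 'c::cvector"
  assumes "cbilinear f"
  shows "clinear (tensor_lift f)"
proof (rule clinearI)
  fix a b :: "('a, 'b) tensor" and c
  obtain a' b' where "a = abs_tensor a'" "b = abs_tensor b'"
    by (metis Quotient_abs_rep[OF Quotient_tensor])
  then show "tensor_lift f (a + b) = tensor_lift f a + tensor_lift f b"
    and "tensor_lift f (c *\<^sub>C a) = c *\<^sub>C tensor_lift f a"
    by (simp_all add: plus_tensor.abs_eq cscale_tensor.abs_eq tensor_lift_abs[OF assms]
        lext_add lext_pmscale)
qed

lemmas tens_simps = tens_add_left tens_add_right tens_cscale_left tens_cscale_right

instantiation tensor :: (superspace, superspace) superspace
begin

definition hcomp_tensor :: "bit \<Rightarrow> ('a, 'b) tensor \<Rightarrow> ('a, 'b) tensor"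
  where "hcomp_tensor k =
    tensor_lift (\<lambda>v w. hcomp 0 v \<otimes>\<^sub>C hcomp k w + hcomp 1 v \<otimes>\<^sub>C hcomp (k + 1) w)"

lemma cbilinear_hcomp_tensor:
  "cbilinear (\<lambda>v w. hcomp 0 v \<otimes>\<^sub>C hcomp k w + hcomp 1 v \<otimes>\<^sub>C hcomp (k + 1) w)"
  by (rule cbilinearI)
     (simp_all add: hcomp_add hcomp_cscale tens_simps cscale_add_right ac_simps)

lemma hcomp_tens:
  "hcomp k (v \<otimes>\<^sub>C w) = hcomp 0 v \<otimes>\<^sub>C hcomp k w + hcomp 1 v \<otimes>\<^sub>C hcomp (k + 1) w"
  unfolding hcomp_tensor_def by (rule tensor_lift_tens[OF cbilinear_hcomp_tensor])

lemma hcomp_tensor_add: "hcomp k (x + y) = hcomp k x + hcomp k (y :: ('a, 'b) tensor)"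
  unfolding hcomp_tensor_def by (rule clinear_add[OF clinear_tensor_lift[OF cbilinear_hcomp_tensor]])

instance
proof
  fix k j :: bit and c and x y :: "('a, 'b) tensor"
  show "hcomp k (x + y) = hcomp k x + hcomp k y"
    by (rule hcomp_tensor_add)
  show "hcomp k (c *\<^sub>C x) = c *\<^sub>C hcomp k x"
    unfolding hcomp_tensor_def
    by (rule clinear_cscale[OF clinear_tensor_lift[OF cbilinear_hcomp_tensor]])
  show "hcomp 0 x + hcomp 1 x = x"
  proof (induction x rule: tensor_induct)
    case (tens v w)
    have "hcomp 0 (v \<otimes>\<^sub>C w) + hcomp 1 (v \<otimes>\<^sub>C w)
        = (hcomp 0 v + hcomp 1 v) \<otimes>\<^sub>C (hcomp 0 w + hcomp 1 w)"
      unfolding tens_add_left tens_add_right by (simp add: hcomp_tens ac_simps)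
    then show ?case by (simp only: hcomp_sum)
  next
    case (add a b)
    have "hcomp 0 (a + b) + hcomp 1 (a + b) = (hcomp 0 a + hcomp 1 a) + (hcomp 0 b + hcomp 1 b)"
      by (simp only: hcomp_tensor_add ac_simps)
    then show ?case by (simp only: add)
  qed
  show "hcomp j (hcomp k x) = (if j = k then hcomp k x else 0)"
  proof (induction x rule: tensor_induct)
    case (tens v w)
    show ?case
      using bit_cases[of j] bit_cases[of k]
      by (auto simp: hcomp_tens hcomp_tensor_add hcomp_hcomp)
  next
    case (add a b)
    then show ?case by (simp add: hcomp_tensor_add)
  qed
qed

end

text \<open>Actions on one tensor factor: \<open>A (v \<otimes> w) = A v \<otimes> w\<close> for an endomorphism of the left factor,
  and \<open>B (v \<otimes> w) = (-1)\<^bsup>p(B) p(v)\<^esup> v \<otimes> B w\<close> for one of the right factor.\<close>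

definition tleft ::
    "('a::superspace \<Rightarrow> 'a) \<Rightarrow> ('a, 'b::superspace) tensor \<Rightarrow> ('a, 'b) tensor"
  where "tleft A = tensor_lift (\<lambda>v w. A v \<otimes>\<^sub>C w)"

definition tright ::
    "('b::superspace \<Rightarrow> 'b) \<Rightarrow> ('a::superspace, 'b) tensor \<Rightarrow> ('a, 'b) tensor"
  where "tright B = tensor_lift (\<lambda>v w. \<Sum>k\<in>{0, 1}. twist k v \<otimes>\<^sub>C gl_part k B w)"

lemma
  assumes "clinear A"
  shows tleft_tens: "tleft A (v \<otimes>\<^sub>C w) = A v \<otimes>\<^sub>C w"
    and clinear_tleft: "clinear (tleft A :: ('a::superspace, 'b::superspace) tensor \<Rightarrow> _)"
proof -
  have "cbilinear (\<lambda>v (w::'b). A v \<otimes>\<^sub>C w)"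
    by (rule cbilinearI)
       (simp_all add: tens_simps clinear_add[OF assms] clinear_cscale[OF assms])
  from clinear_tensor_lift[OF this] show "clinear (tleft A :: ('a, 'b) tensor \<Rightarrow> _)"
    by (simp add: tleft_def[abs_def])
next
  have "cbilinear (\<lambda>v w. A v \<otimes>\<^sub>C w)"
    by (rule cbilinearI)
       (simp_all add: tens_simps clinear_add[OF assms] clinear_cscale[OF assms])
  from tensor_lift_tens[OF this] show "tleft A (v \<otimes>\<^sub>C w) = A v \<otimes>\<^sub>C w"
    by (simp add: tleft_def)
qed

lemma cbilinear_tright:
  assumes "clinear B"
  shows "cbilinear (\<lambda>v w. \<Sum>k\<in>{0, 1}. twist k v \<otimes>\<^sub>C gl_part k B w)"
  by (rule cbilinearI)
     (simp_all add: tens_simps clinear_add[OF clinear_gl_part[OF assms]] cscale_add_right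
        clinear_cscale[OF clinear_gl_part[OF assms]] clinear_add[OF clinear_twist]
        clinear_cscale[OF clinear_twist] ac_simps)

lemma tright_tens:
  assumes "clinear B"
  shows "tright B (v \<otimes>\<^sub>C w) = (\<Sum>k\<in>{0, 1}. twist k v \<otimes>\<^sub>C gl_part k B w)"
  unfolding tright_def by (rule tensor_lift_tens[OF cbilinear_tright[OF assms]])

lemma clinear_tright:
  assumes "clinear B"
  shows "clinear (tright B)"
  unfolding tright_def by (rule clinear_tensor_lift[OF cbilinear_tright[OF assms]])

text \<open>The free associative algebra on the set of vectors of \<open>U\<close> is the monoid algebra of the free
  monoid (written additively) of words over \<open>U\<close>.\<close>

datatype 'u word = Word (letters: "'u list")

instantiation word :: (type) monoid_add
begin
definition zero_word :: "'a word" where "zero_word = Word []"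
definition plus_word :: "'a word \<Rightarrow> 'a word \<Rightarrow> 'a word"
  where "plus_word x y = Word (letters x @ letters y)"
instance by standard (simp_all add: zero_word_def plus_word_def)
end

type_synonym 'u free_alg = "'u word \<Rightarrow>\<^sub>0 complex"

definition fgen :: "'u \<Rightarrow> 'u free_alg"
  where "fgen u = Poly_Mapping.single (Word [u]) 1"

text \<open>The two-sided ideal presenting \<open>S(U)\<close>: linearity in \<open>U\<close> and supercommutativity.\<close>

inductive_set ssym_ideal :: "'u::superspace free_alg set"
  where
    fgen_add: "fgen (u + v) - fgen u - fgen v \<in> ssym_ideal"
  | fgen_cscale: "fgen (c *\<^sub>C u) - pmscale c (fgen u) \<in> ssym_ideal"
  | fgen_commute: "u \<in> homog j \<Longrightarrow> v \<in> homog k \<Longrightarrow>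
      fgen u * fgen v - pmscale (bsign (j * k)) (fgen v * fgen u) \<in> ssym_ideal"
  | ideal_add: "a \<in> ssym_ideal \<Longrightarrow> b \<in> ssym_ideal \<Longrightarrow> a + b \<in> ssym_ideal"
  | ideal_mult: "a \<in> ssym_ideal \<Longrightarrow> l * a * r \<in> ssym_ideal"

definition ssym_eq :: "'u::superspace free_alg \<Rightarrow> 'u free_alg \<Rightarrow> bool"
  where "ssym_eq a b \<longleftrightarrow> a - b \<in> ssym_ideal"

lemma ideal_zero: "0 \<in> ssym_ideal"
  using ideal_mult[OF fgen_add[of 0 0], of 0 0] by simp

lemma ideal_uminus: "a \<in> ssym_ideal \<Longrightarrow> - a \<in> ssym_ideal"
  using ideal_mult[of a "- 1" 1] by simp

lemma ideal_diff: "a \<in> ssym_ideal \<Longrightarrow> b \<in> ssym_ideal \<Longrightarrow> a - b \<in> ssym_ideal"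
  using ideal_add[OF _ ideal_uminus, of a b] by simp

lemma pmscale_conv_mult: "pmscale c (a :: 'k::monoid_add \<Rightarrow>\<^sub>0 complex) = Poly_Mapping.single 0 c * a"
  by (simp add: pmscale_def mult_map_scale_conv_mult)

lemma ideal_pmscale: "a \<in> ssym_ideal \<Longrightarrow> pmscale c a \<in> ssym_ideal"
  using ideal_mult[of a "Poly_Mapping.single 0 c" 1] by (simp add: pmscale_conv_mult)

lemma ssym_eq_refl: "ssym_eq a a"
  by (simp add: ssym_eq_def ideal_zero)

lemma ssym_eq_sym: "ssym_eq a b \<Longrightarrow> ssym_eq b a"
  using ideal_uminus[of "a - b"] by (simp add: ssym_eq_def)

lemma ssym_eq_trans: "ssym_eq a b \<Longrightarrow> ssym_eq b c \<Longrightarrow> ssym_eq a c"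
  using ideal_add[of "a - b" "b - c"] by (simp add: ssym_eq_def)

lemma ssym_eq_add: "ssym_eq a b \<Longrightarrow> ssym_eq c d \<Longrightarrow> ssym_eq (a + c) (b + d)"
  using ideal_add[of "a - b" "c - d"] by (simp add: ssym_eq_def add_diff_add)

lemma ssym_eq_scale: "ssym_eq a b \<Longrightarrow> ssym_eq (pmscale c a) (pmscale c b)"
  using ideal_pmscale[of "a - b" c]
  by (simp add: ssym_eq_def pmv.scale_right_diff_distrib)

lemma ssym_eq_uminus: "ssym_eq a b \<Longrightarrow> ssym_eq (- a) (- b)"
  using ssym_eq_scale[of a b "- 1"] by simp

lemma ssym_eq_mult:
  assumes "ssym_eq a b" "ssym_eq c d"
  shows "ssym_eq (a * c) (b * d)"
proof -
  have "1 * (a - b) * c + b * (c - d) * 1 \<in> ssym_ideal"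
    using assms unfolding ssym_eq_def by (intro ideal_add ideal_mult)
  then show ?thesis
    by (simp add: ssym_eq_def left_diff_distrib right_diff_distrib)
qed

quotient_type (overloaded) 'u ssym = "'u::superspace free_alg" / ssym_eq
  by (rule equivpI; unfold reflp_def symp_def transp_def)
     (blast intro: ssym_eq_refl ssym_eq_sym ssym_eq_trans)+

lemma pmscale_mult_left: "pmscale c a * b = pmscale c (a * (b :: 'k::monoid_add \<Rightarrow>\<^sub>0 complex))"
  by (simp add: pmscale_conv_mult mult.assoc)

lemma pmscale_mult_right: "a * pmscale c b = pmscale c (a * (b :: 'k::monoid_add \<Rightarrow>\<^sub>0 complex))"
proof (induction a rule: pm_induct)
  case (single x d)
  show ?case
    by (induction b rule: pm_induct)
       (simp_all add: pmscale_single mult_single pmv.scale_right_distrib distrib_left mult.left_commute)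
next
  case (add a b)
  then show ?case by (simp add: distrib_right pmv.scale_right_distrib)
qed

lemma lookup_ssym_ideal: "a \<in> ssym_ideal \<Longrightarrow> Poly_Mapping.lookup a 0 = 0"
proof (induction rule: ssym_ideal.induct)
  case (ideal_mult a l r)
  have mult: "Poly_Mapping.lookup (x * y) 0 = Poly_Mapping.lookup x 0 * Poly_Mapping.lookup y 0"
    for x y :: "'a free_alg"
  proof (induction x rule: pm_induct)
    case (single k c)
    show ?case
    proof (induction y rule: pm_induct)
      case (single k' c')
      have "k + k' = 0 \<longleftrightarrow> k = 0 \<and> k' = 0"
        by (cases k; cases k') (auto simp: plus_word_def zero_word_def)
      then show ?case by (auto simp: mult_single lookup_single when_def)
    qed (simp add: distrib_left lookup_add)
  qed (simp add: distrib_right lookup_add)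
  show ?case using ideal_mult by (simp add: mult)
qed (auto simp: lookup_minus lookup_add lookup_single fgen_def zero_word_def mult_single plus_word_def)

instantiation ssym :: (superspace) ring_1
begin

lift_definition zero_ssym :: "'a ssym" is 0 .
lift_definition one_ssym :: "'a ssym" is 1 .
lift_definition plus_ssym :: "'a ssym \<Rightarrow> 'a ssym \<Rightarrow> 'a ssym" is "(+)"
  by (rule ssym_eq_add)
lift_definition uminus_ssym :: "'a ssym \<Rightarrow> 'a ssym" is uminus
  by (rule ssym_eq_uminus)
lift_definition minus_ssym :: "'a ssym \<Rightarrow> 'a ssym \<Rightarrow> 'a ssym" is "\<lambda>a b. a + - b"
  by (intro ssym_eq_add ssym_eq_uminus)
lift_definition times_ssym :: "'a ssym \<Rightarrow> 'a ssym \<Rightarrow> 'a ssym" is "(*)"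
  by (rule ssym_eq_mult)

instance
proof
  fix a b c :: "'a ssym"
  show "a + b + c = a + (b + c)" by transfer (simp add: add.assoc ssym_eq_refl)
  show "a + b = b + a" by transfer (simp add: add.commute ssym_eq_refl)
  show "0 + a = a" by transfer (simp add: ssym_eq_refl)
  show "- a + a = 0" by transfer (simp add: ssym_eq_refl)
  show "a - b = a + - b" by transfer (simp add: ssym_eq_refl)
  show "a * b * c = a * (b * c)" by transfer (simp add: mult.assoc ssym_eq_refl)
  show "1 * a = a" by transfer (simp add: ssym_eq_refl)
  show "a * 1 = a" by transfer (simp add: ssym_eq_refl)
  show "(a + b) * c = a * c + b * c" by transfer (simp add: distrib_right ssym_eq_refl)
  show "a * (b + c) = a * b + a * c" by transfer (simp add: distrib_left ssym_eq_refl)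
  show "(0::'a ssym) \<noteq> 1"
  proof (transfer, rule notI)
    assume "ssym_eq (0::'a free_alg) 1"
    then have "Poly_Mapping.lookup (0 - 1 :: 'a free_alg) 0 = 0"
      unfolding ssym_eq_def by (rule lookup_ssym_ideal)
    then show False by (simp add: lookup_minus)
  qed
qed

end

instantiation ssym :: (superspace) cvector
begin

lift_definition cscale_ssym :: "complex \<Rightarrow> 'a ssym \<Rightarrow> 'a ssym" is pmscale
  by (rule ssym_eq_scale)

instance
proof
  fix a b :: "'a ssym" and r t :: complex
  show "r *\<^sub>C (a + b) = r *\<^sub>C a + r *\<^sub>C b"
    by transfer (simp add: pmv.scale_right_distrib ssym_eq_refl)
  show "(r + t) *\<^sub>C a = r *\<^sub>C a + t *\<^sub>C a"
    by transfer (simp add: pmv.scale_left_distrib ssym_eq_refl)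
  show "r *\<^sub>C t *\<^sub>C a = (r * t) *\<^sub>C a" by transfer (simp add: ssym_eq_refl)
  show "1 *\<^sub>C a = a" by transfer (simp add: ssym_eq_refl)
qed

end

lift_definition sgen :: "'u::superspace \<Rightarrow> 'u ssym" is fgen .

lemma ssym_scale_mult_left: "(c *\<^sub>C a) * b = c *\<^sub>C (a * b)" for a b :: "'u::superspace ssym"
  by transfer (simp add: ssym_eq_def ideal_zero pmscale_mult_left)

lemma ssym_scale_mult_right: "a * (c *\<^sub>C b) = c *\<^sub>C (a * b)" for a b :: "'u::superspace ssym"
  by transfer (simp add: ssym_eq_def ideal_zero pmscale_mult_right)

lemma clinear_sgen: "clinear sgen"
proof (rule clinearI)
  fix x y :: 'a and c
  show "sgen (x + y) = sgen x + sgen y"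
    by transfer (unfold ssym_eq_def diff_diff_eq[symmetric], rule fgen_add)
  show "sgen (c *\<^sub>C x) = c *\<^sub>C sgen x"
    by transfer (unfold ssym_eq_def, rule fgen_cscale)
qed

lemma sgen_commute:
  assumes "u \<in> homog j" "v \<in> homog k"
  shows "sgen u * sgen v = bsign (j * k) *\<^sub>C (sgen v * sgen u)"
  using assms by transfer (unfold ssym_eq_def, rule fgen_commute)

lemma abs_ssym_single:
  "abs_ssym (Poly_Mapping.single (Word us) c) = c *\<^sub>C prod_list (map sgen us)"
proof -
  have "abs_ssym (Poly_Mapping.single (Word us) 1) = prod_list (map sgen us)"
  proof (induction us)
    case Nil
    have "Poly_Mapping.single (Word []) 1 = (1 :: 'a free_alg)"
      by (metis single_one zero_word_def)
    then show ?case by (simp add: one_ssym_def)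
  next
    case (Cons u us)
    have "Poly_Mapping.single (Word (u # us)) 1 = fgen u * Poly_Mapping.single (Word us) (1::complex)"
      by (simp add: fgen_def mult_single plus_word_def)
    then show ?case using Cons
      by (simp add: times_ssym.abs_eq[symmetric] sgen.abs_eq[symmetric])
  qed
  moreover have "Poly_Mapping.single (Word us) c = pmscale c (Poly_Mapping.single (Word us) 1)"
    by (simp add: pmscale_single)
  ultimately show ?thesis by (simp add: cscale_ssym.abs_eq[symmetric])
qed

lemma ssym_induct [case_names one sgen_mult add]:
  assumes "\<And>c. P (c *\<^sub>C 1)" and "\<And>u a. P a \<Longrightarrow> P (sgen u * a)"
    and "\<And>a b. P a \<Longrightarrow> P b \<Longrightarrow> P (a + b)"
  shows "P (a :: 'u::superspace ssym)"
proof -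
  have "P (c *\<^sub>C prod_list (map sgen us))" for c :: complex and us :: "'u list"
    by (induction us) (simp_all add: assms(1) assms(2) ssym_scale_mult_right[symmetric])
  then have "P (abs_ssym a)" for a
    by (induction a rule: pm_induct)
       (metis abs_ssym_single word.exhaust, metis assms(3) plus_ssym.abs_eq)
  then show ?thesis by (metis Quotient_abs_rep[OF Quotient_ssym])
qed

text \<open>\<open>sder T\<close> is the superderivation of \<open>S(U)\<close> extending the endomorphism \<open>T\<close> of \<open>U\<close>, with both
  parity components of \<open>T\<close> treated separately; for homogeneous \<open>T\<close> and \<open>u\<close>
  \<open>D (u a) = T u a + (-1)\<^bsup>p(T) p(u)\<^esup> u D a\<close>. It is computed on a representative.\<close>

primrec sder_word ::
    "bit \<Rightarrow> ('u::superspace \<Rightarrow> 'u) \<Rightarrow> 'u list \<Rightarrow> 'u ssym"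
  where
    "sder_word k T [] = 0"
  | "sder_word k T (u # us) =
       sgen (gl_part k T u) * prod_list (map sgen us) + sgen (twist k u) * sder_word k T us"

definition sder :: "('u::superspace \<Rightarrow> 'u) \<Rightarrow> 'u ssym \<Rightarrow> 'u ssym"
  where "sder T a = (\<Sum>k\<in>{0, 1}. lext (\<lambda>x. sder_word k T (letters x)) (rep_ssym a))"

definition stwist_free :: "bit \<Rightarrow> 'u::superspace free_alg \<Rightarrow> 'u ssym"
  where "stwist_free k = lext (\<lambda>x. prod_list (map (\<lambda>u. sgen (twist k u)) (letters x)))"

definition sder_free :: "bit \<Rightarrow> ('u::superspace \<Rightarrow> 'u) \<Rightarrow> 'u free_alg \<Rightarrow> 'u ssym"
  where "sder_free k T = lext (\<lambda>x. sder_word k T (letters x))"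

lemma twist_hom: "u \<in> homog j \<Longrightarrow> twist k u \<in> homog j"
  by (simp add: twist_homog homog_def hcomp_cscale)

lemma gl_part_hom:
  assumes "clinear T" "u \<in> homog j"
  shows "gl_part k T u \<in> homog (k + j)"
  by (simp add: gl_part_homog[OF assms] homog_def hcomp_hcomp)

lemma stwist_free_mult: "stwist_free k (a * b) = stwist_free k a * stwist_free k b"
proof (induction a rule: pm_induct)
  case (single x c)
  show ?case
    by (induction b rule: pm_induct)
       (simp_all add: stwist_free_def mult_single plus_word_def ssym_scale_mult_left
          ssym_scale_mult_right cscale_cscale lext_add distrib_left)
next
  case (add a b)
  then show ?case by (simp add: stwist_free_def distrib_right lext_add)
qed

lemma stwist_free_ideal:
  assumes "a \<in> ssym_ideal"
  shows "stwist_free k a = 0"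
  using assms
proof (induction rule: ssym_ideal.induct)
  case (fgen_add u v)
  then show ?case
    by (simp add: stwist_free_def fgen_def lext_diff clinear_add[OF clinear_twist]
        clinear_add[OF clinear_sgen] cscale_one)
next
  case (fgen_cscale c u)
  then show ?case
    by (simp add: stwist_free_def fgen_def lext_diff clinear_cscale[OF clinear_twist] pmscale_single
        clinear_cscale[OF clinear_sgen] cscale_one)
next
  case (fgen_commute u i v j)
  then show ?case
    using sgen_commute[OF twist_hom[OF fgen_commute(1)] twist_hom[OF fgen_commute(2)]]
    by (simp add: stwist_free_def fgen_def lext_diff lext_pmscale mult_single plus_word_def cscale_one)
next
  case (ideal_add a b)
  then show ?case by (simp add: stwist_free_def lext_add)
next
  case (ideal_mult a l r)
  then show ?case by (simp add: stwist_free_mult)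
qed

lemma sder_word_append:
  "sder_word k T (us @ vs) = sder_word k T us * prod_list (map sgen vs)
     + prod_list (map (\<lambda>u. sgen (twist k u)) us) * sder_word k T vs"
  by (induction us) (simp_all add: algebra_simps)

lemma sder_free_mult:
  "sder_free k T (a * b) = sder_free k T a * abs_ssym b + stwist_free k a * sder_free k T b"
proof (induction a rule: pm_induct)
  case (single x c)
  show ?case
  proof (induction b rule: pm_induct)
    case (single y d)
    show ?case
      by (cases x; cases y)
         (simp add: sder_free_def stwist_free_def mult_single plus_word_def sder_word_append
            abs_ssym_single ssym_scale_mult_left ssym_scale_mult_right cscale_cscale
            cscale_add_right mult.commute)
  next
    case (add a b)
    then show ?case
      by (simp add: sder_free_def distrib_left lext_add plus_ssym.abs_eq[symmetric] algebra_simps)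
  qed
next
  case (add a b)
  then show ?case
    by (simp add: sder_free_def stwist_free_def distrib_right lext_add algebra_simps)
qed

lemma abs_ssym_ideal: "a \<in> ssym_ideal \<Longrightarrow> abs_ssym a = 0"
  by (simp add: zero_ssym.abs_eq ssym.abs_eq_iff ssym_eq_def zero_ssym_def)

lemma sder_free_ideal:
  assumes T: "clinear T" and "a \<in> ssym_ideal"
  shows "sder_free k T a = 0"
  using assms(2)
proof (induction rule: ssym_ideal.induct)
  case (fgen_add u v)
  then show ?case
    by (simp add: sder_free_def fgen_def lext_diff clinear_add[OF clinear_gl_part[OF T]]
        clinear_add[OF clinear_sgen] cscale_one)
next
  case (fgen_cscale c u)
  then show ?case
    by (simp add: sder_free_def fgen_def lext_diff clinear_cscale[OF clinear_gl_part[OF T]]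
        pmscale_single clinear_cscale[OF clinear_sgen] cscale_one)
next
  case (fgen_commute u i v j)
  let ?Tu = "gl_part k T u" and ?Tv = "gl_part k T v"
  have 1: "sgen ?Tu * sgen v = bsign ((k + i) * j) *\<^sub>C (sgen v * sgen ?Tu)"
    by (rule sgen_commute[OF gl_part_hom[OF T fgen_commute(1)] fgen_commute(2)])
  have 2: "sgen u * sgen ?Tv = bsign (i * (k + j)) *\<^sub>C (sgen ?Tv * sgen u)"
    by (rule sgen_commute[OF fgen_commute(1) gl_part_hom[OF T fgen_commute(2)]])
  show ?case
    using bit_cases[of i] bit_cases[of j] bit_cases[of k]
    by (auto simp: sder_free_def fgen_def lext_diff lext_pmscale mult_single plus_word_def
        cscale_one twist_homog[OF fgen_commute(1)] twist_homog[OF fgen_commute(2)]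
        clinear_cscale[OF clinear_sgen] ssym_scale_mult_left 1 2 bsign_def)
next
  case (ideal_add a b)
  then show ?case by (simp add: sder_free_def lext_add)
next
  case (ideal_mult a l r)
  then show ?case by (simp add: sder_free_mult stwist_free_mult stwist_free_ideal abs_ssym_ideal)
qed

lemma sder_abs:
  assumes "clinear T"
  shows "sder T (abs_ssym a) = (\<Sum>k\<in>{0, 1}. sder_free k T a)"
proof -
  have "ssym_eq (rep_ssym (abs_ssym a)) a"
    by (rule Quotient3_rep_abs[OF Quotient3_ssym]) (simp add: ssym_eq_def ideal_zero)
  then have "sder_free k T (rep_ssym (abs_ssym a)) = sder_free k T a" for k
    using sder_free_ideal[OF assms, of "rep_ssym (abs_ssym a) - a" k]
    by (simp add: ssym_eq_def sder_free_def lext_diff)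
  then show ?thesis by (simp add: sder_def sder_free_def)
qed

lemma clinear_sder:
  fixes T :: "'a::superspace \<Rightarrow> 'a"
  assumes "clinear T"
  shows "clinear (sder T)"
proof (rule clinearI)
  fix a b :: "'a ssym" and c
  obtain a' b' where "a = abs_ssym a'" "b = abs_ssym b'"
    by (metis Quotient_abs_rep[OF Quotient_ssym])
  then show "sder T (a + b) = sder T a + sder T b" and "sder T (c *\<^sub>C a) = c *\<^sub>C sder T a"
    by (simp_all add: plus_ssym.abs_eq cscale_ssym.abs_eq sder_abs[OF assms] sder_free_def
        lext_add lext_pmscale cscale_add_right ac_simps)
qed

lemma sder_one: "clinear T \<Longrightarrow> sder T 1 = 0"
  by (simp add: one_ssym.abs_eq one_ssym_def sder_abs sder_free_def
      single_one[symmetric] zero_word_def del: single_one)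

lemma gl_part_gl_part:
  assumes "clinear T"
  shows "gl_part j (gl_part k T) = (if j = k then gl_part k T else (\<lambda>_. 0))"
proof
  fix v
  show "gl_part j (gl_part k T) v = (if j = k then gl_part k T else (\<lambda>_. 0)) v"
    using clinear_cscale[OF assms, of 0 0] bit_cases[of j] bit_cases[of k]
    by (auto simp: gl_part_def hcomp_hcomp hcomp_add)
qed

lemma sder_gl_part:
  assumes "clinear T"
  shows "sder (gl_part k T) (abs_ssym a) = sder_free k T a"
proof -
  have same: "sder_word k (gl_part k T) us = sder_word k T us" for k and us :: "'a list"
    by (induction us) (simp_all add: gl_part_gl_part[OF assms])
  have sgen0: "sgen (0::'a) = 0"
    using clinear_cscale[OF clinear_sgen, of 0 "0::'a"] by simp
  have other: "sder_word j (gl_part k T) us = 0" if "j \<noteq> k" for j k and us :: "'a list"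
    using that by (induction us) (simp_all add: gl_part_gl_part[OF assms] sgen0)
  have other': "lext (\<lambda>x. 0) a = (0::'a ssym)" by (simp add: lext_def)
  show ?thesis
    using bit_cases[of k]
    by (auto simp: sder_abs[OF clinear_gl_part[OF assms]] sder_free_def same other other')
qed

lemma sder_sgen_mult:
  assumes "clinear T"
  shows "sder T (sgen u * a) =
     sgen (T u) * a + (\<Sum>k\<in>{0, 1}. sgen (twist k u) * sder (gl_part k T) a)"
proof -
  obtain a' where a: "a = abs_ssym a'"
    by (metis Quotient_abs_rep[OF Quotient_ssym])
  have "sder_free k T (fgen u * a') = sgen (gl_part k T u) * a + sgen (twist k u) * sder (gl_part k T) a"
    for k
    by (simp add: sder_free_mult a sder_gl_part[OF assms])
       (simp add: sder_free_def stwist_free_def fgen_def cscale_one)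
  moreover have "sgen (T u) = sgen (gl_part 0 T u) + sgen (gl_part 1 T u)"
    by (metis clinear_add[OF clinear_sgen] gl_part_sum[OF assms])
  ultimately show ?thesis
    by (simp add: a sgen.abs_eq times_ssym.abs_eq sder_abs[OF assms] algebra_simps)
qed

definition gl_act_V ::
    "('v::superspace \<Rightarrow> 'v) \<Rightarrow> ('v dual, 'w::superspace) tensor ssym \<Rightarrow> ('v dual, 'w) tensor ssym"
  where "gl_act_V A = sder (tleft (dual_act A))"

definition gl_act_W ::
    "('w::superspace \<Rightarrow> 'w) \<Rightarrow> ('v::superspace dual, 'w) tensor ssym \<Rightarrow> ('v dual, 'w) tensor ssym"
  where "gl_act_W B = sder (tright B)"

definition invariants ::
    "('v::superspace \<Rightarrow> 'v) set \<Rightarrow> ('v dual, 'w::superspace) tensor ssym set"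
  where "invariants g = {a. \<forall>A\<in>g. gl_act_V A a = 0}"

text \<open>The image of the universal enveloping algebra of \<open>gl(W)\<close> in the endomorphisms of
  \<open>S(V\<^sup>* \<otimes> W)\<close>.\<close>

inductive_set polarizations ::
    "(('v::superspace dual, 'w::superspace) tensor ssym \<Rightarrow> ('v dual, 'w) tensor ssym) set"
  where
    "(\<lambda>a. a) \<in> polarizations"
  | "B \<in> gl \<Longrightarrow> gl_act_W B \<in> polarizations"
  | "P \<in> polarizations \<Longrightarrow> Q \<in> polarizations \<Longrightarrow> P \<circ> Q \<in> polarizations"
  | "P \<in> polarizations \<Longrightarrow> Q \<in> polarizations \<Longrightarrow> (\<lambda>a. P a + Q a) \<in> polarizations"
  | "P \<in> polarizations \<Longrightarrow> (\<lambda>a. c *\<^sub>C P a) \<in> polarizations"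

definition subalgebra :: "'u::superspace ssym set \<Rightarrow> bool"
  where "subalgebra N \<longleftrightarrow> cvs.subspace N \<and> 1 \<in> N \<and> (\<forall>a\<in>N. \<forall>b\<in>N. a * b \<in> N)"

definition basic_set ::
    "('v::superspace \<Rightarrow> 'v) set \<Rightarrow> ('v dual, 'w::superspace) tensor ssym set \<Rightarrow> bool"
  where "basic_set g M \<longleftrightarrow> M \<subseteq> invariants g \<and>
    invariants g = \<Inter> {N. subalgebra N \<and> M \<subseteq> N \<and> (\<forall>P\<in>polarizations. P ` N \<subseteq> N)}"

text \<open>\<open>Ev i\<close> stands for the index \<open>i\<close> and \<open>Od i\<close> for the barred index.\<close>

datatype sindex = Ev nat | Od nat

fun par :: "sindex \<Rightarrow> bit"
  where
    "par (Ev i) = 0"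
  | "par (Od i) = 1"

definition indices :: "nat \<Rightarrow> nat \<Rightarrow> sindex set"
  where "indices p q = Ev ` {1..p} \<union> Od ` {1..q}"

definition homogeneous_basis :: "nat \<Rightarrow> nat \<Rightarrow> (sindex \<Rightarrow> 'a::superspace) \<Rightarrow> bool"
  where "homogeneous_basis p q e \<longleftrightarrow>
    inj_on e (indices p q) \<and> cvs.independent (e ` indices p q) \<and> cvs.span (e ` indices p q) = UNIV \<and>
    (\<forall>i\<in>indices p q. e i \<in> homog (par i))"

definition dual_basis :: "nat \<Rightarrow> nat \<Rightarrow> (sindex \<Rightarrow> 'a::superspace) \<Rightarrow> sindex \<Rightarrow> 'a dual"
  where "dual_basis p q e i =
    (THE f. \<forall>j\<in>indices p q. dual_app f (e j) = (if i = j then 1 else 0))"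

lemma dual_basis_apply:
  fixes e :: "sindex \<Rightarrow> 'a::superspace"
  assumes e: "homogeneous_basis p q e" and j: "j \<in> indices p q"
  shows "dual_app (dual_basis p q e i) (e j) = (if i = j then 1 else 0)"
proof -
  interpret vsp: vector_space_pair "cscale :: complex \<Rightarrow> 'a \<Rightarrow> 'a" "(*) :: complex \<Rightarrow> complex \<Rightarrow> complex"
    by unfold_locales (auto simp: algebra_simps)
  let ?X = "indices p q"
  let ?P = "\<lambda>f. \<forall>j\<in>?X. dual_app f (e j) = (if i = j then 1 else 0)"
  have inj: "inj_on e ?X" and ind: "cvs.independent (e ` ?X)" and sp: "cvs.span (e ` ?X) = UNIV"
    using e by (auto simp: homogeneous_basis_def)
  define h where "h v = (if i = the_inv_into ?X e v then 1 else (0::complex))" for v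
  obtain f where f: "Vector_Spaces.linear cscale (*) f" "\<forall>x\<in>e ` ?X. f x = h x"
    using vsp.linear_independent_extend[OF ind, of h] by auto
  have ex: "?P (Abs_dual f)"
    using f(2) by (simp add: Abs_dual_inverse f(1) h_def the_inv_into_f_f[OF inj])
  have uniq: "g = g'" if "?P g" "?P g'" for g g'
  proof -
    have "dual_app g = dual_app g'"
    proof
      fix v
      have "v \<in> cvs.span (e ` ?X)" using sp by simp
      then show "dual_app g v = dual_app g' v"
        using dual_app[of g] dual_app[of g'] that
        by (elim vsp.linear_eq_on[rotated 2]) auto
    qed
    then show ?thesis by (simp add: dual_app_inject)
  qed
  have "?P (dual_basis p q e i)"
    unfolding dual_basis_def by (rule theI[of ?P, OF ex]) (rule uniq[OF _ ex])
  then show ?thesis using j by simp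
qed

definition odd_form :: "nat \<Rightarrow> (sindex \<Rightarrow> 'v::superspace) \<Rightarrow> ('v dual, 'v dual) tensor"
  where "odd_form n e = (let e' = dual_basis n n e in
    \<Sum>i\<in>{1..n}. e' (Ev i) \<otimes>\<^sub>C e' (Od i) + e' (Od i) \<otimes>\<^sub>C e' (Ev i))"

text \<open>An endomorphism acts on a tensor product by \<open>A \<otimes> 1 + 1 \<otimes> A\<close>; preserving a tensor means that the
  Lie algebra element annihilates it.\<close>

definition pe :: "nat \<Rightarrow> (sindex \<Rightarrow> 'v::superspace) \<Rightarrow> ('v \<Rightarrow> 'v) set"
  where "pe n e = {A \<in> gl.
    tleft (dual_act A) (odd_form n e) + tright (dual_act A) (odd_form n e) = 0}"

definition xgen ::
    "nat \<Rightarrow> (sindex \<Rightarrow> 'v::superspace) \<Rightarrow> (sindex \<Rightarrow> 'w::superspace) \<Rightarrow>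
     sindex \<Rightarrow> sindex \<Rightarrow> ('v dual, 'w) tensor ssym"
  where "xgen n e w i s = sgen (dual_basis n n e i \<otimes>\<^sub>C w s)"

definition inner_product ::
    "nat \<Rightarrow> (sindex \<Rightarrow> 'v::superspace) \<Rightarrow> (sindex \<Rightarrow> 'w::superspace) \<Rightarrow>
     sindex \<Rightarrow> sindex \<Rightarrow> ('v dual, 'w) tensor ssym"
  where "inner_product n e w s t = (let x = xgen n e w in
    \<Sum>i\<in>{1..n}. bsign (par s) *\<^sub>C (x (Ev i) s * x (Od i) t) + x (Od i) s * x (Ev i) t)"

end

theory Submission
  imports Defs "HOL-Library.Function_Algebras"
begin

text \<open>
  Supersymmetric functions on words over the letters \<open>x\<^bsub>is\<^esub>\<close> form a Fock space with creation and
  annihilation operators, and \<open>S(V\<^sup>* \<otimes> W)\<close> embeds into it. We adjoin to \<open>W\<close> a frame of \<open>n\<close> even vectors.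
  For the Fischer inner product the adjoint of a polarization is a polarization, hence the orthogonal
  complement, among the invariants, of the span \<open>R\<close> of the products of inner products is stable under
  polarizations. If it were nonzero it would contain an \<open>f \<noteq> 0\<close> annihilated by all operators that replace
  a vector outside the frame by one of the frame. Such an invariant is determined by its restriction to
  the slice where the unbarred coordinates of the frame form the identity matrix and all other unbarred
  coordinates vanish. On the slice, invariance under the odd part of \<open>pe(V)\<close> yields
  \<open>\<Sum> Z\<^sup>* Z f = 0\<close> for first-order operators \<open>Z\<close>, so \<open>Z f = 0\<close> by positivity. This says precisely that
  the polynomial in inner products with the same restriction to the slice is annihilated by the same
  operators as \<open>f\<close>. The two therefore coincide, so \<open>f\<close> lies in \<open>R\<close> and is orthogonal to itself.
\<close>

section \<open>Linear maps\<close>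

text \<open>The Fischer adjoint does not preserve \<open>pe(V)\<close>: its two odd parts consist of
  antisymmetric and of symmetric matrices, and adjunction would interchange them. Unitarity is
  therefore used on the side of W, where adjunction transposes matrix units. The frame is adjoined
  because W may contain fewer than n even vectors, and the unbarred coordinates of even vectors are
  the commuting ones that can be set to an identity matrix. It is removed at the end by the
  homomorphism sending its letters to zero, which fixes the inner products of vectors of W and kills
  the others. The identity matrix stands for a generic point. Instead of orbits and density the
  proof uses derivatives: invariance under the even part and the vanishing of the replacing
  operators express every derivative transverse to the slice through tangential ones, so restriction
  loses nothing. The odd equations turning barred coordinates into unbarred ones make the
  restriction symmetric in the frame; those in the opposite direction give the equation to which
  positivity applies.\<close>

instantiation complex :: cvector
begin
definition cscale_complex :: "complex \<Rightarrow> complex \<Rightarrow> complex" where "cscale_complex c x = c * x"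
instance by standard (simp_all add: cscale_complex_def algebra_simps)
end

text \<open>With scalars and states both in \<open>cvector\<close>, the single notion
  \<open>clinear\<close> covers operators on states and functionals such as
  \<open>ip L m f\<close>.\<close>

instantiation "fun" :: (type, cvector) cvector
begin
definition cscale_fun :: "complex \<Rightarrow> ('a \<Rightarrow> 'b) \<Rightarrow> 'a \<Rightarrow> 'b" where "cscale_fun c f x = c *\<^sub>C f x"
instance
  by standard
    (simp_all add: cscale_fun_def fun_eq_iff cscale_add_right cscale_add_left cscale_cscale cscale_one)
end

lemmas cscale_simps [simp] = cscale_complex_def cscale_fun_def

lemma clinear_zero: "clinear f \<Longrightarrow> f 0 = 0"
  using clinear_cscale[of f 0 0] by simp

lemma clinear_uminus: "clinear f \<Longrightarrow> f (- x) = - f x"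
  using clinear_cscale[of f "- 1" x] by simp

lemma clinear_diff: "clinear f \<Longrightarrow> f (x - y) = f x - f y"
  using clinear_add[of f x "- y"] by (simp add: clinear_uminus)

lemma clinear_sum: "clinear f \<Longrightarrow> f (\<Sum>i\<in>A. g i) = (\<Sum>i\<in>A. f (g i))"
  by (induction A rule: infinite_finite_induct) (simp_all add: clinear_zero clinear_add)

lemmas clin = clinear_zero clinear_uminus clinear_diff clinear_add clinear_cscale clinear_sum

lemma clinear_id: "clinear (\<lambda>x. x)"
  by (rule clinearI) simp_all

lemma clinear_const0: "clinear (\<lambda>x. 0)"
  by (rule clinearI) simp_all

lemma clinear_compose: "clinear f \<Longrightarrow> clinear g \<Longrightarrow> clinear (\<lambda>x. f (g x))"
  by (rule clinearI) (simp_all add: clin)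

lemma clinear_compose_cscale: "clinear f \<Longrightarrow> clinear (\<lambda>x. c *\<^sub>C f x)"
  by (rule clinearI) (simp_all add: clin cscale_add_right cscale_cscale mult.commute)

lemma clinear_compose_sum: "(\<And>i. i \<in> A \<Longrightarrow> clinear (f i)) \<Longrightarrow> clinear (\<lambda>x. \<Sum>i\<in>A. f i x)"
  by (rule clinearI) (simp_all add: clin sum.distrib cvs.scale_sum_right)

lemma sum_fun_apply: "(\<Sum>i\<in>A. f i) x = (\<Sum>i\<in>A. f i x)"
  by (induction A rule: infinite_finite_induct) simp_all

lemma sum_of_bool_cscale:
  assumes "finite A"
  shows "(\<Sum>a\<in>A. of_bool (a = b) *\<^sub>C f a) = (if b \<in> A then f b else 0)"
    and "(\<Sum>a\<in>A. of_bool (b = a) *\<^sub>C f a) = (if b \<in> A then f b else 0)"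
proof -
  have "of_bool (a = b) *\<^sub>C f a = (if a = b then f b else 0)" for a
    by (simp add: cscale_one)
  then show "(\<Sum>a\<in>A. of_bool (a = b) *\<^sub>C f a) = (if b \<in> A then f b else 0)"
    using assms by simp
  then show "(\<Sum>a\<in>A. of_bool (b = a) *\<^sub>C f a) = (if b \<in> A then f b else 0)"
    by (simp add: eq_commute)
qed

lemma add_of_nat_cscale: "y + of_nat k *\<^sub>C y = of_nat (Suc k) *\<^sub>C y"
  by (simp add: cscale_add_left)

lemma bsign_simps [simp]: "bsign 0 = 1" "bsign 1 = - 1" "bsign k * bsign k = 1"
  "bsign k * (bsign k * z) = z" "cnj (bsign k) = bsign k"
  by (simp_all add: bsign_def)

lemma bsign_add: "bsign (j + k) = bsign j * bsign k"
  using bit_cases[of j] bit_cases[of k] by (auto simp: bsign_def)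

section \<open>Supersymmetric functions on words\<close>

type_synonym letter = "sindex \<times> sindex"
type_synonym state = "letter list \<Rightarrow> complex"

definition lpar :: "letter \<Rightarrow> bit" where "lpar a = par (fst a) + par (snd a)"

definition sg :: "letter \<Rightarrow> letter \<Rightarrow> complex" where "sg a b = bsign (lpar a * lpar b)"

lemma sg_commute: "sg a b = sg b a"
  by (simp add: sg_def mult.commute)

lemma sg_sg [simp]: "sg a b * sg a b = 1" "sg a b * sg b a = 1" "sg a b * (sg a b * z) = z"
  "sg a b * (sg b a * z) = z"
  by (simp_all add: sg_def mult.commute[of "lpar b"])

text \<open>A state stores unnormalized Taylor coefficients: \<open>f w\<close> is the constant term
  left after differentiating along the letters of \<open>w\<close>, first letter first. Accordingly
  \<open>ann b\<close> is the superderivative in the variable \<open>b\<close>.\<close>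

definition ann :: "letter \<Rightarrow> state \<Rightarrow> state" where "ann b f w = f (b # w)"

text \<open>The second summand moves \<open>a\<close> past the first letter of the word, so \<open>cre a\<close> is the
  supersymmetrized insertion of \<open>a\<close>. With this definition \<open>cre\<close> and \<open>ann\<close> satisfy the super
  canonical commutation relations, and the words \<open>cre a\<^sub>1 (\<dots> (cre a\<^sub>m vac))\<close> form a model of the
  free supercommutative algebra on the letters.\<close>

fun cre :: "letter \<Rightarrow> state \<Rightarrow> state" where
  "cre a f [] = 0"
| "cre a f (b # w) = (if a = b then f w else 0) + sg a b * cre a (ann b f) w"

definition vac :: state where "vac w = (if w = [] then 1 else 0)"

lemma clinear_ann: "clinear (ann b)"
  by (rule clinearI) (auto simp: ann_def fun_eq_iff)

lemmas ann_lin = clin[OF clinear_ann]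

lemma clinear_cre: "clinear (cre a)"
proof (rule clinearI)
  show "cre a (f + g) = cre a f + cre a g" for f g
  proof
    show "cre a (f + g) w = (cre a f + cre a g) w" for w
      by (induction w arbitrary: f g) (simp_all add: ann_lin algebra_simps)
  qed
  show "cre a (c *\<^sub>C f) = c *\<^sub>C cre a f" for c f
  proof
    show "cre a (c *\<^sub>C f) w = (c *\<^sub>C cre a f) w" for w
      by (induction w arbitrary: f) (auto simp: ann_lin algebra_simps)
  qed
qed

lemmas cre_lin = clin[OF clinear_cre]

lemma ann_cre: "ann b (cre a f) = of_bool (a = b) *\<^sub>C f + sg a b *\<^sub>C cre a (ann b f)"
  by (simp add: ann_def fun_eq_iff)

lemma ann_vac [simp]: "ann b vac = 0"
  by (simp add: ann_def vac_def fun_eq_iff)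

lemma cre_cre: "cre a (cre b f) = sg a b *\<^sub>C cre b (cre a f)"
proof
  show "cre a (cre b f) w = (sg a b *\<^sub>C cre b (cre a f)) w" for w
  proof (induction w arbitrary: f)
    case (Cons e w)
    then show ?case
      by (auto simp: ann_cre cre_lin algebra_simps sg_commute)
  qed simp
qed

text \<open>Adjacent transpositions suffice for the sign rule. For an odd letter
  \<open>sg a a = - 1\<close>, so such a state vanishes on words that repeat an odd letter.\<close>

definition ssymm :: "state \<Rightarrow> bool" where
  "ssymm f \<longleftrightarrow> (\<forall>u a b v. f (u @ a # b # v) = sg a b * f (u @ b # a # v))"

definition fock :: "letter set \<Rightarrow> state set" where
  "fock L = {f. ssymm f \<and> (\<forall>w. f w \<noteq> 0 \<longrightarrow> set w \<subseteq> L)}"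

lemma ann_ann: "ssymm f \<Longrightarrow> ann a (ann b f) = sg a b *\<^sub>C ann b (ann a f)"
proof
  assume f: "ssymm f"
  show "ann a (ann b f) w = (sg a b *\<^sub>C ann b (ann a f)) w" for w
    using f[unfolded ssymm_def, rule_format, of "[]" b a w] by (simp add: ann_def sg_commute)
qed

lemma ssymm_ann: "ssymm f \<Longrightarrow> ssymm (ann a f)"
  unfolding ssymm_def ann_def by (metis append_Cons)

lemma ssymm_cre:
  assumes "ssymm f"
  shows "ssymm (cre c f)"
  unfolding ssymm_def
proof (intro allI)
  show "cre c f (u @ a # b # v) = sg a b * cre c f (u @ b # a # v)" for u a b v
    using assms
  proof (induction u arbitrary: f)
    case Nil
    have "cre c (ann b (ann a f)) v = sg a b * cre c (ann a (ann b f)) v"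
      using ann_ann[OF Nil, of b a] by (simp add: cre_lin sg_commute)
    then show ?case by (auto simp: ann_def algebra_simps sg_commute)
  next
    case (Cons e u)
    have "f (u @ a # b # v) = sg a b * f (u @ b # a # v)"
      using Cons.prems unfolding ssymm_def by blast
    then show ?case using Cons.IH[OF ssymm_ann[OF Cons.prems]]
      by (simp add: algebra_simps)
  qed
qed

lemma fock_ssymm: "f \<in> fock L \<Longrightarrow> ssymm f"
  by (simp add: fock_def)

lemma fock_ann: "f \<in> fock L \<Longrightarrow> ann a f \<in> fock L"
  unfolding fock_def by (auto simp: ssymm_ann ann_def) (metis list.set_intros(2) subsetD)

lemma cre_nonzero: "cre a f w \<noteq> 0 \<Longrightarrow> \<exists>u v. w = u @ a # v \<and> f (u @ v) \<noteq> 0"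
proof (induction w arbitrary: f)
  case (Cons b w)
  show ?case
  proof (cases "a = b \<and> f w \<noteq> 0")
    case True
    then show ?thesis by (metis append_Nil)
  next
    case False
    then have "cre a (ann b f) w \<noteq> 0" using Cons.prems by (auto split: if_splits)
    from Cons.IH[OF this] show ?thesis by (metis ann_def append_Cons)
  qed
qed simp

lemma fock_cre: "f \<in> fock L \<Longrightarrow> a \<in> L \<Longrightarrow> cre a f \<in> fock L"
  by (fastforce simp: fock_def ssymm_cre dest!: cre_nonzero)

lemma fock_vac: "vac \<in> fock L"
  by (simp add: fock_def ssymm_def vac_def)

lemma ssymmD: "ssymm f \<Longrightarrow> f (u @ a # b # v) = sg a b * f (u @ b # a # v)"
  unfolding ssymm_def by blast

lemma subspace_fock: "cvs.subspace (fock L)"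
proof (rule cvs.subspaceI)
  show "0 \<in> fock L" by (simp add: fock_def ssymm_def)
next
  fix f g assume f: "f \<in> fock L" and g: "g \<in> fock L"
  have "ssymm (f + g)"
    unfolding ssymm_def
  proof (intro allI)
    show "(f + g) (u @ a # b # v) = sg a b * (f + g) (u @ b # a # v)" for u a b v
      using ssymmD[OF fock_ssymm[OF f], of u a b v] ssymmD[OF fock_ssymm[OF g], of u a b v]
      by (simp add: distrib_left)
  qed
  moreover have "set w \<subseteq> L" if "(f + g) w \<noteq> 0" for w
  proof (cases "f w = 0")
    case True
    with that have "g w \<noteq> 0" by simp
    then show ?thesis using g unfolding fock_def by blast
  next
    case False
    then show ?thesis using f unfolding fock_def by blast
  qed
  ultimately show "f + g \<in> fock L" unfolding fock_def by blast
next
  fix c f assume f: "f \<in> fock L"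
  have "ssymm (c *\<^sub>C f)"
    unfolding ssymm_def
  proof (intro allI)
    show "(c *\<^sub>C f) (u @ a # b # v) = sg a b * (c *\<^sub>C f) (u @ b # a # v)" for u a b v
      using ssymmD[OF fock_ssymm[OF f], of u a b v] by simp
  qed
  then show "c *\<^sub>C f \<in> fock L" using f by (simp add: fock_def)
qed

lemma fock_sum: "(\<And>i. i \<in> A \<Longrightarrow> F i \<in> fock L) \<Longrightarrow> (\<Sum>i\<in>A. F i) \<in> fock L"
  and fock_cscale: "f \<in> fock L \<Longrightarrow> c *\<^sub>C f \<in> fock L"
  and fock_add: "f \<in> fock L \<Longrightarrow> g \<in> fock L \<Longrightarrow> f + g \<in> fock L"
  and fock_diff: "f \<in> fock L \<Longrightarrow> g \<in> fock L \<Longrightarrow> f - g \<in> fock L"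
  using subspace_fock[of L]
  by (auto intro: cvs.subspace_sum cvs.subspace_scale cvs.subspace_add cvs.subspace_diff)

text \<open>Peel off the first letter \<open>b\<close>: the delta term of \<open>cre\<close>
  recovers \<open>f (b # w)\<close>, and commuting \<open>ann b\<close> inwards leaves the same
  identity for \<open>ann b f\<close> at the shorter word.\<close>

lemma euler:
  assumes "f \<in> fock L" "finite L"
  shows "(\<Sum>a\<in>L. cre a (ann a f)) w = of_nat (length w) * f w"
  using assms(1)
proof (induction w arbitrary: f)
  case Nil
  then show ?case by (simp add: sum_fun_apply)
next
  case (Cons b w)
  have "sg a b * cre a (ann b (ann a f)) w = cre a (ann a (ann b f)) w" for a
    unfolding ann_ann[OF fock_ssymm[OF Cons.prems], of b a] by (simp add: cre_lin)
  then have "(\<Sum>a\<in>L. cre a (ann a f)) (b # w)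
    = (\<Sum>a\<in>L. if a = b then ann a f w else 0) + (\<Sum>a\<in>L. cre a (ann a (ann b f))) w"
    by (simp add: sum_fun_apply sum.distrib)
  also have "(\<Sum>a\<in>L. if a = b then ann a f w else 0) = f (b # w)"
    using assms(2) Cons.prems by (auto simp: ann_def fock_def)
  finally show ?case
    using Cons.IH[OF fock_ann[OF Cons.prems, of b]] by (simp add: ann_def algebra_simps)
qed

section \<open>Induced homomorphisms\<close>

text \<open>The homomorphism sending \<open>cre a\<close> to the operator \<open>Op a\<close> and the vacuum to \<open>z\<close>, on words of
  length \<open>m\<close>; the recursion is Euler's identity.\<close>

primrec hmap :: "letter set \<Rightarrow> (letter \<Rightarrow> 'b \<Rightarrow> 'b) \<Rightarrow> 'b \<Rightarrow> nat \<Rightarrow> state \<Rightarrow> 'b::cvector" where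
  "hmap L Op z 0 f = f [] *\<^sub>C z"
| "hmap L Op z (Suc m) f = (1 / of_nat (Suc m)) *\<^sub>C (\<Sum>b\<in>L. Op b (hmap L Op z m (ann b f)))"

lemma clinear_hmap:
  assumes "\<And>a. clinear (Op a)"
  shows "clinear (hmap L Op z m)"
proof (induction m)
  case 0
  show ?case by (rule clinearI) (simp_all add: cscale_add_left cscale_cscale)
next
  case (Suc m)
  have "hmap L Op z (Suc m)
    = (\<lambda>f. (1 / of_nat (Suc m)) *\<^sub>C (\<Sum>b\<in>L. Op b (hmap L Op z m (ann b f))))"
    by (rule ext) (rule hmap.simps)
  then show ?case
    by (simp only:)
      (intro clinear_compose_cscale clinear_compose_sum clinear_compose[OF assms]
         clinear_compose[OF Suc] clinear_ann)
qed

text \<open>Once \<open>Op a\<close> is moved to the front, the delta term contributes one copy of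
  the result and the recursion contributes \<open>Suc m\<close> more, which cancels the denominator
  \<open>Suc (Suc m)\<close>.\<close>

lemma hmap_cre:
  assumes lin: "\<And>a. clinear (Op a)" and "finite L" "a \<in> L"
    and comm: "\<And>b y. b \<in> L \<Longrightarrow> Op b (Op a y) = sg a b *\<^sub>C Op a (Op b y)"
  shows "hmap L Op z (Suc m) (cre a f) = Op a (hmap L Op z m f)"
proof (induction m arbitrary: f)
  case 0
  have "Op b (hmap L Op z 0 (ann b (cre a f))) = of_bool (b = a) *\<^sub>C Op b (f [] *\<^sub>C z)" for b
    by (cases "b = a") (simp_all add: ann_def clin[OF lin])
  then have "hmap L Op z (Suc 0) (cre a f) = (\<Sum>b\<in>L. of_bool (b = a) *\<^sub>C Op b (f [] *\<^sub>C z))"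
    unfolding hmap.simps(2)[of _ _ _ 0] by (simp del: hmap.simps)
  then show ?case using assms(2,3) by (simp add: sum_of_bool_cscale)
next
  case (Suc m)
  let ?h = "hmap L Op z"
  have lh: "clinear (?h k)" for k by (rule clinear_hmap[OF lin])
  have "Op b (?h (Suc m) (ann b (cre a f)))
      = of_bool (a = b) *\<^sub>C Op b (?h (Suc m) f) + Op a (Op b (?h m (ann b f)))" if "b \<in> L" for b
    by (simp add: ann_cre clin[OF lh] clin[OF lin] Suc comm[OF that] cscale_cscale cscale_one
          del: hmap.simps of_nat_Suc)
  then have "?h (Suc (Suc m)) (cre a f) = (1 / of_nat (Suc (Suc m))) *\<^sub>C
      (Op a (?h (Suc m) f) + Op a (\<Sum>b\<in>L. Op b (?h m (ann b f))))"
    unfolding hmap.simps(2)[of _ _ _ "Suc m"] using assms(2,3)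
    by (simp add: sum.distrib sum_of_bool_cscale clin[OF lin] del: hmap.simps of_nat_Suc)
  also have "(\<Sum>b\<in>L. Op b (?h m (ann b f))) = of_nat (Suc m) *\<^sub>C ?h (Suc m) f"
    by (simp add: cscale_cscale cscale_one del: of_nat_Suc)
  also have "Op a (?h (Suc m) f) + Op a (of_nat (Suc m) *\<^sub>C ?h (Suc m) f)
      = of_nat (Suc (Suc m)) *\<^sub>C Op a (?h (Suc m) f)"
    unfolding clinear_cscale[OF lin] by (rule add_of_nat_cscale)
  finally show ?case by (simp add: cscale_cscale cscale_one del: hmap.simps of_nat_Suc)
qed

text \<open>\<open>Q\<close> obeys with the \<open>Op b\<close> the relations that
  \<open>ann a\<close> obeys with the \<open>cre b\<close>, and it kills the image of the vacuum;
  these data force it to correspond to \<open>ann a\<close>.\<close>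

lemma hmap_ann:
  assumes lin: "\<And>a. clinear (Op a)" "clinear Q" and "finite L" "a \<in> L"
    and comm: "\<And>b y. b \<in> L \<Longrightarrow> Q (Op b y) = of_bool (a = b) *\<^sub>C y + sg a b *\<^sub>C Op b (Q y)"
    and "Q z = 0" "f \<in> fock L"
  shows "Q (hmap L Op z (Suc m) f) = hmap L Op z m (ann a f)"
  using \<open>f \<in> fock L\<close>
proof (induction m arbitrary: f)
  case 0
  have "Q (Op b (hmap L Op z 0 (ann b f))) = of_bool (a = b) *\<^sub>C (ann b f [] *\<^sub>C z)"
    if "b \<in> L" for b
    using comm[OF that, of z] by (simp add: clin[OF lin(1)] clin[OF lin(2)] assms(6) cscale_cscale mult.commute)
  then have "(\<Sum>b\<in>L. Q (Op b (hmap L Op z 0 (ann b f))))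
      = (\<Sum>b\<in>L. of_bool (a = b) *\<^sub>C (ann b f [] *\<^sub>C z))"
    by (intro sum.cong refl)
  also have "\<dots> = hmap L Op z 0 (ann a f)"
    using assms(3,4) by (simp only: sum_of_bool_cscale hmap.simps if_True)
  finally show ?case by (simp add: clin[OF lin(2)])
next
  case (Suc m)
  let ?h = "hmap L Op z"
  have lh: "clinear (?h k)" for k by (rule clinear_hmap[OF lin(1)])
  have "Q (Op b (?h (Suc m) (ann b f)))
      = of_bool (a = b) *\<^sub>C ?h (Suc m) (ann b f) + Op b (?h m (ann b (ann a f)))" if "b \<in> L" for b
  proof -
    have "sg a b *\<^sub>C Op b (?h m (ann a (ann b f))) = Op b (?h m (ann b (ann a f)))"
      unfolding ann_ann[OF fock_ssymm[OF Suc.prems], of a b]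
      by (simp add: clin[OF lh] clin[OF lin(1)] cscale_cscale cscale_one)
    then show ?thesis using comm[OF that] Suc.IH[OF fock_ann[OF Suc.prems]] by simp
  qed
  then have "Q (?h (Suc (Suc m)) f) = (1 / of_nat (Suc (Suc m))) *\<^sub>C
      (?h (Suc m) (ann a f) + (\<Sum>b\<in>L. Op b (?h m (ann b (ann a f)))))"
    unfolding hmap.simps(2)[of _ _ _ "Suc m"] using assms(3,4)
    by (simp add: clin[OF lin(2)] sum.distrib sum_of_bool_cscale del: hmap.simps of_nat_Suc)
  also have "(\<Sum>b\<in>L. Op b (?h m (ann b (ann a f)))) = of_nat (Suc m) *\<^sub>C ?h (Suc m) (ann a f)"
    by (simp add: cscale_cscale cscale_one del: of_nat_Suc)
  also have "?h (Suc m) (ann a f) + of_nat (Suc m) *\<^sub>C ?h (Suc m) (ann a f)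
      = of_nat (Suc (Suc m)) *\<^sub>C ?h (Suc m) (ann a f)"
    by (rule add_of_nat_cscale)
  finally show ?case by (simp add: cscale_cscale cscale_one del: hmap.simps of_nat_Suc)
qed

section \<open>The Fischer inner product\<close>

text \<open>Unfolded, this is the sum of \<open>cnj (f w) * g w\<close> over the words
  \<open>w\<close> of length \<open>m\<close> over \<open>L\<close>, divided by the factorial of
  \<open>m\<close>. With this normalization \<open>cre a\<close> and \<open>ann a\<close> are
  adjoint.\<close>

primrec ip :: "letter set \<Rightarrow> nat \<Rightarrow> state \<Rightarrow> state \<Rightarrow> complex" where
  "ip L 0 f g = cnj (f []) * g []"
| "ip L (Suc m) f g = (\<Sum>a\<in>L. ip L m (ann a f) (ann a g)) / of_nat (Suc m)"

lemma clinear_ip: "clinear (ip L m f)"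
proof (induction m arbitrary: f)
  case 0
  show ?case by (rule clinearI) (simp_all add: algebra_simps)
next
  case (Suc m)
  have "ip L (Suc m) f = (\<lambda>g. (1 / of_nat (Suc m)) *\<^sub>C (\<Sum>a\<in>L. ip L m (ann a f) (ann a g)))"
    by (rule ext) (simp del: of_nat_Suc)
  then show ?case
    by (simp only:)
      (intro clinear_compose_cscale clinear_compose_sum clinear_compose[OF Suc] clinear_ann)
qed

lemmas ip_lin = clin[OF clinear_ip]

lemma ip_commute: "ip L m g f = cnj (ip L m f g)"
proof (induction m arbitrary: f g)
  case (Suc m)
  have "ip L m (ann a g) (ann a f) = cnj (ip L m (ann a f) (ann a g))" for a by (rule Suc)
  then show ?case by (simp del: of_nat_Suc)
qed simp

lemma ip_lin_left: "ip L m (f + h) g = ip L m f g + ip L m h g"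
  "ip L m (c *\<^sub>C f) g = cnj c * ip L m f g"
  "ip L m (f - h) g = ip L m f g - ip L m h g" "ip L m 0 g = 0"
  "ip L m (\<Sum>i\<in>A. F i) g = (\<Sum>i\<in>A. ip L m (F i) g)"
  unfolding ip_commute[of L m _ g] by (simp_all add: ip_lin)

lemma ip_self: "0 \<le> Re (ip L m f f) \<and> Im (ip L m f f) = 0"
proof (induction m arbitrary: f)
  case 0
  show ?case by simp
next
  case (Suc m)
  then show ?case by (simp add: sum_nonneg Im_divide_of_nat Re_divide_of_nat del: of_nat_Suc)
qed

lemma ip_definite:
  assumes "finite L" "\<And>w. f w \<noteq> 0 \<Longrightarrow> set w \<subseteq> L"
    and "Re (ip L m f f) = 0" "length w = m"
  shows "f w = 0"
  using assms(2-)
proof (induction m arbitrary: f w)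
  case 0
  then show ?case by (simp add: complex_eq_iff power2_eq_square[symmetric])
next
  case (Suc m)
  obtain b v where w: "w = b # v" "length v = m" using Suc.prems(3) by (cases w) auto
  show ?case
  proof (cases "b \<in> L")
    case True
    have "(\<Sum>a\<in>L. Re (ip L m (ann a f) (ann a f))) = 0"
      using Suc.prems(2) by (simp add: Re_divide_of_nat del: of_nat_Suc)
    then have "Re (ip L m (ann b f) (ann b f)) = 0"
      using assms(1) True ip_self by (subst (asm) sum_nonneg_eq_0_iff) auto
    moreover have "set u \<subseteq> L" if "ann b f u \<noteq> 0" for u
      using Suc.prems(1)[of "b # u"] that by (simp add: ann_def)
    ultimately have "ann b f v = 0" using Suc.IH w(2) by blast
    then show ?thesis by (simp add: ann_def w)
  next
    case False
    then show ?thesis using Suc.prems(1)[of w] w by auto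
  qed
qed

text \<open>The count is that of \<open>hmap_cre\<close>: the delta term gives one copy, the
  commuted terms give \<open>Suc m\<close> copies, and the denominator \<open>Suc (Suc m)\<close>
  normalizes their sum.\<close>

lemma ip_cre:
  assumes "finite L" "a \<in> L" "ssymm f"
  shows "ip L (Suc m) f (cre a g) = ip L m (ann a f) g"
  using assms(3)
proof (induction m arbitrary: f g)
  case 0
  have "ip L 0 (ann b f) (ann b (cre a g)) = (if b = a then cnj (f [b]) * g [] else 0)" for b
    by (simp add: ann_def)
  then show ?case using assms(1,2) by (simp add: ann_def)
next
  case (Suc m)
  have "ip L (Suc m) (ann b f) (ann b (cre a g)) =
      (if b = a then ip L (Suc m) (ann a f) g else 0) + ip L m (ann b (ann a f)) (ann b g)" for b
  proof -
    have "sg a b * ip L m (ann a (ann b f)) (ann b g) = ip L m (ann b (ann a f)) (ann b g)"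
      unfolding ann_ann[OF Suc.prems, of a b] by (simp add: ip_lin_left sg_def)
    then show ?thesis using Suc.IH[OF ssymm_ann[OF Suc.prems, of b], of "ann b g"]
      by (simp add: ann_cre ip_lin del: ip.simps of_nat_Suc)
  qed
  then have "ip L (Suc (Suc m)) f (cre a g)
      = (ip L (Suc m) (ann a f) g + (\<Sum>b\<in>L. ip L m (ann b (ann a f)) (ann b g))) / of_nat (Suc (Suc m))"
    unfolding ip.simps(2)[of _ "Suc m"] using assms(1,2)
    by (simp add: sum.distrib del: ip.simps of_nat_Suc)
  also have "(\<Sum>b\<in>L. ip L m (ann b (ann a f)) (ann b g)) = of_nat (Suc m) * ip L (Suc m) (ann a f) g"
    by (simp del: of_nat_Suc)
  also have "ip L (Suc m) (ann a f) g + of_nat (Suc m) * ip L (Suc m) (ann a f) g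
      = of_nat (Suc (Suc m)) * ip L (Suc m) (ann a f) g"
    by (simp add: algebra_simps del: ip.simps)
  finally show ?case by (simp del: ip.simps of_nat_Suc)
qed

lemma ip_ann:
  assumes "finite L" "a \<in> L" "ssymm g"
  shows "ip L m f (ann a g) = ip L (Suc m) (cre a f) g"
  using ip_cre[OF assms, of m f] ip_commute by metis

text \<open>Gram-Schmidt, one generator at a time: \<open>x - y\<close> is the part of the new
  generator orthogonal to the old ones, and a single correction along it repairs the earlier
  projection \<open>r\<close>.\<close>

lemma ip_projection:
  assumes "finite B" "B \<subseteq> fock L" "finite L"
  shows "\<exists>r \<in> cvs.span B. \<forall>b\<in>B. ip L m b (f - r) = 0"
  using assms(1,2)
proof (induction B arbitrary: f rule: finite_induct)
  case empty
  show ?case using cvs.span_zero by blast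
next
  case (insert x B)
  obtain y where y: "y \<in> cvs.span B" "\<forall>b\<in>B. ip L m b (x - y) = 0"
    using insert.IH[of x] insert.prems by blast
  obtain r where r: "r \<in> cvs.span B" "\<forall>b\<in>B. ip L m b (f - r) = 0"
    using insert.IH[of f] insert.prems by blast
  let ?z = "x - y"
  have span_zero: "ip L m u g = 0" if "u \<in> cvs.span B" "\<forall>b\<in>B. ip L m b g = 0" for u g
    using that(1)
  proof (induction rule: cvs.span_induct_alt)
    case base
    show ?case by (rule ip_lin_left)
  next
    case (step c b v)
    then show ?case using that(2) unfolding ip_lin_left by simp
  qed
  \<comment> \<open>If \<open>?z\<close> has norm 0, it vanishes on all words of length
    \<open>m\<close>, the only ones that \<open>ip L m\<close> sees, so it pairs to zero with
    everything and the coefficient 0 will do.\<close>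
  define c where "c = (if ip L m ?z ?z = 0 then 0 else ip L m ?z (f - r) / ip L m ?z ?z)"
  have "ip L m ?z (f - r - c *\<^sub>C ?z) = 0"
  proof (cases "ip L m ?z ?z = 0")
    case True
    have "B \<subseteq> fock L" "x \<in> fock L" using insert.prems by auto
    then have "?z \<in> fock L"
      using y(1) cvs.span_minimal[OF _ subspace_fock, of B L] by (auto intro: fock_diff)
    then have z0: "?z w = 0" if "length w = m" for w
      using ip_definite[OF assms(3), of ?z m w] that True by (auto simp: fock_def)
    have "ip L k h g = 0" if "\<And>w. length w = k \<Longrightarrow> h w = 0" for k h g
      using that
    proof (induction k arbitrary: h g)
      case (Suc k)
      then show ?case by (simp add: ann_def)
    qed simp
    then show ?thesis using z0 by blast
  next
    case False
    then show ?thesis by (simp add: c_def ip_lin)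
  qed
  moreover have "ip L m b (f - r - c *\<^sub>C ?z) = 0" if "b \<in> B" for b
    using that r(2) y(2) by (simp add: ip_lin)
  moreover have "ip L m x g = ip L m ?z g + ip L m y g" for g
    by (simp add: ip_lin_left)
  moreover have "ip L m y (f - r - c *\<^sub>C ?z) = 0"
    by (rule span_zero[OF y(1)]) (simp add: calculation(2))
  ultimately have "\<forall>b\<in>insert x B. ip L m b (f - (r + c *\<^sub>C ?z)) = 0"
    by (simp add: diff_diff_eq)
  moreover have "r + c *\<^sub>C ?z \<in> cvs.span (insert x B)"
  proof -
    have "cvs.span B \<subseteq> cvs.span (insert x B)" by (rule cvs.span_mono) blast
    then have "r \<in> cvs.span (insert x B)" "y \<in> cvs.span (insert x B)" using r(1) y(1) by blast+
    moreover have "x \<in> cvs.span (insert x B)" by (rule cvs.span_base) blast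
    ultimately show ?thesis by (intro cvs.span_add cvs.span_scale cvs.span_diff)
  qed
  ultimately show ?case by blast
qed

section \<open>Quadratic operators\<close>

text \<open>For a matrix of fixed parity this is the superderivation extending the linear map with
  matrix \<open>M\<close> on the letters, column \<open>b\<close> being the image of the letter
  \<open>b\<close>.\<close>

definition quad :: "letter set \<Rightarrow> (letter \<Rightarrow> letter \<Rightarrow> complex) \<Rightarrow> state \<Rightarrow> state" where
  "quad L M f = (\<Sum>a\<in>L. \<Sum>b\<in>L. M a b *\<^sub>C cre a (ann b f))"

lemma clinear_quad: "clinear (quad L M)"
proof -
  have "quad L M = (\<lambda>f. \<Sum>a\<in>L. \<Sum>b\<in>L. M a b *\<^sub>C cre a (ann b f))"
    by (rule ext) (rule quad_def)
  then show ?thesis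
    by (simp only:)
      (intro clinear_compose_cscale clinear_compose_sum clinear_compose[OF clinear_cre] clinear_ann)
qed

lemmas quad_lin = clin[OF clinear_quad]

lemma quad_vac [simp]: "quad L M vac = 0"
  by (simp add: quad_def cre_lin)

lemma fock_quad: "f \<in> fock L \<Longrightarrow> quad L M f \<in> fock L"
  unfolding quad_def by (intro fock_sum fock_cscale fock_cre fock_ann)

definition parity_mat :: "bit \<Rightarrow> (letter \<Rightarrow> letter \<Rightarrow> complex) \<Rightarrow> bool" where
  "parity_mat k M \<longleftrightarrow> (\<forall>a b. M a b \<noteq> 0 \<longrightarrow> lpar a + lpar b = k)"

lemma parity_matD: "parity_mat k M \<Longrightarrow> M a b \<noteq> 0 \<Longrightarrow> k = lpar a + lpar b"
  unfolding parity_mat_def by blast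

text \<open>Moving \<open>e\<close> past \<open>cre a\<close> and \<open>ann b\<close> costs one
  sign each. On the support of a matrix of parity \<open>k\<close> the product of the two depends on
  \<open>k\<close> and \<open>e\<close> alone, which is what makes \<open>quad L M\<close> a
  superderivation of parity \<open>k\<close>.\<close>

lemma parity_mat_sg:
  assumes "parity_mat k M"
  shows "M a b * (sg e b * sg a e) = bsign (k * lpar e) * M a b"
proof (cases "M a b = 0")
  case False
  then have k: "k = lpar a + lpar b" using parity_matD[OF assms] by blast
  show ?thesis
    unfolding k sg_def using bit_cases[of "lpar a"] bit_cases[of "lpar b"] bit_cases[of "lpar e"]
    by (elim disjE) (simp_all add: bsign_def)
qed simp

lemma quad_cre:
  assumes "finite L" "e \<in> L" "parity_mat k M"
  shows "quad L M (cre e h)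
    = (\<Sum>a\<in>L. M a e *\<^sub>C cre a h) + bsign (k * lpar e) *\<^sub>C cre e (quad L M h)"
proof -
  have "M a b *\<^sub>C cre a (ann b (cre e h)) = of_bool (e = b) *\<^sub>C (M a b *\<^sub>C cre a h)
      + bsign (k * lpar e) *\<^sub>C cre e (M a b *\<^sub>C cre a (ann b h))" for a b
  proof -
    have "cre a (ann b (cre e h))
        = of_bool (e = b) *\<^sub>C cre a h + (sg e b * sg a e) *\<^sub>C cre e (cre a (ann b h))"
      unfolding ann_cre cre_lin cre_cre[of a e "ann b h"] by (simp only: cscale_cscale)
    then show ?thesis
      by (simp only: cscale_add_right cscale_cscale cre_lin parity_mat_sg[OF assms(3)]
            mult.commute[of "M a b" "of_bool _"])
  qed
  then have "quad L M (cre e h) = (\<Sum>a\<in>L. \<Sum>b\<in>L. of_bool (e = b) *\<^sub>C (M a b *\<^sub>C cre a h))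
      + (\<Sum>a\<in>L. \<Sum>b\<in>L. bsign (k * lpar e) *\<^sub>C cre e (M a b *\<^sub>C cre a (ann b h)))"
    by (simp only: quad_def sum.distrib)
  also have "(\<Sum>a\<in>L. \<Sum>b\<in>L. of_bool (e = b) *\<^sub>C (M a b *\<^sub>C cre a h)) = (\<Sum>a\<in>L. M a e *\<^sub>C cre a h)"
    by (simp only: sum_of_bool_cscale[OF assms(1)] assms(2) if_True)
  also have "(\<Sum>a\<in>L. \<Sum>b\<in>L. bsign (k * lpar e) *\<^sub>C cre e (M a b *\<^sub>C cre a (ann b h)))
      = bsign (k * lpar e) *\<^sub>C cre e (quad L M h)"
    by (simp only: quad_def cre_lin(6) cvs.scale_sum_right)
  finally show ?thesis .
qed

lemma ann_quad:
  assumes "finite L" "e \<in> L" "parity_mat k M" "ssymm f"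
  shows "ann e (quad L M f)
    = (\<Sum>b\<in>L. M e b *\<^sub>C ann b f) + bsign (k * lpar e) *\<^sub>C quad L M (ann e f)"
proof -
  have "M a b *\<^sub>C ann e (cre a (ann b f)) = of_bool (a = e) *\<^sub>C (M a b *\<^sub>C ann b f)
      + bsign (k * lpar e) *\<^sub>C (M a b *\<^sub>C cre a (ann b (ann e f)))" for a b
  proof -
    have "ann e (cre a (ann b f))
        = of_bool (a = e) *\<^sub>C ann b f + (sg e b * sg a e) *\<^sub>C cre a (ann b (ann e f))"
      unfolding ann_cre ann_ann[OF assms(4), of e b] cre_lin by (simp only: cscale_cscale mult.commute[of "sg a e"])
    then show ?thesis
      by (simp only: cscale_add_right cscale_cscale parity_mat_sg[OF assms(3)]
            mult.commute[of "M a b" "of_bool _"])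
  qed
  then have "ann e (quad L M f) = (\<Sum>a\<in>L. \<Sum>b\<in>L. of_bool (a = e) *\<^sub>C (M a b *\<^sub>C ann b f))
      + (\<Sum>a\<in>L. \<Sum>b\<in>L. bsign (k * lpar e) *\<^sub>C (M a b *\<^sub>C cre a (ann b (ann e f))))"
    by (simp only: quad_def ann_lin sum.distrib)
  also have "(\<Sum>a\<in>L. \<Sum>b\<in>L. of_bool (a = e) *\<^sub>C (M a b *\<^sub>C ann b f)) = (\<Sum>b\<in>L. M e b *\<^sub>C ann b f)"
    by (simp only: cvs.scale_sum_right[symmetric] sum_of_bool_cscale[OF assms(1)] assms(2) if_True)
  also have "(\<Sum>a\<in>L. \<Sum>b\<in>L. bsign (k * lpar e) *\<^sub>C (M a b *\<^sub>C cre a (ann b (ann e f))))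
      = bsign (k * lpar e) *\<^sub>C quad L M (ann e f)"
    by (simp only: quad_def cvs.scale_sum_right)
  finally show ?thesis .
qed

lemma quad_adjoint:
  assumes "finite L" "ssymm f" "ssymm g"
  shows "ip L m f (quad L M g) = ip L m (quad L (\<lambda>a b. cnj (M b a)) f) g"
proof (cases m)
  case 0
  then show ?thesis by (simp add: quad_def sum_fun_apply)
next
  case (Suc k)
  have "ip L m f (M a b *\<^sub>C cre a (ann b g)) = ip L m (cnj (M a b) *\<^sub>C cre b (ann a f)) g"
    if "a \<in> L" "b \<in> L" for a b
    unfolding Suc ip_lin ip_lin_left ip_cre[OF assms(1) that(1) assms(2)]
      ip_ann[OF assms(1) that(2) assms(3)] by (simp del: ip.simps)
  then have "ip L m f (quad L M g)
      = (\<Sum>a\<in>L. \<Sum>b\<in>L. ip L m (cnj (M a b) *\<^sub>C cre b (ann a f)) g)"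
    unfolding quad_def ip_lin by (intro sum.cong refl) auto
  also have "\<dots> = ip L m (quad L (\<lambda>a b. cnj (M b a)) f) g"
    unfolding quad_def ip_lin_left by (rule sum.swap)
  finally show ?thesis .
qed

text \<open>The operator of \<open>M\<close> is carried through every \<open>cre a\<close> and
  \<open>ann b\<close> of \<open>quad L N\<close>. The leftover terms assemble to the quadratic
  operator of the supercommutator of the two matrices, which vanishes by
  \<open>comm\<close>.\<close>

lemma quad_supercommute:
  assumes "finite L" and M: "parity_mat k M" and N: "parity_mat l N" and "ssymm f"
    and comm: "\<And>a c. a \<in> L \<Longrightarrow> c \<in> L \<Longrightarrow>
      (\<Sum>b\<in>L. M a b * N b c) = bsign (k * l) * (\<Sum>b\<in>L. N a b * M b c)"
  shows "quad L M (quad L N f) = bsign (k * l) *\<^sub>C quad L N (quad L M f)"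
proof -
  \<comment> \<open>This is \<open>ann_quad\<close> solved for \<open>quad L M (ann b f)\<close>, so
    that \<open>quad L M\<close> can be moved inwards past an annihilator.\<close>
  have 1: "bsign (k * lpar b) *\<^sub>C quad L M (ann b f) = ann b (quad L M f) - (\<Sum>c\<in>L. M b c *\<^sub>C ann c f)"
    if "b \<in> L" for b
    using ann_quad[OF assms(1) that M assms(4)] by simp
  have 2: "N a b *\<^sub>C quad L M (cre a (ann b f)) = (\<Sum>c\<in>L. (M c a * N a b) *\<^sub>C cre c (ann b f))
      + bsign (k * l) *\<^sub>C (N a b *\<^sub>C cre a (ann b (quad L M f)))
      - bsign (k * l) *\<^sub>C (\<Sum>c\<in>L. (N a b * M b c) *\<^sub>C cre a (ann c f))"
    if "a \<in> L" "b \<in> L" for a b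
  proof -
    have "N a b *\<^sub>C bsign (k * lpar a) *\<^sub>C quad L M (ann b f)
        = (bsign (k * l) * N a b) *\<^sub>C (bsign (k * lpar b) *\<^sub>C quad L M (ann b f))"
    proof (cases "N a b = 0")
      case False
      then have l: "l = lpar a + lpar b" using parity_matD[OF N] by blast
      have "bsign (k * l) * bsign (k * lpar b) = bsign (k * lpar a)"
        unfolding l using bit_cases[of "lpar a"] bit_cases[of "lpar b"] bit_cases[of k]
        by (elim disjE) (simp_all add: bsign_def)
      then show ?thesis by (simp add: mult.assoc mult.left_commute)
    qed simp
    also note 1[OF that(2)]
    finally have "N a b *\<^sub>C cre a (bsign (k * lpar a) *\<^sub>C quad L M (ann b f))
        = cre a ((bsign (k * l) * N a b) *\<^sub>C (ann b (quad L M f) - (\<Sum>c\<in>L. M b c *\<^sub>C ann c f)))"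
      by (simp only: cre_lin(5)[symmetric])
    then show ?thesis
      unfolding quad_cre[OF assms(1) that(1) M] cscale_add_right
      by (simp only: cre_lin cvs.scale_right_diff_distrib cvs.scale_sum_right cscale_cscale
            mult.assoc mult.commute[of "N a b"] add_diff_eq)
  qed
  have "quad L M (quad L N f) = (\<Sum>a\<in>L. \<Sum>b\<in>L. N a b *\<^sub>C quad L M (cre a (ann b f)))"
    unfolding quad_def[of L N f] by (simp only: quad_lin)
  also have "\<dots> = (\<Sum>a\<in>L. \<Sum>b\<in>L. \<Sum>c\<in>L. (M c a * N a b) *\<^sub>C cre c (ann b f))
      + bsign (k * l) *\<^sub>C quad L N (quad L M f)
      - bsign (k * l) *\<^sub>C (\<Sum>a\<in>L. \<Sum>b\<in>L. \<Sum>c\<in>L. (N a b * M b c) *\<^sub>C cre a (ann c f))"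
    by (simp only: 2 quad_def[of L N "quad L M f"] sum.distrib sum_subtractf cvs.scale_sum_right cong: sum.cong)
  also have "(\<Sum>a\<in>L. \<Sum>b\<in>L. \<Sum>c\<in>L. (M c a * N a b) *\<^sub>C cre c (ann b f))
      = (\<Sum>c\<in>L. \<Sum>b\<in>L. (\<Sum>a\<in>L. M c a * N a b) *\<^sub>C cre c (ann b f))"
    unfolding cvs.scale_sum_left
    by (subst (2) sum.swap, subst sum.swap, subst (2) sum.swap) (rule refl)
  also have "\<dots> = bsign (k * l) *\<^sub>C (\<Sum>c\<in>L. \<Sum>b\<in>L. (\<Sum>a\<in>L. N c a * M a b) *\<^sub>C cre c (ann b f))"
    by (simp only: comm cscale_cscale cvs.scale_sum_right cong: sum.cong)
  also have "(\<Sum>c\<in>L. \<Sum>b\<in>L. (\<Sum>a\<in>L. N c a * M a b) *\<^sub>C cre c (ann b f))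
      = (\<Sum>a\<in>L. \<Sum>b\<in>L. \<Sum>c\<in>L. (N a b * M b c) *\<^sub>C cre a (ann c f))"
    unfolding cvs.scale_sum_left by (subst (2) sum.swap) (rule refl)
  finally show ?thesis by (simp only: add_diff_cancel_left')
qed

section \<open>Invariants and inner products\<close>

fun bar :: "sindex \<Rightarrow> sindex" where
  "bar (Ev i) = Od i"
| "bar (Od i) = Ev i"

lemma bar_bar [simp]: "bar (bar i) = i"
  by (cases i) simp_all

lemma bar_eq_iff: "bar i = j \<longleftrightarrow> i = bar j"
  by auto

lemma par_bar [simp]: "par (bar i) = par i + 1"
  by (cases i) simp_all

definition vmat :: "(sindex \<Rightarrow> sindex \<Rightarrow> complex) \<Rightarrow> letter \<Rightarrow> letter \<Rightarrow> complex" where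
  "vmat \<mu> a b = of_bool (snd a = snd b) * \<mu> (fst a) (fst b)"

text \<open>The sign is the one in \<open>tright\<close>: an operator of parity \<open>k\<close> on
  W first has to pass the dual basis vector with index \<open>fst a\<close>.\<close>

definition wmat :: "bit \<Rightarrow> (sindex \<Rightarrow> sindex \<Rightarrow> complex) \<Rightarrow> letter \<Rightarrow> letter \<Rightarrow> complex" where
  "wmat k \<nu> a b = of_bool (fst a = fst b) * (bsign (k * par (fst a)) * \<nu> (snd a) (snd b))"

definition ipar :: "bit \<Rightarrow> (sindex \<Rightarrow> sindex \<Rightarrow> complex) \<Rightarrow> bool" where
  "ipar k \<mu> \<longleftrightarrow> (\<forall>i j. \<mu> i j \<noteq> 0 \<longrightarrow> par i + par j = k)"

lemma iparD: "ipar k \<mu> \<Longrightarrow> \<mu> i j \<noteq> 0 \<Longrightarrow> k = par i + par j"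
  unfolding ipar_def by blast

lemma bit_add_self [simp]: "(k::bit) + k = 0" "k + (k + l) = l"
  using bit_cases[of k] by auto

lemma bit_add_swap: "(i + s) + (j + t) = (i + j) + (s + t)" for i j s t :: bit
  by (simp only: ac_simps)

lemma parity_vmat:
  assumes "ipar k \<mu>"
  shows "parity_mat k (vmat \<mu>)"
  unfolding parity_mat_def
proof (intro allI impI)
  fix a b assume "vmat \<mu> a b \<noteq> 0"
  then have "snd a = snd b" "\<mu> (fst a) (fst b) \<noteq> 0" by (simp_all add: vmat_def)
  then have "par (fst a) + par (fst b) = k" using assms unfolding ipar_def by blast
  then show "lpar a + lpar b = k" unfolding lpar_def bit_add_swap \<open>snd a = snd b\<close> by (simp only: bit_add_self add_0_right)
qed

lemma parity_wmat:
  assumes "ipar k \<nu>"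
  shows "parity_mat k (wmat l \<nu>)"
  unfolding parity_mat_def
proof (intro allI impI)
  fix a b assume "wmat l \<nu> a b \<noteq> 0"
  then have "fst a = fst b" "\<nu> (snd a) (snd b) \<noteq> 0" by (simp_all add: wmat_def)
  then have "par (snd a) + par (snd b) = k" using assms unfolding ipar_def by blast
  then show "lpar a + lpar b = k" unfolding lpar_def bit_add_swap \<open>fst a = fst b\<close> by (simp only: bit_add_self add_0_left)
qed

text \<open>Matrices of homogeneous operators on \<open>V\<^sup>*\<close> that annihilate the odd form.\<close>

definition pe_mat :: "nat \<Rightarrow> bit \<Rightarrow> (sindex \<Rightarrow> sindex \<Rightarrow> complex) \<Rightarrow> bool" where
  "pe_mat n k \<mu> \<longleftrightarrow> ipar k \<mu> \<and>
    (\<forall>i\<in>indices n n. \<forall>j\<in>indices n n. \<mu> i (bar j) + bsign (k * par i) * \<mu> j (bar i) = 0)"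

locale frame =
  fixes n p q :: nat
begin

text \<open>Besides the index set of \<open>W\<close> there are \<open>n\<close> further even indices \<open>fr 1, \<dots>, fr n\<close>, the frame.\<close>

definition I where "I = indices n n"
definition S where "S = indices (p + n) q"
definition L where "L = I \<times> S"
definition fr where "fr j = Ev (p + j)"

lemma finite_I [simp]: "finite I" and finite_S [simp]: "finite S" and finite_L [simp]: "finite L"
  by (simp_all add: I_def S_def L_def indices_def)

lemma mem_L [simp]: "(i, s) \<in> L \<longleftrightarrow> i \<in> I \<and> s \<in> S"
  by (simp add: L_def)

lemma bar_I [simp]: "bar i \<in> I \<longleftrightarrow> i \<in> I"
  by (cases i) (auto simp: I_def indices_def)

lemma sum_I_bar: "(\<Sum>i\<in>I. f (bar i)) = (\<Sum>i\<in>I. f i)"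
  by (rule sum.reindex_bij_witness[where i = bar and j = bar]) auto

lemma sum_L: "(\<Sum>a\<in>L. f a) = (\<Sum>i\<in>I. \<Sum>s\<in>S. f (i, s))"
  unfolding L_def by (simp add: sum.cartesian_product)

lemma vmat_col: "t \<in> S \<Longrightarrow> (\<Sum>a\<in>L. vmat \<mu> a (j, t) *\<^sub>C F a) = (\<Sum>i\<in>I. \<mu> i j *\<^sub>C F (i, t))"
  unfolding sum_L vmat_def fst_conv snd_conv cscale_cscale[symmetric]
  by (simp only: sum_of_bool_cscale finite_S if_True)

lemma vmat_row: "s \<in> S \<Longrightarrow> (\<Sum>b\<in>L. vmat \<mu> (i, s) b *\<^sub>C F b) = (\<Sum>j\<in>I. \<mu> i j *\<^sub>C F (j, s))"
  unfolding sum_L vmat_def fst_conv snd_conv cscale_cscale[symmetric]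
  by (simp only: sum_of_bool_cscale finite_S if_True)

lemma wmat_col:
  assumes "j \<in> I"
  shows "(\<Sum>a\<in>L. wmat k \<nu> a (j, t) *\<^sub>C F a) = bsign (k * par j) *\<^sub>C (\<Sum>s\<in>S. \<nu> s t *\<^sub>C F (j, s))"
  unfolding sum_L wmat_def fst_conv snd_conv cscale_cscale[symmetric]
  by (subst sum.swap) (simp only: sum_of_bool_cscale finite_I if_True assms cvs.scale_sum_right)

lemma wmat_row:
  assumes "i \<in> I"
  shows "(\<Sum>b\<in>L. wmat k \<nu> (i, s) b *\<^sub>C F b) = bsign (k * par i) *\<^sub>C (\<Sum>t\<in>S. \<nu> s t *\<^sub>C F (i, t))"
  unfolding sum_L wmat_def fst_conv snd_conv cscale_cscale[symmetric]
  by (subst sum.swap) (simp only: sum_of_bool_cscale finite_I if_True assms cvs.scale_sum_right)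

text \<open>Multiplication by the inner product of \<open>s\<close> and \<open>t\<close>, with its
  two kinds of summands merged into one sum over \<open>I\<close>: the sign is that of
  \<open>par s\<close> for unbarred \<open>i\<close> and 1 for barred \<open>i\<close>.\<close>

definition G :: "sindex \<Rightarrow> sindex \<Rightarrow> state \<Rightarrow> state" where
  "G s t h = (\<Sum>i\<in>I. bsign (par s * (par i + 1)) *\<^sub>C cre (i, s) (cre (bar i, t) h))"

lemma clinear_G: "clinear (G s t)"
proof -
  have "G s t = (\<lambda>h. \<Sum>i\<in>I. bsign (par s * (par i + 1)) *\<^sub>C cre (i, s) (cre (bar i, t) h))"
    by (rule ext) (rule G_def)
  then show ?thesis
    by (simp only:)
      (intro clinear_compose_cscale clinear_compose_sum clinear_compose[OF clinear_cre] clinear_cre)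
qed

lemmas G_lin = clin[OF clinear_G]

text \<open>Reindexing by \<open>bar\<close> exchanges the two kinds of summands. For frame indices
  the sign is trivial, so there the inner product is symmetric.\<close>

lemma G_swap: "G s t h = bsign (par s * par t) *\<^sub>C G t s h"
proof -
  have "G s t h = (\<Sum>i\<in>I. bsign (par s * par i) *\<^sub>C cre (bar i, s) (cre (i, t) h))"
    unfolding G_def
    by (subst sum_I_bar[symmetric]) (simp add: add.assoc)
  also have "\<dots> = (\<Sum>i\<in>I. bsign (par s * par t) *\<^sub>C
      (bsign (par t * (par i + 1)) *\<^sub>C cre (i, t) (cre (bar i, s) h)))"
  proof (rule sum.cong[OF refl])
    fix i
    have "bsign (par s * par i) * sg (bar i, s) (i, t) = bsign (par s * par t) * bsign (par t * (par i + 1))"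
      unfolding sg_def lpar_def
      using bit_cases[of "par i"] bit_cases[of "par s"] bit_cases[of "par t"]
      by (auto simp: bsign_def)
    then show "bsign (par s * par i) *\<^sub>C cre (bar i, s) (cre (i, t) h)
      = bsign (par s * par t) *\<^sub>C (bsign (par t * (par i + 1)) *\<^sub>C cre (i, t) (cre (bar i, s) h))"
      unfolding cre_cre[of "(bar i, s)" "(i, t)"] by simp
  qed
  finally show ?thesis unfolding G_def by (simp only: cvs.scale_sum_right)
qed

lemma fock_G: "h \<in> fock L \<Longrightarrow> s \<in> S \<Longrightarrow> t \<in> S \<Longrightarrow> G s t h \<in> fock L"
  unfolding G_def by (intro fock_sum fock_cscale fock_cre) auto

lemma quad_cre_cre:
  assumes "u \<in> L" "v \<in> L" "parity_mat k M"
  shows "quad L M (cre u (cre v h)) = (\<Sum>a\<in>L. M a u *\<^sub>C cre a (cre v h))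
    + bsign (k * lpar u) *\<^sub>C (\<Sum>a\<in>L. M a v *\<^sub>C cre u (cre a h))
    + bsign (k * (lpar u + lpar v)) *\<^sub>C cre u (cre v (quad L M h))"
  unfolding quad_cre[OF finite_L assms(1,3)] quad_cre[OF finite_L assms(2,3)]
  by (simp only: cre_lin cscale_add_right cscale_cscale bsign_add distrib_left add.assoc)

text \<open>By the Leibniz rule \<open>\<mu>\<close> hits either the left or the right factor. After
  reindexing by \<open>bar\<close> the two double sums run over the same monomials, and the relation
  in \<open>pe_mat\<close> says that their coefficients are opposite.\<close>

lemma quad_vmat_G:
  assumes "pe_mat n k \<mu>" "s \<in> S" "t \<in> S"
  shows "quad L (vmat \<mu>) (G s t h) = bsign (k * (par s + par t + 1)) *\<^sub>C G s t (quad L (vmat \<mu>) h)"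
proof -
  have pm: "parity_mat k (vmat \<mu>)" and ip: "ipar k \<mu>"
    using assms(1) by (auto simp: pe_mat_def intro: parity_vmat)
  let ?c = "\<lambda>i. bsign (par s * (par i + 1))"
  have "quad L (vmat \<mu>) (G s t h)
      = (\<Sum>i\<in>I. ?c i *\<^sub>C quad L (vmat \<mu>) (cre (i, s) (cre (bar i, t) h)))"
    unfolding G_def by (simp only: quad_lin)
  also have "\<dots> = (\<Sum>i\<in>I. \<Sum>j\<in>I. (?c i * \<mu> j i) *\<^sub>C cre (j, s) (cre (bar i, t) h))
      + (\<Sum>i\<in>I. \<Sum>j\<in>I. (?c i * bsign (k * (par i + par s)) * \<mu> j (bar i)) *\<^sub>C cre (i, s) (cre (j, t) h))
      + (\<Sum>i\<in>I. (?c i * bsign (k * (par s + par t + 1))) *\<^sub>C cre (i, s) (cre (bar i, t) (quad L (vmat \<mu>) h)))"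
  proof -
    have "?c i *\<^sub>C quad L (vmat \<mu>) (cre (i, s) (cre (bar i, t) h))
       = (\<Sum>j\<in>I. (?c i * \<mu> j i) *\<^sub>C cre (j, s) (cre (bar i, t) h))
      + (\<Sum>j\<in>I. (?c i * bsign (k * (par i + par s)) * \<mu> j (bar i)) *\<^sub>C cre (i, s) (cre (j, t) h))
      + (?c i * bsign (k * (par s + par t + 1))) *\<^sub>C cre (i, s) (cre (bar i, t) (quad L (vmat \<mu>) h))"
      if "i \<in> I" for i
    proof -
      have "lpar (i, s) + lpar (bar i, t) = par s + par t + 1"
        unfolding lpar_def using bit_cases[of "par i"] bit_cases[of "par s"] bit_cases[of "par t"]
        by (elim disjE) simp_all
      moreover have "(i, s) \<in> L" "(bar i, t) \<in> L" using that assms by auto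
      ultimately show ?thesis
        unfolding quad_cre_cre[OF \<open>(i, s) \<in> L\<close> \<open>(bar i, t) \<in> L\<close> pm] vmat_col[OF assms(2)] vmat_col[OF assms(3)]
        by (simp only: cscale_add_right cvs.scale_sum_right cscale_cscale lpar_def fst_conv snd_conv mult.assoc)
    qed
    then show ?thesis by (simp only: sum.distrib cong: sum.cong)
  qed
  also have "(\<Sum>i\<in>I. \<Sum>j\<in>I. (?c i * \<mu> j i) *\<^sub>C cre (j, s) (cre (bar i, t) h))
     = (\<Sum>i\<in>I. \<Sum>j\<in>I. (bsign (par s * par j) * \<mu> i (bar j)) *\<^sub>C cre (i, s) (cre (j, t) h))"
  proof -
    let ?F = "\<lambda>i j. (bsign (par s * par j) * \<mu> i (bar j)) *\<^sub>C cre (i, s) (cre (j, t) h)"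
    have "(\<Sum>i\<in>I. \<Sum>j\<in>I. ?F j (bar i)) = (\<Sum>i\<in>I. \<Sum>j\<in>I. ?F j i)"
      by (rule sum_I_bar)
    also have "\<dots> = (\<Sum>i\<in>I. \<Sum>j\<in>I. ?F i j)" by (rule sum.swap)
    finally show ?thesis by (simp only: par_bar bar_bar)
  qed
  also have "(\<Sum>i\<in>I. \<Sum>j\<in>I. (?c i * bsign (k * (par i + par s)) * \<mu> j (bar i)) *\<^sub>C cre (i, s) (cre (j, t) h))
     = - (\<Sum>i\<in>I. \<Sum>j\<in>I. (bsign (par s * par j) * \<mu> i (bar j)) *\<^sub>C cre (i, s) (cre (j, t) h))"
  proof -
    have "?c i * bsign (k * (par i + par s)) * \<mu> j (bar i) = - (bsign (par s * par j) * \<mu> i (bar j))"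
      if "i \<in> I" "j \<in> I" for i j
    proof -
      have "?c i * bsign (k * (par i + par s)) * \<mu> j (bar i)
         = bsign (par s * par j) * (bsign (k * par i) * \<mu> j (bar i))"
      proof (cases "\<mu> j (bar i) = 0")
        case False
        have k: "k = par j + (par i + 1)" using iparD[OF ip False] unfolding par_bar .
        show ?thesis unfolding k
          using bit_cases[of "par i"] bit_cases[of "par s"] bit_cases[of "par j"]
          by (elim disjE) (simp_all add: bsign_def)
      qed simp
      also have "bsign (k * par i) * \<mu> j (bar i) = - \<mu> i (bar j)"
        using assms(1) that unfolding pe_mat_def I_def add_eq_0_iff by blast
      finally show ?thesis by simp
    qed
    then show ?thesis by (simp only: sum_negf[symmetric] cvs.scale_minus_left cong: sum.cong)
  qed
  also have "(\<Sum>i\<in>I. (?c i * bsign (k * (par s + par t + 1))) *\<^sub>C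
        cre (i, s) (cre (bar i, t) (quad L (vmat \<mu>) h)))
      = bsign (k * (par s + par t + 1)) *\<^sub>C G s t (quad L (vmat \<mu>) h)"
    unfolding G_def by (simp only: cvs.scale_sum_right cscale_cscale mult.commute[of "?c _"])
  finally show ?thesis by (simp only: right_minus add_0_left)
qed

text \<open>The sign in \<open>wmat\<close> turns the coefficients of \<open>G s t\<close> into
  those of \<open>G u t\<close> and \<open>G s u\<close>. Hence polarizations keep the span of
  products of inner products stable, which the orthogonality argument relies on.\<close>

lemma quad_wmat_G:
  assumes "ipar k \<nu>" "s \<in> S" "t \<in> S"
  shows "quad L (wmat k \<nu>) (G s t h)
    = (\<Sum>u\<in>S. (bsign k * \<nu> u s) *\<^sub>C G u t h + (bsign (k + k * par s) * \<nu> u t) *\<^sub>C G s u h)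
      + bsign (k * (par s + par t + 1)) *\<^sub>C G s t (quad L (wmat k \<nu>) h)"
proof -
  have pm: "parity_mat k (wmat k \<nu>)"
    using assms(1) by (rule parity_wmat)
  let ?c = "\<lambda>s i. bsign (par s * (par i + 1))"
  have "quad L (wmat k \<nu>) (G s t h)
      = (\<Sum>i\<in>I. ?c s i *\<^sub>C quad L (wmat k \<nu>) (cre (i, s) (cre (bar i, t) h)))"
    unfolding G_def by (simp only: quad_lin)
  also have "\<dots> = (\<Sum>i\<in>I. \<Sum>u\<in>S. (bsign k * \<nu> u s) *\<^sub>C (?c u i *\<^sub>C cre (i, u) (cre (bar i, t) h)))
      + (\<Sum>i\<in>I. \<Sum>u\<in>S. (bsign (k + k * par s) * \<nu> u t) *\<^sub>C (?c s i *\<^sub>C cre (i, s) (cre (bar i, u) h)))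
      + (\<Sum>i\<in>I. bsign (k * (par s + par t + 1)) *\<^sub>C (?c s i *\<^sub>C cre (i, s) (cre (bar i, t) (quad L (wmat k \<nu>) h))))"
  proof -
    have "?c s i *\<^sub>C quad L (wmat k \<nu>) (cre (i, s) (cre (bar i, t) h))
       = (\<Sum>u\<in>S. (bsign k * \<nu> u s) *\<^sub>C (?c u i *\<^sub>C cre (i, u) (cre (bar i, t) h)))
      + (\<Sum>u\<in>S. (bsign (k + k * par s) * \<nu> u t) *\<^sub>C (?c s i *\<^sub>C cre (i, s) (cre (bar i, u) h)))
      + bsign (k * (par s + par t + 1)) *\<^sub>C (?c s i *\<^sub>C cre (i, s) (cre (bar i, t) (quad L (wmat k \<nu>) h)))"
      if "i \<in> I" for i
    proof -
      have "lpar (i, s) + lpar (bar i, t) = par s + par t + 1"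
        unfolding lpar_def using bit_cases[of "par i"] bit_cases[of "par s"] bit_cases[of "par t"]
        by (elim disjE) simp_all
      moreover have "(i, s) \<in> L" "(bar i, t) \<in> L" using that assms by auto
      moreover have "?c s i * (bsign (k * par i) * \<nu> u s) = bsign k * \<nu> u s * ?c u i" for u
      proof (cases "\<nu> u s = 0")
        case False
        have k: "k = par u + par s" by (rule iparD[OF assms(1) False])
        show ?thesis unfolding k
          using bit_cases[of "par i"] bit_cases[of "par s"] bit_cases[of "par u"]
          by (elim disjE) (simp_all add: bsign_def)
      qed simp
      moreover have "?c s i * (bsign (k * lpar (i, s)) * (bsign (k * par (bar i)) * x))
          = bsign (k + k * par s) * x * ?c s i" for x
        using bit_cases[of "par i"] bit_cases[of "par s"] bit_cases[of k]
        by (elim disjE) (simp_all add: bsign_def lpar_def)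
      moreover have "bar i \<in> I" using that by simp
      ultimately show ?thesis
        unfolding quad_cre_cre[OF \<open>(i, s) \<in> L\<close> \<open>(bar i, t) \<in> L\<close> pm] wmat_col[OF that] wmat_col[OF \<open>bar i \<in> I\<close>]
        by (simp only: cscale_add_right cvs.scale_sum_right cscale_cscale mult.commute)
    qed
    then show ?thesis by (simp only: sum.distrib cong: sum.cong)
  qed
  finally show ?thesis
    unfolding G_def sum.distrib cvs.scale_sum_right
    by (subst sum.swap, subst (2) sum.swap)
qed

end

section \<open>Matrix units and homogeneous states\<close>

definition single :: "'a \<Rightarrow> 'a \<Rightarrow> 'a \<Rightarrow> 'a \<Rightarrow> complex" where
  "single u v a b = of_bool (a = u \<and> b = v)"

lemma single_bar: "single u v a (bar b) = single u (bar v) a b"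
  unfolding single_def by (simp only: bar_eq_iff[of b v])

lemma single_swap: "single u v b a = single v u a b"
  unfolding single_def by (simp only: conj_commute)

lemma single_Ev_Od [simp]: "single (Ev i) v (Od k) b = 0" "single (Od i) v (Ev k) b = 0"
  by (simp_all add: single_def)

definition hom :: "nat \<Rightarrow> state \<Rightarrow> bool" where
  "hom m f \<longleftrightarrow> (\<forall>w. f w \<noteq> 0 \<longrightarrow> length w = m)"

lemma hom_cre: "hom m f \<Longrightarrow> hom (Suc m) (cre a f)"
  unfolding hom_def by (fastforce dest!: cre_nonzero)

lemma hom_ann: "hom (Suc m) f \<Longrightarrow> hom m (ann a f)"
  unfolding hom_def ann_def by force

lemma subspace_hom: "cvs.subspace (Collect (hom m))"
proof (rule cvs.subspaceI)
  show "0 \<in> Collect (hom m)" by (simp add: hom_def)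
next
  fix f g assume "f \<in> Collect (hom m)" "g \<in> Collect (hom m)"
  then have "length w = m" if "(f + g) w \<noteq> 0" for w
    using that unfolding hom_def by (cases "f w = 0") auto
  then show "f + g \<in> Collect (hom m)" unfolding hom_def by blast
next
  fix c f assume "f \<in> Collect (hom m)"
  then show "c *\<^sub>C f \<in> Collect (hom m)" by (simp add: hom_def)
qed

lemma hom_diff: "hom m f \<Longrightarrow> hom m g \<Longrightarrow> hom m (f - g)"
  and hom_cscale: "hom m f \<Longrightarrow> hom m (c *\<^sub>C f)"
  and hom_sum: "(\<And>i. i \<in> A \<Longrightarrow> hom m (F i)) \<Longrightarrow> hom m (\<Sum>i\<in>A. F i)"
  using cvs.subspace_diff[OF subspace_hom, of f m g]
    cvs.subspace_scale[OF subspace_hom, of f m c] cvs.subspace_sum[OF subspace_hom, of A F m]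
  by blast+

lemma hom_vac: "hom 0 vac"
  by (simp add: hom_def vac_def)

lemma hom_quad:
  assumes "hom m f"
  shows "hom m (quad L M f)"
proof (cases m)
  case 0
  have "ann b f = 0" for b
    using assms unfolding 0 hom_def ann_def fun_eq_iff by auto
  then have "quad L M f = 0" by (simp add: quad_def cre_lin)
  then show ?thesis by (simp add: hom_def)
next
  case (Suc k)
  then show ?thesis
    using assms unfolding quad_def by (intro hom_sum hom_cscale) (simp add: hom_cre hom_ann)
qed

lemma euler_hom:
  assumes "f \<in> fock L" "finite L" "hom m f"
  shows "(\<Sum>a\<in>L. cre a (ann a f)) = of_nat m *\<^sub>C f"
proof
  show "(\<Sum>a\<in>L. cre a (ann a f)) w = (of_nat m *\<^sub>C f) w" for w
    using euler[OF assms(1,2), of w] assms(3) by (cases "f w = 0") (simp_all add: hom_def)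
qed

context frame
begin

section \<open>The two actions in terms of indices\<close>

lemma quad_vmat: "quad L (vmat \<mu>) f = (\<Sum>i\<in>I. \<Sum>j\<in>I. \<mu> i j *\<^sub>C (\<Sum>s\<in>S. cre (i, s) (ann (j, s) f)))"
proof -
  have "quad L (vmat \<mu>) f = (\<Sum>i\<in>I. \<Sum>s\<in>S. \<Sum>b\<in>L. vmat \<mu> (i, s) b *\<^sub>C cre (i, s) (ann b f))"
    unfolding quad_def by (rule sum_L)
  also have "\<dots> = (\<Sum>i\<in>I. \<Sum>s\<in>S. \<Sum>j\<in>I. \<mu> i j *\<^sub>C cre (i, s) (ann (j, s) f))"
    by (intro sum.cong refl) (simp only: vmat_row)
  also have "\<dots> = (\<Sum>i\<in>I. \<Sum>j\<in>I. \<Sum>s\<in>S. \<mu> i j *\<^sub>C cre (i, s) (ann (j, s) f))"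
    by (intro sum.cong refl sum.swap)
  finally show ?thesis by (simp only: cvs.scale_sum_right)
qed

lemma quad_wmat:
  "quad L (wmat k \<nu>) f
    = (\<Sum>i\<in>I. bsign (k * par i) *\<^sub>C (\<Sum>s\<in>S. \<Sum>t\<in>S. \<nu> s t *\<^sub>C cre (i, s) (ann (i, t) f)))"
proof -
  have "quad L (wmat k \<nu>) f = (\<Sum>i\<in>I. \<Sum>s\<in>S. \<Sum>b\<in>L. wmat k \<nu> (i, s) b *\<^sub>C cre (i, s) (ann b f))"
    unfolding quad_def by (rule sum_L)
  also have "\<dots> = (\<Sum>i\<in>I. \<Sum>s\<in>S. bsign (k * par i) *\<^sub>C (\<Sum>t\<in>S. \<nu> s t *\<^sub>C cre (i, s) (ann (i, t) f)))"
    by (intro sum.cong refl) (simp only: wmat_row)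
  finally show ?thesis by (simp only: cvs.scale_sum_right)
qed

lemma sum_single:
  assumes "u \<in> A" "v \<in> B" "finite A" "finite B"
  shows "(\<Sum>a\<in>A. \<Sum>b\<in>B. single u v a b *\<^sub>C F a b) = F u v"
proof -
  have "single u v a b *\<^sub>C F a b = of_bool (a = u) *\<^sub>C (of_bool (b = v) *\<^sub>C F a b)" for a b
    by (simp add: single_def)
  then show ?thesis
    by (simp only: cvs.scale_sum_right[symmetric] sum_of_bool_cscale assms if_True)
qed

lemma quad_vmat_two:
  assumes "u \<in> I" "v \<in> I" "u' \<in> I" "v' \<in> I"
  shows "quad L (vmat (\<lambda>a b. c * single u v a b + d * single u' v' a b)) f
    = c *\<^sub>C (\<Sum>s\<in>S. cre (u, s) (ann (v, s) f)) + d *\<^sub>C (\<Sum>s\<in>S. cre (u', s) (ann (v', s) f))"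
  unfolding quad_vmat cscale_add_left cscale_cscale[symmetric] sum.distrib cvs.scale_sum_right[symmetric]
  by (simp only: sum_single[OF assms(1,2) finite_I finite_I] sum_single[OF assms(3,4) finite_I finite_I])

section \<open>Invariant states and the span of products of inner products\<close>

definition Inv :: "state set" where
  "Inv = {f \<in> fock L. \<forall>k \<mu>. pe_mat n k \<mu> \<longrightarrow> quad L (vmat \<mu>) f = 0}"

lemma Inv_fock: "f \<in> Inv \<Longrightarrow> f \<in> fock L"
  unfolding Inv_def by (drule CollectD, erule conjunct1)

lemma InvD:
  assumes "f \<in> Inv" "pe_mat n k \<mu>"
  shows "quad L (vmat \<mu>) f = 0"
proof -
  have "\<forall>k \<mu>. pe_mat n k \<mu> \<longrightarrow> quad L (vmat \<mu>) f = 0"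
    using assms(1) unfolding Inv_def by - (drule CollectD, erule conjunct2)
  from this[rule_format, OF assms(2)] show ?thesis .
qed

lemma InvI: "f \<in> fock L \<Longrightarrow> (\<And>k \<mu>. pe_mat n k \<mu> \<Longrightarrow> quad L (vmat \<mu>) f = 0) \<Longrightarrow> f \<in> Inv"
  unfolding Inv_def by (intro CollectI conjI allI impI)

lemma subspace_Inv: "cvs.subspace Inv"
proof (rule cvs.subspaceI)
  show "0 \<in> Inv"
    by (rule InvI) (simp_all only: cvs.subspace_0[OF subspace_fock] quad_lin)
next
  fix f g assume "f \<in> Inv" "g \<in> Inv"
  then show "f + g \<in> Inv"
    by (intro InvI) (simp_all only: fock_add Inv_fock quad_lin InvD add_0_left)
next
  fix c f assume "f \<in> Inv"
  then show "c *\<^sub>C f \<in> Inv"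
    by (intro InvI) (simp_all only: fock_cscale Inv_fock quad_lin InvD cvs.scale_zero_right)
qed

text \<open>The grading is by the number of letters, two for each inner product. Each degree is a
  finite set, as the orthogonal projection requires.\<close>

fun Rgen :: "nat \<Rightarrow> state set" where
  "Rgen 0 = {vac}"
| "Rgen (Suc 0) = {}"
| "Rgen (Suc (Suc m)) = (\<Union>s\<in>S. \<Union>t\<in>S. G s t ` Rgen m)"

definition R :: "nat \<Rightarrow> state set" where "R m = cvs.span (Rgen m)"

lemma finite_Rgen: "finite (Rgen m)"
  by (induction m rule: Rgen.induct) auto

lemma Rgen_SucE:
  assumes "h \<in> Rgen (Suc (Suc m))"
  obtains s t h' where "s \<in> S" "t \<in> S" "h' \<in> Rgen m" "h = G s t h'"
  using assms unfolding Rgen.simps by (elim UN_E imageE) (rule that)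

lemma Rgen_SucI: "s \<in> S \<Longrightarrow> t \<in> S \<Longrightarrow> h \<in> Rgen m \<Longrightarrow> G s t h \<in> Rgen (Suc (Suc m))"
  unfolding Rgen.simps by (rule UN_I, assumption, rule UN_I, assumption, rule imageI)

lemma Rgen_Inv: "h \<in> Rgen m \<Longrightarrow> h \<in> Inv"
proof (induction m arbitrary: h rule: Rgen.induct)
  case 1
  then have "h = vac" unfolding Rgen.simps by (rule singletonD)
  then show ?case by (simp only: InvI[OF fock_vac quad_vac])
next
  case (3 m)
  from "3.prems" obtain s t h' where h: "s \<in> S" "t \<in> S" "h' \<in> Rgen m" "h = G s t h'"
    by (rule Rgen_SucE)
  have h': "h' \<in> Inv" by (rule "3.IH"[OF h(1,2,3)])
  have "G s t h' \<in> fock L" by (rule fock_G[OF Inv_fock[OF h'] h(1,2)])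
  moreover have "quad L (vmat \<mu>) (G s t h') = 0" if "pe_mat n k \<mu>" for k \<mu>
    unfolding quad_vmat_G[OF that h(1,2)] InvD[OF h' that] by (simp add: G_lin)
  ultimately show ?case unfolding h(4) by (rule InvI)
qed simp

lemma R_Inv: "R m \<subseteq> Inv"
  unfolding R_def using Rgen_Inv by (intro cvs.span_minimal[OF _ subspace_Inv]) blast

lemma hom_G: "hom m h \<Longrightarrow> hom (Suc (Suc m)) (G s t h)"
  unfolding G_def by (intro hom_sum hom_cscale hom_cre)

lemma Rgen_hom: "h \<in> Rgen m \<Longrightarrow> hom m h"
proof (induction m arbitrary: h rule: Rgen.induct)
  case 1
  then have "h = vac" unfolding Rgen.simps by (rule singletonD)
  then show ?case by (simp only: hom_vac)
next
  case (3 m)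
  from "3.prems" obtain s t h' where h: "s \<in> S" "t \<in> S" "h' \<in> Rgen m" "h = G s t h'"
    by (rule Rgen_SucE)
  show ?case unfolding h(4) by (rule hom_G[OF "3.IH"[OF h(1,2,3)]])
qed simp

lemma R_hom: "h \<in> R m \<Longrightarrow> hom m h"
  unfolding R_def using cvs.span_minimal[OF _ subspace_hom, of "Rgen m" m] Rgen_hom by blast

lemma G_R:
  assumes "h \<in> R m" "s \<in> S" "t \<in> S"
  shows "G s t h \<in> R (Suc (Suc m))"
  using assms(1) unfolding R_def
proof (induction rule: cvs.span_induct_alt)
  case base
  show ?case unfolding G_lin by (rule cvs.span_zero)
next
  case (step c x y)
  have "G s t x \<in> Rgen (Suc (Suc m))" by (rule Rgen_SucI[OF assms(2,3) step(1)])
  then show ?case unfolding G_lin by (intro cvs.span_add[OF _ step(2)] cvs.span_scale cvs.span_base)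
qed

lemmas R_add = cvs.span_add[of _ "Rgen m" for m, folded R_def]
  and R_scale = cvs.span_scale[of _ "Rgen m" for m, folded R_def]
  and R_sum = cvs.span_sum[of _ _ "Rgen m" for m, folded R_def]
  and R_zero = cvs.span_zero[of "Rgen m" for m, folded R_def]
  and R_base = cvs.span_base[of _ "Rgen m" for m, folded R_def]

lemma quad_wmat_Rgen:
  assumes "ipar k \<nu>" "h \<in> Rgen m"
  shows "quad L (wmat k \<nu>) h \<in> R m"
  using assms(2)
proof (induction m arbitrary: h rule: Rgen.induct)
  case 1
  then have "h = vac" unfolding Rgen.simps by (rule singletonD)
  then show ?case by (simp only: quad_vac R_zero)
next
  case (3 m)
  from "3.prems" obtain s t h' where h: "s \<in> S" "t \<in> S" "h' \<in> Rgen m" "h = G s t h'"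
    by (rule Rgen_SucE)
  have "quad L (wmat k \<nu>) h' \<in> R m" by (rule "3.IH"[OF h(1,2,3)])
  moreover have "h' \<in> R m" using h(3) by (rule R_base)
  ultimately show ?case
    unfolding h(4) quad_wmat_G[OF assms(1) h(1,2)] using h(1,2)
    by (intro R_add R_scale R_sum G_R)
qed simp

text \<open>The matrices act on different indices, so only the sign of \<open>wmat\<close> matters:
  it is taken at \<open>j\<close> on one side and at \<open>i\<close> on the other, and
  \<open>par i + par j = k\<close> wherever \<open>\<mu> i j\<close> is nonzero.\<close>

lemma vmat_wmat_commute:
  assumes "ipar k \<mu>" "a \<in> L" "c \<in> L"
  shows "(\<Sum>b\<in>L. vmat \<mu> a b * wmat l \<nu> b c) = bsign (k * l) * (\<Sum>b\<in>L. wmat l \<nu> a b * vmat \<mu> b c)"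
proof -
  obtain i s j t where a: "a = (i, s)" and c: "c = (j, t)" by (cases a, cases c)
  then have mem: "i \<in> I" "s \<in> S" "j \<in> I" "t \<in> S" using assms by simp_all
  have "(\<Sum>b\<in>L. vmat \<mu> a b * wmat l \<nu> b c) = \<mu> i j * (bsign (l * par j) * \<nu> s t)"
  proof -
    have "(\<Sum>b\<in>L. vmat \<mu> a b * wmat l \<nu> b c) = (\<Sum>x\<in>I. \<mu> i x * wmat l \<nu> (x, s) c)"
      using vmat_row[OF mem(2), of \<mu> i "\<lambda>b. wmat l \<nu> b c"] by (simp only: a cscale_complex_def)
    also have "\<dots> = (\<Sum>x\<in>I. of_bool (x = j) *\<^sub>C (\<mu> i x * (bsign (l * par x) * \<nu> s t)))"
      by (simp only: c wmat_def fst_conv snd_conv cscale_complex_def mult.left_commute[of "\<mu> _ _" "of_bool _"])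
    finally show ?thesis by (simp only: sum_of_bool_cscale finite_I mem if_True)
  qed
  moreover have "(\<Sum>b\<in>L. wmat l \<nu> a b * vmat \<mu> b c) = bsign (l * par i) * (\<nu> s t * \<mu> i j)"
  proof -
    have "(\<Sum>b\<in>L. wmat l \<nu> a b * vmat \<mu> b c)
        = bsign (l * par i) * (\<Sum>u\<in>S. \<nu> s u * vmat \<mu> (i, u) c)"
      using wmat_row[OF mem(1), of l \<nu> s "\<lambda>b. vmat \<mu> b c"] by (simp only: a cscale_complex_def)
    also have "(\<Sum>u\<in>S. \<nu> s u * vmat \<mu> (i, u) c) = (\<Sum>u\<in>S. of_bool (u = t) *\<^sub>C (\<nu> s u * \<mu> i j))"
      by (simp only: c vmat_def fst_conv snd_conv cscale_complex_def
            mult.left_commute[of "\<nu> _ _" "of_bool _"])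
    finally show ?thesis by (simp only: sum_of_bool_cscale finite_S mem if_True)
  qed
  moreover have "\<mu> i j * (bsign (l * par j) * \<nu> s t) = bsign (k * l) * (bsign (l * par i) * (\<nu> s t * \<mu> i j))"
  proof (cases "\<mu> i j = 0")
    case False
    have k: "k = par i + par j" by (rule iparD[OF assms(1) False])
    show ?thesis unfolding k using bit_cases[of "par i"] bit_cases[of "par j"] bit_cases[of l]
      by (elim disjE) (simp_all add: bsign_def)
  qed simp
  ultimately show ?thesis by simp
qed

lemma quad_wmat_Inv:
  assumes "f \<in> Inv" "ipar l \<nu>"
  shows "quad L (wmat l \<nu>) f \<in> Inv"
proof -
  have "quad L (vmat \<mu>) (quad L (wmat l \<nu>) f) = 0" if "pe_mat n k \<mu>" for k \<mu>
  proof -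
    have "ipar k \<mu>" using that by (simp add: pe_mat_def)
    then have "quad L (vmat \<mu>) (quad L (wmat l \<nu>) f)
        = bsign (k * l) *\<^sub>C quad L (wmat l \<nu>) (quad L (vmat \<mu>) f)"
      using assms by (intro quad_supercommute vmat_wmat_commute parity_vmat parity_wmat
          fock_ssymm[OF Inv_fock] finite_L)
    then show ?thesis unfolding InvD[OF assms(1) that] by (simp add: quad_lin)
  qed
  then show ?thesis
    by (rule InvI[OF fock_quad[OF Inv_fock[OF assms(1)]]])
qed

subsection \<open>The frame\<close>

definition J where "J = {1..n}"
definition T where "T = S - fr ` J"

lemma fr_eq_iff [simp]: "fr i = fr j \<longleftrightarrow> i = j"
  by (auto simp: fr_def)

lemma par_fr [simp]: "par (fr j) = 0"
  by (simp add: fr_def)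

lemma finite_J [simp]: "finite J" and finite_T [simp]: "finite T"
  by (simp_all add: J_def T_def)

lemma Ev_I [simp]: "Ev i \<in> I \<longleftrightarrow> i \<in> J" and Od_I [simp]: "Od i \<in> I \<longleftrightarrow> i \<in> J"
  by (auto simp: I_def indices_def J_def)

lemma fr_S [simp]: "j \<in> J \<Longrightarrow> fr j \<in> S"
  by (auto simp: fr_def S_def indices_def J_def)

lemma T_S: "s \<in> T \<Longrightarrow> s \<in> S"
  by (simp add: T_def)

lemma T_fr: "s \<in> T \<Longrightarrow> j \<in> J \<Longrightarrow> s \<noteq> fr j" "j \<in> J \<Longrightarrow> fr j \<notin> T"
  by (auto simp: T_def)

lemma sum_I: "(\<Sum>i\<in>I. f i) = (\<Sum>j\<in>J. f (Ev j)) + (\<Sum>j\<in>J. f (Od j))"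
proof -
  have "I = Ev ` J \<union> Od ` J" by (auto simp: I_def indices_def J_def)
  moreover have "(\<Sum>i\<in>Ev ` J \<union> Od ` J. f i) = (\<Sum>i\<in>Ev ` J. f i) + (\<Sum>i\<in>Od ` J. f i)"
    by (rule sum.union_disjoint) auto
  ultimately show ?thesis by (simp add: sum.reindex inj_on_def)
qed

lemma sum_S: "(\<Sum>s\<in>S. f s) = (\<Sum>j\<in>J. f (fr j)) + (\<Sum>s\<in>T. f s)"
proof -
  have "S = fr ` J \<union> T" by (auto simp: T_def)
  moreover have "(\<Sum>s\<in>fr ` J \<union> T. f s) = (\<Sum>s\<in>fr ` J. f s) + (\<Sum>s\<in>T. f s)"
    by (rule sum.union_disjoint) (auto simp: T_def)
  ultimately show ?thesis by (simp add: sum.reindex inj_on_def)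
qed

text \<open>These matrices span the even part of \<open>pe(V)\<close>, a copy of
  \<open>gl(n)\<close> acting on unbarred indices and contragrediently on barred ones.\<close>

lemma pe_mat_gl:
  "pe_mat n 0 (\<lambda>a b. 1 * single (Ev l) (Ev j) a b + (- 1) * single (Od j) (Od l) a b)"
proof -
  have "ipar 0 (\<lambda>a b. 1 * single (Ev l) (Ev j) a b + (- 1) * single (Od j) (Od l) a b)"
    by (auto simp: ipar_def single_def)
  then show ?thesis
    unfolding pe_mat_def
  proof (intro conjI ballI)
    fix a b
    let ?m = "\<lambda>a b. 1 * single (Ev l) (Ev j) a b + (- 1) * single (Od j) (Od l) a b"
    show "?m a (bar b) + bsign (0 * par a) * ?m b (bar a) = 0"
      by (cases a; cases b) (auto simp: single_def)
  qed
qed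

lemma Inv_gl:
  assumes "f \<in> Inv" "j \<in> J" "l \<in> J"
  shows "(\<Sum>s\<in>S. cre (Ev l, s) (ann (Ev j, s) f)) = (\<Sum>s\<in>S. cre (Od j, s) (ann (Od l, s) f))"
proof -
  note InvD[OF assms(1) pe_mat_gl[of l j]]
  moreover have "Ev l \<in> I" "Ev j \<in> I" "Od j \<in> I" "Od l \<in> I" using assms by simp_all
  ultimately show ?thesis
    by (simp only: quad_vmat_two cscale_one cvs.scale_minus_left add_uminus_conv_diff right_minus_eq)
qed

text \<open>The odd part of \<open>pe(V)\<close> that turns barred coordinates into unbarred ones is
  antisymmetric in its two indices, so invariance becomes an equality of two operators.\<close>

lemma Inv_b:
  assumes "f \<in> Inv" "i \<in> J" "j \<in> J"
  shows "(\<Sum>s\<in>S. cre (Ev i, s) (ann (Od j, s) f)) = (\<Sum>s\<in>S. cre (Ev j, s) (ann (Od i, s) f))"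
proof -
  have "ipar 1 (\<lambda>a b. 1 * single (Ev i) (Od j) a b + (- 1) * single (Ev j) (Od i) a b)"
    by (auto simp: ipar_def single_def)
  then have "pe_mat n 1 (\<lambda>a b. 1 * single (Ev i) (Od j) a b + (- 1) * single (Ev j) (Od i) a b)"
    unfolding pe_mat_def
  proof (intro conjI ballI)
    fix a b
    let ?m = "\<lambda>a b. 1 * single (Ev i) (Od j) a b + (- 1) * single (Ev j) (Od i) a b"
    show "?m a (bar b) + bsign (1 * par a) * ?m b (bar a) = 0"
      unfolding single_bar bar.simps single_swap[of _ _ b a] by (cases a) simp_all
  qed
  note InvD[OF assms(1) this]
  moreover have "Ev i \<in> I" "Od j \<in> I" "Ev j \<in> I" "Od i \<in> I" using assms by simp_all
  ultimately show ?thesis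
    by (simp only: quad_vmat_two cscale_one cvs.scale_minus_left add_uminus_conv_diff right_minus_eq)
qed

text \<open>The opposite odd part is symmetric in its two indices. These equations differentiate in
  unbarred coordinates, hence transversally to the slice.\<close>

lemma Inv_c:
  assumes "f \<in> Inv" "i \<in> J" "j \<in> J"
  shows "(\<Sum>s\<in>S. cre (Od j, s) (ann (Ev i, s) f)) + (\<Sum>s\<in>S. cre (Od i, s) (ann (Ev j, s) f)) = 0"
proof -
  have "ipar 1 (\<lambda>a b. 1 * single (Od j) (Ev i) a b + 1 * single (Od i) (Ev j) a b)"
    by (auto simp: ipar_def single_def)
  then have "pe_mat n 1 (\<lambda>a b. 1 * single (Od j) (Ev i) a b + 1 * single (Od i) (Ev j) a b)"
    unfolding pe_mat_def
  proof (intro conjI ballI)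
    fix a b
    let ?m = "\<lambda>a b. 1 * single (Od j) (Ev i) a b + 1 * single (Od i) (Ev j) a b"
    show "?m a (bar b) + bsign (1 * par a) * ?m b (bar a) = 0"
      unfolding single_bar bar.simps single_swap[of _ _ b a] by (cases a) simp_all
  qed
  note InvD[OF assms(1) this]
  moreover have "Od j \<in> I" "Ev i \<in> I" "Od i \<in> I" "Ev j \<in> I" using assms by simp_all
  ultimately show ?thesis by (simp only: quad_vmat_two cscale_one)
qed

text \<open>The polarization by the matrix unit sending \<open>s\<close> to \<open>fr j\<close>.
  Frame vectors are even, so its parity is \<open>par s\<close>.\<close>

definition raise :: "nat \<Rightarrow> sindex \<Rightarrow> state \<Rightarrow> state" where
  "raise j s = quad L (wmat (par s) (single (fr j) s))"

lemma ipar_raise: "ipar (par s) (single (fr j) s)"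
  by (simp add: ipar_def single_def)

lemma raise_eq:
  assumes "j \<in> J" "s \<in> T"
  shows "raise j s f = (\<Sum>i\<in>J. cre (Ev i, fr j) (ann (Ev i, s) f))
    + bsign (par s) *\<^sub>C (\<Sum>i\<in>J. cre (Od i, fr j) (ann (Od i, s) f))"
  unfolding raise_def quad_wmat
  by (simp only: sum_single[OF fr_S[OF assms(1)] T_S[OF assms(2)] finite_S finite_S] sum_I
        par.simps bsign_simps mult_zero_right mult_1_right cscale_one cvs.scale_sum_right)

subsection \<open>Evaluation on the slice\<close>

text \<open>In the notation \<open>x\<^bsub>is\<^esub> = cre (Ev i, s)\<close>, \<open>\<xi>\<^bsub>is\<^esub> = cre (Od i, s)\<close> this sets the frame part of \<open>x\<close> to
  the identity matrix and the rest of \<open>x\<close> to zero.\<close>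

fun slice_op :: "letter \<Rightarrow> state \<Rightarrow> state" where
  "slice_op (Ev i, s) y = of_bool (s = fr i) *\<^sub>C y"
| "slice_op (Od i, s) y = cre (Od i, s) y"

definition slice :: "nat \<Rightarrow> state \<Rightarrow> state" where "slice = hmap L slice_op vac"

lemma clinear_slice_op: "clinear (slice_op a)"
proof (cases a)
  case (Pair i s)
  have "slice_op a = (\<lambda>y. of_bool (s = fr k) *\<^sub>C y)" if "i = Ev k" for k
    by (rule ext) (simp only: Pair that slice_op.simps)
  moreover have "slice_op a = cre (Od k, s)" if "i = Od k" for k
    by (rule ext) (simp only: Pair that slice_op.simps)
  ultimately show ?thesis
    by (cases i) (simp_all only: clinear_compose_cscale[OF clinear_id] clinear_cre)
qed

lemma clinear_slice: "clinear (slice m)"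
  unfolding slice_def by (rule clinear_hmap[OF clinear_slice_op])

lemmas slice_lin = clin[OF clinear_slice]

lemma slice_op_commute: "slice_op b (slice_op a y) = sg a b *\<^sub>C slice_op a (slice_op b y)"
proof (cases a, cases b)
  fix i s j t assume a: "a = (i, s)" and b: "b = (j, t)"
  show ?thesis
  proof (cases i; cases j)
    fix k l assume "i = Ev k" "j = Ev l"
    then show ?thesis
      by (cases "s = fr k"; cases "t = fr l") (simp_all add: a b sg_def lpar_def)
  next
    fix k l assume "i = Ev k" "j = Od l"
    then show ?thesis
      by (cases "s = fr k") (simp_all add: a b sg_def lpar_def cre_lin)
  next
    fix k l assume "i = Od k" "j = Ev l"
    then show ?thesis
      by (cases "t = fr l") (simp_all add: a b sg_def lpar_def cre_lin)
  next
    fix k l assume ij: "i = Od k" "j = Od l"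
    show ?thesis unfolding a b ij slice_op.simps cre_cre[of "(Od l, t)"] by (simp only: sg_commute)
  qed
qed

lemma slice_cre: "a \<in> L \<Longrightarrow> slice (Suc m) (cre a h) = slice_op a (slice m h)"
  unfolding slice_def by (rule hmap_cre[OF clinear_slice_op finite_L _ slice_op_commute])

text \<open>Differentiation in \<open>\<xi>\<close> is tangent to the slice: a barred letter is
  untouched by the substitution and an unbarred one becomes a constant.\<close>

lemma slice_ann:
  assumes "h \<in> fock L" "i \<in> J" "s \<in> S"
  shows "ann (Od i, s) (slice (Suc m) h) = slice m (ann (Od i, s) h)"
  unfolding slice_def
proof (rule hmap_ann[OF clinear_slice_op clinear_ann finite_L _ _ ann_vac assms(1)])
  show "(Od i, s) \<in> L" using assms by simp
  fix b :: letter and y :: state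
  obtain j t where b: "b = (j, t)" by (cases b)
  show "ann (Od i, s) (slice_op b y) = of_bool ((Od i, s) = b) *\<^sub>C y + sg (Od i, s) b *\<^sub>C slice_op b (ann (Od i, s) y)"
  proof (cases j)
    case (Ev k)
    then show ?thesis
      by (cases "t = fr k") (simp_all add: b sg_def lpar_def ann_lin)
  next
    case (Od k)
    then show ?thesis unfolding b Od slice_op.simps ann_cre
      by (simp only: sg_commute eq_commute[of "(Od i, s)"])
  qed
qed

lemma slice_fock: "slice m h \<in> fock L"
  unfolding slice_def
proof (induction m arbitrary: h)
  case 0
  show ?case by (simp only: hmap.simps) (rule fock_cscale[OF fock_vac])
next
  case (Suc m)
  have *: "slice_op b y \<in> fock L" if "b \<in> L" "y \<in> fock L" for b y
  proof -
    obtain i s where b: "b = (i, s)" by (cases b)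
    show ?thesis
      using that unfolding b by (cases i) (simp_all only: slice_op.simps fock_cscale fock_cre)
  qed
  show ?case unfolding hmap.simps(2) by (intro fock_cscale fock_sum *[OF _ Suc])
qed

lemma ann_Ev_slice: "ann (Ev i, s) (slice m h) = 0"
  unfolding slice_def
proof (induction m arbitrary: h)
  case 0
  show ?case by (simp only: hmap.simps ann_lin ann_vac cvs.scale_zero_right)
next
  case (Suc m)
  have "ann (Ev i, s) (slice_op b y) = 0" if "ann (Ev i, s) y = 0" for b y
  proof -
    obtain j t where b: "b = (j, t)" by (cases b)
    show ?thesis
      unfolding b
      by (cases j) (simp_all only: slice_op.simps ann_lin ann_cre that cre_lin cvs.scale_zero_right, simp)
  qed
  then show ?case unfolding hmap.simps(2) ann_lin using Suc by (simp only: sum.neutral_const cvs.scale_zero_right)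
qed

end

lemma add_cancel_regroup: "(h' + k) + (h + k') = (a + h + k) + (- a + h' + k')"
  for a h h' k k' :: "'a::ab_group_add"
  by (simp add: algebra_simps)

lemma fock_support: "f \<in> fock L \<Longrightarrow> f w \<noteq> 0 \<Longrightarrow> set w \<subseteq> L"
  unfolding fock_def by blast

context frame
begin

text \<open>On the slice the coefficient \<open>cre (Ev l, s)\<close> becomes 1 for
  \<open>s = fr l\<close> and 0 otherwise. A vector field with unbarred coefficients thus restricts
  to one transverse derivative.\<close>

lemma slice_sum_Ev:
  assumes "l \<in> J"
  shows "slice (Suc k) (\<Sum>s\<in>S. cre (Ev l, s) (F s)) = slice k (F (fr l))"
proof -
  have "slice (Suc k) (\<Sum>s\<in>S. cre (Ev l, s) (F s)) = (\<Sum>s\<in>S. of_bool (s = fr l) *\<^sub>C slice k (F s))"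
    unfolding slice_lin
    by (rule sum.cong[OF refl]) (simp only: slice_cre mem_L Ev_I assms simp_thms slice_op.simps)
  then show ?thesis by (simp only: sum_of_bool_cscale finite_S fr_S assms if_True)
qed

lemma slice_sum_Od:
  assumes "j \<in> J"
  shows "slice (Suc k) (\<Sum>s\<in>S. cre (Od j, s) (F s)) = (\<Sum>s\<in>S. cre (Od j, s) (slice k (F s)))"
  unfolding slice_lin
  by (rule sum.cong[OF refl]) (simp only: slice_cre mem_L Od_I assms simp_thms slice_op.simps)

lemma slice_raise:
  assumes "j \<in> J" "s \<in> T"
  shows "slice (Suc k) (raise j s f) = slice k (ann (Ev j, s) f)
    + bsign (par s) *\<^sub>C (\<Sum>i\<in>J. cre (Od i, fr j) (slice k (ann (Od i, s) f)))"
proof -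
  have "slice (Suc k) (\<Sum>i\<in>J. cre (Ev i, fr j) (ann (Ev i, s) f))
      = (\<Sum>i\<in>J. of_bool (j = i) *\<^sub>C slice k (ann (Ev i, s) f))"
    unfolding slice_lin
    by (rule sum.cong[OF refl])
      (simp only: slice_cre mem_L Ev_I fr_S assms simp_thms slice_op.simps fr_eq_iff)
  moreover have "slice (Suc k) (\<Sum>i\<in>J. cre (Od i, fr j) (ann (Od i, s) f))
      = (\<Sum>i\<in>J. cre (Od i, fr j) (slice k (ann (Od i, s) f)))"
    unfolding slice_lin
    by (rule sum.cong[OF refl])
      (simp only: slice_cre mem_L Od_I fr_S assms simp_thms slice_op.simps)
  ultimately show ?thesis
    unfolding raise_eq[OF assms] by (simp only: slice_lin(4,5) sum_of_bool_cscale finite_J assms if_True)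
qed

subsection \<open>Equations on the slice\<close>

text \<open>Restricted to the slice, the inner product of \<open>fr i\<close> and
  \<open>fr j\<close> is this symmetrized odd variable, compare \<open>slice_G\<close>. The operator
  \<open>dsig\<close> is the adjoint derivative.\<close>

definition sig :: "nat \<Rightarrow> nat \<Rightarrow> state \<Rightarrow> state" where
  "sig i j h = cre (Od i, fr j) h + cre (Od j, fr i) h"

definition dsig :: "nat \<Rightarrow> nat \<Rightarrow> state \<Rightarrow> state" where
  "dsig i j h = ann (Od i, fr j) h + ann (Od j, fr i) h"

lemma sig_lin: "sig i j (c *\<^sub>C h) = c *\<^sub>C sig i j h" "sig i j 0 = 0"
  "sig i j (\<Sum>a\<in>A. F a) = (\<Sum>a\<in>A. sig i j (F a))"
  unfolding sig_def cre_lin sum.distrib cscale_add_right by simp_all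

lemma dsig_lin: "dsig i j (c *\<^sub>C h) = c *\<^sub>C dsig i j h" "dsig i j 0 = 0"
  "dsig i j (h + h') = dsig i j h + dsig i j h'"
  "dsig i j (\<Sum>a\<in>A. F a) = (\<Sum>a\<in>A. dsig i j (F a))"
  unfolding dsig_def ann_lin sum.distrib cscale_add_right by (simp_all only: add_0_left ac_simps)

lemma sig_swap: "sig i j h = sig j i h"
  unfolding sig_def by (rule add.commute)

lemma dsig_swap: "dsig i j h = dsig j i h"
  unfolding dsig_def by (rule add.commute)

lemma sg_Od_fr: "sg (Od j, s) (Od a, fr i) = - bsign (par s)"
  unfolding sg_def lpar_def using bit_cases[of "par s"] by (elim disjE) (simp_all add: bsign_def)

lemma cre_Od_fr: "cre (Od j, s) (cre (Od a, fr i) h) = (- bsign (par s)) *\<^sub>C cre (Od a, fr i) (cre (Od j, s) h)"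
  unfolding cre_cre[of "(Od j, s)" "(Od a, fr i)"] sg_Od_fr ..

lemma cre_ann_Od_fr:
  assumes "s \<in> T" "i \<in> J"
  shows "cre (Od j, s) (ann (Od a, fr i) h) = (- bsign (par s)) *\<^sub>C ann (Od a, fr i) (cre (Od j, s) h)"
proof -
  have "(Od j, s) \<noteq> (Od a, fr i)" using T_fr(1)[OF assms] by simp
  then have "ann (Od a, fr i) (cre (Od j, s) h) = (- bsign (par s)) *\<^sub>C cre (Od j, s) (ann (Od a, fr i) h)"
    unfolding ann_cre sg_Od_fr by (simp only: of_bool_eq cvs.scale_zero_left add_0_left)
  then show ?thesis by (simp only: cscale_cscale mult_minus_left mult_minus_right minus_minus bsign_simps cscale_one)
qed

lemma cre_sig: "cre (Od k, s) (sig i j h) = (- bsign (par s)) *\<^sub>C sig i j (cre (Od k, s) h)"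
  unfolding sig_def cre_lin cre_Od_fr[of k s] cscale_add_right ..

text \<open>Since \<open>s\<close> lies outside the frame, the letter \<open>(Od k, s)\<close>
  contracts with nothing; it passes two odd operators and the two signs cancel.\<close>

lemma cre_dsig_sig:
  assumes "s \<in> T" "i \<in> J" "k \<in> J"
  shows "cre (Od k, s) (dsig i k (sig i j h)) = dsig i k (sig i j (cre (Od k, s) h))"
proof -
  have "cre (Od k, s) (dsig i k (sig i j h)) = (- bsign (par s)) *\<^sub>C dsig i k (cre (Od k, s) (sig i j h))"
    unfolding dsig_def cre_lin cre_ann_Od_fr[OF assms(1,2)] cre_ann_Od_fr[OF assms(1,3)] cscale_add_right ..
  then show ?thesis
    by (simp only: cre_sig dsig_lin cscale_cscale mult_minus_left mult_minus_right minus_minus bsign_simps cscale_one)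
qed

text \<open>The restriction depends on the odd frame variables only through their symmetric
  combinations \<open>sig\<close>. This is what allows \<open>lift\<close> to invert
  restriction.\<close>

lemma slice_Inv_b:
  assumes "f \<in> Inv" "i \<in> J" "j \<in> J"
  shows "ann (Od i, fr j) (slice (Suc k) f) = ann (Od j, fr i) (slice (Suc k) f)"
  using arg_cong[OF Inv_b[OF assms], of "slice (Suc k)"] assms(2,3)
  by (simp only: slice_sum_Ev slice_ann[OF Inv_fock[OF assms(1)]] fr_S)

text \<open>Moving the frame matrix away from the identity is the infinitesimal action of
  \<open>gl(n)\<close>, so invariance expresses this transverse derivative through the
  restriction.\<close>

lemma slice_Inv_gl:
  assumes "f \<in> Inv" "j \<in> J" "l \<in> J"
  shows "slice k (ann (Ev j, fr l) f) = (\<Sum>s\<in>S. cre (Od j, s) (ann (Od l, s) (slice (Suc k) f)))"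
proof -
  have "(\<Sum>s\<in>S. cre (Od j, s) (slice k (ann (Od l, s) f)))
    = (\<Sum>s\<in>S. cre (Od j, s) (ann (Od l, s) (slice (Suc k) f)))"
    by (rule sum.cong[OF refl]) (simp only: slice_ann[OF Inv_fock[OF assms(1)] assms(3)])
  then show ?thesis
    using arg_cong[OF Inv_gl[OF assms], of "slice (Suc k)"] assms(2,3)
    by (simp only: slice_sum_Ev slice_sum_Od)
qed

text \<open>This handles the remaining transverse directions, the unbarred coordinates outside the
  frame, where \<open>raise\<close> plays the part of \<open>gl(n)\<close>.\<close>

lemma slice_raise_zero:
  assumes "f \<in> Inv" "raise j s f = 0" "j \<in> J" "s \<in> T"
  shows "slice k (ann (Ev j, s) f)
    = (- bsign (par s)) *\<^sub>C (\<Sum>i\<in>J. cre (Od i, fr j) (ann (Od i, s) (slice (Suc k) f)))"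
proof -
  have "(\<Sum>i\<in>J. cre (Od i, fr j) (slice k (ann (Od i, s) f)))
    = (\<Sum>i\<in>J. cre (Od i, fr j) (ann (Od i, s) (slice (Suc k) f)))"
    by (rule sum.cong[OF refl]) (simp only: slice_ann[OF Inv_fock[OF assms(1)] _ T_S[OF assms(4)]])
  then have "slice k (ann (Ev j, s) f)
    + bsign (par s) *\<^sub>C (\<Sum>i\<in>J. cre (Od i, fr j) (ann (Od i, s) (slice (Suc k) f))) = 0"
    using slice_raise[OF assms(3,4), of k f] unfolding assms(2) slice_lin by (simp only: )
  then show ?thesis by (simp only: add_eq_0_iff2 cvs.scale_minus_left)
qed

text \<open>In the restricted equations of \<open>Inv_c\<close> every transverse derivative is
  replaced by tangential ones. What survives is a first-order equation for the restriction alone,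
  with coefficients of degree two in \<open>\<xi>\<close>.\<close>

lemma slice_Inv_c:
  fixes k :: nat
  assumes "f \<in> Inv" "\<And>j s. j \<in> J \<Longrightarrow> s \<in> T \<Longrightarrow> raise j s f = 0" "i \<in> J" "j \<in> J"
  defines "D \<equiv> \<lambda>a s. ann (Od a, s) (slice (Suc k) f)"
  shows "(\<Sum>a\<in>J. \<Sum>s\<in>T. sig i a (cre (Od j, s) (D a s)))
    + (\<Sum>a\<in>J. \<Sum>s\<in>T. sig j a (cre (Od i, s) (D a s))) = 0"
proof -
  \<comment> \<open>\<open>F\<close> and \<open>H\<close> collect the frame and the non-frame
    summands produced by \<open>slice_Inv_gl\<close>, while \<open>K\<close> comes from
    \<open>slice_raise_zero\<close>.\<close>
  define F where "F i j = (\<Sum>l\<in>J. \<Sum>a\<in>J. cre (Od j, fr l) (cre (Od i, fr a) (D l (fr a))))" for i j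
  define H where "H i j = (\<Sum>a\<in>J. \<Sum>s\<in>T. cre (Od j, fr a) (cre (Od i, s) (D a s)))" for i j
  define K where "K i j = (\<Sum>a\<in>J. \<Sum>s\<in>T. cre (Od a, fr i) (cre (Od j, s) (D a s)))" for i j
  have Q: "(\<Sum>s\<in>S. cre (Od j, s) (slice k (ann (Ev i, s) f))) = F i j + H i j + K i j"
    if "i \<in> J" "j \<in> J" for i j
  proof -
    have "(\<Sum>l\<in>J. cre (Od j, fr l) (slice k (ann (Ev i, fr l) f)))
      = (\<Sum>l\<in>J. cre (Od j, fr l) (\<Sum>s\<in>S. cre (Od i, s) (D l s)))"
      unfolding D_def by (rule sum.cong[OF refl]) (simp only: slice_Inv_gl[OF assms(1) that(1)])
    also have "\<dots> = F i j + H i j"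
      unfolding sum_S cre_lin sum.distrib F_def H_def ..
    finally have 1: "(\<Sum>l\<in>J. cre (Od j, fr l) (slice k (ann (Ev i, fr l) f))) = F i j + H i j" .
    have "(\<Sum>s\<in>T. cre (Od j, s) (slice k (ann (Ev i, s) f)))
      = (\<Sum>s\<in>T. cre (Od j, s) ((- bsign (par s)) *\<^sub>C (\<Sum>a\<in>J. cre (Od a, fr i) (D a s))))"
      unfolding D_def
      by (rule sum.cong[OF refl]) (simp only: slice_raise_zero[OF assms(1) assms(2)[OF that(1)] that(1)])
    also have "\<dots> = (\<Sum>s\<in>T. \<Sum>a\<in>J. cre (Od a, fr i) (cre (Od j, s) (D a s)))"
      unfolding cre_lin cre_Od_fr cvs.scale_sum_right cscale_cscale
      by (simp only: mult_minus_left mult_minus_right minus_minus bsign_simps cscale_one)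
    also have "\<dots> = K i j" unfolding K_def by (rule sum.swap)
    finally show ?thesis unfolding sum_S 1 by (simp only:)
  qed
  \<comment> \<open>By \<open>slice_Inv_b\<close> the derivatives are symmetric in \<open>l\<close>
    and \<open>a\<close>, whereas odd frame letters anticommute; so \<open>F\<close> drops out of
    the equation symmetrized in \<open>i\<close> and \<open>j\<close>.\<close>
  have "F j i = - F i j"
  proof -
    have "F j i = (\<Sum>l\<in>J. \<Sum>a\<in>J. - cre (Od j, fr a) (cre (Od i, fr l) (D a (fr l))))"
      unfolding F_def
    proof (intro sum.cong refl)
      fix l a assume la: "l \<in> J" "a \<in> J"
      have "D l (fr a) = D a (fr l)" unfolding D_def by (rule slice_Inv_b[OF assms(1) la])
      then show "cre (Od i, fr l) (cre (Od j, fr a) (D l (fr a))) = - cre (Od j, fr a) (cre (Od i, fr l) (D a (fr l)))"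
        unfolding cre_Od_fr[of i "fr l"] by (simp only: par_fr bsign_simps cvs.scale_minus_left cscale_one)
    qed
    also have "\<dots> = (\<Sum>a\<in>J. \<Sum>l\<in>J. - cre (Od j, fr a) (cre (Od i, fr l) (D a (fr l))))"
      by (rule sum.swap)
    finally show ?thesis unfolding F_def by (simp only: sum_negf)
  qed
  moreover have "(F i j + H i j + K i j) + (F j i + H j i + K j i) = 0"
    using arg_cong[OF Inv_c[OF assms(1,3,4)], of "slice (Suc k)"]
    by (simp only: slice_lin(1,4) slice_sum_Od assms(3,4) Q)
  ultimately have "(H j i + K i j) + (H i j + K j i) = 0"
    unfolding add_cancel_regroup[of "H j i" "K i j" "H i j" "K j i" "F i j"] by (simp only:)
  then show ?thesis unfolding sig_def sum.distrib H_def K_def by (simp only:)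
qed

text \<open>Write \<open>Z i s\<close> for the sum to be shown zero. The letters
  \<open>(Od k, s)\<close> pass freely through \<open>dsig\<close> and \<open>sig\<close>, so the
  sum of \<open>Z* Z\<close> over \<open>i\<close> and \<open>s\<close> becomes the sum of
  \<open>dsig i k (Q i k)\<close>. Here \<open>dsig\<close> is symmetric in \<open>i\<close> and
  \<open>k\<close>, while \<open>star\<close> makes \<open>Q\<close> antisymmetric. The squared
  norms of all \<open>Z i s\<close> therefore add up to zero.\<close>

lemma slice_positivity:
  assumes "g \<in> fock L"
    and star: "\<And>i k. i \<in> J \<Longrightarrow> k \<in> J \<Longrightarrow>
      (\<Sum>a\<in>J. \<Sum>s\<in>T. sig i a (cre (Od k, s) (ann (Od a, s) g)))
      + (\<Sum>a\<in>J. \<Sum>s\<in>T. sig k a (cre (Od i, s) (ann (Od a, s) g))) = 0"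
    and "i \<in> J" "s \<in> T"
  shows "(\<Sum>j\<in>J. sig i j (ann (Od j, s) g)) = 0"
proof -
  define D where "D a s = ann (Od a, s) g" for a s
  define Z where "Z i s = (\<Sum>j\<in>J. sig i j (D j s))" for i s
  define Q where "Q i k = (\<Sum>a\<in>J. \<Sum>s\<in>T. sig i a (cre (Od k, s) (D a s)))" for i k
  have mem1: "(Od i, s) \<in> L" if "i \<in> J" "s \<in> T" for i s
    using that by (simp add: T_S)
  have mem2: "(Od i, fr k) \<in> L" if "i \<in> J" "k \<in> J" for i k
    using that by simp
  have Dfock: "D a s \<in> fock L" for a s unfolding D_def by (rule fock_ann[OF assms(1)])
  have Zfock: "Z i s \<in> fock L" if "i \<in> J" "s \<in> T" for i s
    unfolding Z_def sig_def by (intro fock_sum fock_add fock_cre Dfock mem2 that)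
  \<comment> \<open>Both factors of \<open>Z\<close> in the left argument are moved across by
    adjunction: \<open>sig\<close> becomes \<open>dsig\<close>, and differentiation in
    \<open>(Od k, s)\<close> becomes creation.\<close>
  have ZZ: "ip L (Suc r) (Z i s) (Z i s) = ip L (Suc r) g (\<Sum>k\<in>J. cre (Od k, s) (dsig i k (Z i s)))"
    if isT: "i \<in> J" "s \<in> T" for r i s
  proof -
    have "ip L (Suc r) (sig i k (D k s)) (Z i s) = ip L (Suc r) g (cre (Od k, s) (dsig i k (Z i s)))"
      if "k \<in> J" for k
    proof -
      have "ip L (Suc r) (sig i k (D k s)) (Z i s) = ip L r (D k s) (dsig i k (Z i s))"
        unfolding sig_def dsig_def ip_lin ip_lin_left
        using ip_ann[OF finite_L _ fock_ssymm[OF Zfock[OF isT]]] mem2 isT that by (simp only:)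
      also have "\<dots> = ip L (Suc r) g (cre (Od k, s) (dsig i k (Z i s)))"
        unfolding D_def
        by (rule ip_cre[symmetric]) (use mem1 isT that fock_ssymm[OF assms(1)] in simp_all)
      finally show ?thesis .
    qed
    then have "(\<Sum>k\<in>J. ip L (Suc r) (sig i k (D k s)) (Z i s))
      = (\<Sum>k\<in>J. ip L (Suc r) g (cre (Od k, s) (dsig i k (Z i s))))"
      by (rule sum.cong[OF refl])
    then show ?thesis unfolding ip_lin(6) by (subst (1) Z_def) (simp only: ip_lin_left)
  qed
  have "(\<Sum>i\<in>J. \<Sum>s\<in>T. \<Sum>k\<in>J. cre (Od k, s) (dsig i k (Z i s))) = (\<Sum>i\<in>J. \<Sum>k\<in>J. dsig i k (Q i k))"
  proof (rule sum.cong[OF refl])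
    fix i assume i: "i \<in> J"
    have "cre (Od k, s) (dsig i k (Z i s)) = dsig i k (\<Sum>j\<in>J. sig i j (cre (Od k, s) (D j s)))"
      if "k \<in> J" "s \<in> T" for k s
      unfolding Z_def dsig_lin cre_lin cre_dsig_sig[OF that(2) i that(1)] ..
    then have "(\<Sum>s\<in>T. \<Sum>k\<in>J. cre (Od k, s) (dsig i k (Z i s)))
        = (\<Sum>s\<in>T. \<Sum>k\<in>J. dsig i k (\<Sum>j\<in>J. sig i j (cre (Od k, s) (D j s))))"
      by (intro sum.cong refl)
    also have "\<dots> = (\<Sum>k\<in>J. \<Sum>s\<in>T. \<Sum>j\<in>J. dsig i k (sig i j (cre (Od k, s) (D j s))))"
      unfolding dsig_lin by (rule sum.swap)
    also have "\<dots> = (\<Sum>k\<in>J. dsig i k (Q i k))"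
      unfolding Q_def dsig_lin by (rule sum.cong[OF refl], rule sum.swap)
    finally show "(\<Sum>s\<in>T. \<Sum>k\<in>J. cre (Od k, s) (dsig i k (Z i s))) = (\<Sum>k\<in>J. dsig i k (Q i k))" .
  qed
  moreover have "(\<Sum>i\<in>J. \<Sum>k\<in>J. dsig i k (Q i k)) = 0" (is "?X = 0")
  proof -
    have "?X = (\<Sum>i\<in>J. \<Sum>k\<in>J. dsig k i (Q k i))" by (rule sum.swap)
    also have "\<dots> = (\<Sum>i\<in>J. \<Sum>k\<in>J. dsig i k (Q k i))" by (simp only: dsig_swap)
    finally have "?X + ?X = (\<Sum>i\<in>J. \<Sum>k\<in>J. dsig i k (Q i k)) + (\<Sum>i\<in>J. \<Sum>k\<in>J. dsig i k (Q k i))"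
      by (rule arg_cong)
    also have "\<dots> = (\<Sum>i\<in>J. \<Sum>k\<in>J. dsig i k (Q i k + Q k i))"
      unfolding dsig_lin(3) sum.distrib ..
    also have "\<dots> = (\<Sum>i\<in>J. \<Sum>k\<in>J. 0)"
    proof (intro sum.cong refl)
      fix i k assume "i \<in> J" "k \<in> J"
      then have "Q i k + Q k i = 0" unfolding Q_def D_def by (rule star)
      then show "dsig i k (Q i k + Q k i) = 0" by (simp only: dsig_lin)
    qed
    finally have "2 *\<^sub>C ?X = 0"
      unfolding one_add_one[symmetric] cscale_add_left cscale_one by (simp only: sum.neutral_const)
    then show ?thesis by (simp only: cvs.scale_eq_0_iff) simp
  qed
  ultimately have tot: "(\<Sum>i\<in>J. \<Sum>s\<in>T. \<Sum>k\<in>J. cre (Od k, s) (dsig i k (Z i s))) = 0" by (rule trans)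
  have "Re (ip L (Suc r) (Z i s) (Z i s)) = 0" for r
  proof -
    have "(\<Sum>i\<in>J. \<Sum>s\<in>T. ip L (Suc r) (Z i s) (Z i s))
      = (\<Sum>i\<in>J. \<Sum>s\<in>T. ip L (Suc r) g (\<Sum>k\<in>J. cre (Od k, s) (dsig i k (Z i s))))"
      by (intro sum.cong refl ZZ)
    also have "\<dots> = ip L (Suc r) g (\<Sum>i\<in>J. \<Sum>s\<in>T. \<Sum>k\<in>J. cre (Od k, s) (dsig i k (Z i s)))"
      unfolding ip_lin(6) ..
    also have "\<dots> = 0" unfolding tot by (rule ip_lin)
    finally have "Re (\<Sum>i\<in>J. \<Sum>s\<in>T. ip L (Suc r) (Z i s) (Z i s)) = 0"
      by (simp only: zero_complex.sel)
    then have sum0: "(\<Sum>i\<in>J. \<Sum>s\<in>T. Re (ip L (Suc r) (Z i s) (Z i s))) = 0"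
      unfolding Re_sum .
    have nn: "0 \<le> Re (ip L (Suc r) (Z i s) (Z i s))" for i s
      using ip_self by blast
    have "(\<Sum>s\<in>T. Re (ip L (Suc r) (Z i s) (Z i s))) = 0"
      by (rule sum_nonneg_0[OF finite_J _ sum0 assms(3)]) (rule sum_nonneg, rule nn)
    from sum_nonneg_0[OF finite_T nn this assms(4)] show ?thesis .
  qed
  note Re0 = this
  \<comment> \<open>The norms were computed in positive degrees only. The value at the empty word
    vanishes because \<open>sig\<close> creates a letter.\<close>
  have "Z i s w = 0" for w
  proof (cases w)
    case Nil
    then show ?thesis by (simp add: Z_def sum_fun_apply sig_def)
  next
    case (Cons a v)
    show ?thesis
    proof (rule ip_definite[OF finite_L _ Re0[of "length v"]])
      show "set u \<subseteq> L" if "Z i s u \<noteq> 0" for u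
        using Zfock[OF assms(3,4)] that by (rule fock_support)
      show "length w = Suc (length v)" by (simp only: Cons list.size add_0_right add_Suc_right)
    qed
  qed
  then have "Z i s = 0" by (intro ext) (simp only: zero_fun_apply)
  then show ?thesis unfolding Z_def D_def .
qed


subsection \<open>Injectivity of the slice map\<close>

lemma foldr_ann: "foldr ann as f w = f (rev as @ w)"
  by (induction as arbitrary: w) (simp_all add: ann_def)

definition derivs :: "state \<Rightarrow> nat \<Rightarrow> state set" where
  "derivs f k = (\<lambda>as. foldr ann as f) ` {as. length as = k \<and> set as \<subseteq> L}"

lemma derivsE:
  assumes "x \<in> derivs f k"
  obtains as where "length as = k" "set as \<subseteq> L" "x = foldr ann as f"
  using assms unfolding derivs_def by (elim imageE CollectE conjE) (rule that)

lemma derivsI: "set as \<subseteq> L \<Longrightarrow> foldr ann as f \<in> derivs f (length as)"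
  unfolding derivs_def by (intro imageI CollectI conjI refl)

lemma ann_span_derivs:
  assumes "x \<in> cvs.span (derivs f k)" "a \<in> L"
  shows "ann a x \<in> cvs.span (derivs f (Suc k))"
  using assms(1)
proof (induction rule: cvs.span_induct_alt)
  case base
  show ?case unfolding ann_lin by (rule cvs.span_zero)
next
  case (step c x y)
  from step(1) obtain as where as: "length as = k" "set as \<subseteq> L" "x = foldr ann as f"
    by (rule derivsE)
  have "set (a # as) \<subseteq> L" using as assms(2) by simp
  from derivsI[OF this, of f] have "ann a x \<in> derivs f (Suc k)"
    by (simp only: as foldr.simps o_apply list.size add_0_right add_Suc_right)
  then show ?case unfolding ann_lin by (intro cvs.span_add[OF _ step(2)] cvs.span_scale cvs.span_base)
qed

lemma fock_foldr_ann: "f \<in> fock L \<Longrightarrow> foldr ann as f \<in> fock L"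
proof (induction as)
  case (Cons a as)
  then show ?case unfolding foldr.simps o_apply by (intro fock_ann)
qed (simp only: foldr.simps id_apply)

text \<open>The supercommutator of \<open>quad L M\<close> with a derivative is a combination of
  derivatives. An operator that kills \<open>f\<close> hence sends derivatives of order k to
  combinations of derivatives of the same order.\<close>

lemma quad_derivs:
  assumes "f \<in> fock L" "parity_mat k M" "quad L M f = 0" "set as \<subseteq> L"
  shows "quad L M (foldr ann as f) \<in> cvs.span (derivs f (length as))"
  using assms(4)
proof (induction as)
  case Nil
  show ?case unfolding foldr.simps id_apply assms(3) by (rule cvs.span_zero)
next
  case (Cons e as)
  let ?g = "foldr ann as f"
  have e: "e \<in> L" "set as \<subseteq> L" using Cons.prems by simp_all
  have len: "length (e # as) = Suc (length as)" by simp
  have "quad L M (ann e ?g)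
      = bsign (k * lpar e) *\<^sub>C (ann e (quad L M ?g) - (\<Sum>b\<in>L. M e b *\<^sub>C ann b ?g))"
    unfolding ann_quad[OF finite_L e(1) assms(2) fock_ssymm[OF fock_foldr_ann[OF assms(1)]]]
    by (simp only: add_diff_cancel_left' cscale_cscale bsign_simps cscale_one)
  moreover have "ann b ?g \<in> cvs.span (derivs f (Suc (length as)))" if "b \<in> L" for b
    using derivsI[OF e(2)] that by (intro ann_span_derivs cvs.span_base)
  ultimately show ?case
    unfolding len foldr.simps o_apply
    by (simp only:)
      (intro cvs.span_scale cvs.span_diff cvs.span_sum ann_span_derivs[OF Cons.IH[OF e(2)] e(1)])
qed

lemma slice_span_zero:
  assumes "x \<in> cvs.span B" "\<And>b. b \<in> B \<Longrightarrow> slice m b = 0"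
  shows "slice m x = 0"
  using assms(1)
proof (induction rule: cvs.span_induct_alt)
  case base
  show ?case by (rule slice_lin)
next
  case (step c x y)
  show ?case unfolding slice_lin step(2) assms(2)[OF step(1)] by (simp only: cvs.scale_zero_right add_0_left)
qed

text \<open>Taylor expansion transverse to the slice, by induction on the order. If \<open>g\<close>
  is a derivative of order k, its \<open>\<xi>\<close>-derivatives vanish on the slice because
  \<open>g\<close> does. For an unbarred direction, apply \<open>raise\<close> or an element of
  \<open>gl(n)\<close> to \<open>g\<close>: by \<open>quad_derivs\<close> the result vanishes on the
  slice, and there it equals the wanted derivative up to terms with \<open>\<xi>\<close>-derivatives
  of \<open>g\<close>.\<close>

lemma slice_derivs_zero:
  assumes f: "f \<in> Inv" and r: "\<And>j s. j \<in> J \<Longrightarrow> s \<in> T \<Longrightarrow> raise j s f = 0"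
    and z: "slice m f = 0" and "k + l = m" "x \<in> derivs f k"
  shows "slice l x = 0"
  using assms(4,5)
proof (induction k arbitrary: l x)
  case 0
  from 0(2) obtain as where "length as = 0" "x = foldr ann as f" by (rule derivsE)
  then have "x = f" by (simp only: length_0_conv foldr.simps id_apply)
  moreover have "l = m" using 0(1) by simp
  ultimately show ?case using z by (simp only:)
next
  case (Suc k)
  from Suc.prems(2) obtain as' where as': "length as' = Suc k" "set as' \<subseteq> L" "x = foldr ann as' f"
    by (rule derivsE)
  obtain a as where as: "as' = a # as" "length as = k" using as'(1) by (cases as') auto
  have L: "a \<in> L" "set as \<subseteq> L" using as'(2) as by simp_all
  define g where "g = foldr ann as f"
  have x: "x = ann a g" unfolding as' as g_def foldr.simps o_apply ..
  have g: "g \<in> fock L" unfolding g_def by (rule fock_foldr_ann[OF Inv_fock[OF f]])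
  have kl: "k + Suc l = m" using Suc.prems(1) by simp
  have IH: "slice (Suc l) y = 0" if "y \<in> cvs.span (derivs f k)" for y
    by (rule slice_span_zero[OF that Suc.IH[OF kl]])
  have sg: "slice (Suc l) g = 0"
    unfolding g_def by (rule IH, rule cvs.span_base) (use derivsI[OF L(2)] as in simp)
  have Odz: "slice l (ann (Od i, s) g) = 0" if "i \<in> J" "s \<in> S" for i s
    unfolding slice_ann[OF g that, symmetric] sg by (rule ann_lin)
  obtain i s where a: "a = (i, s)" by (cases a)
  then have isL: "i \<in> I" "s \<in> S" using L by simp_all
  show ?case
  proof (cases i)
    case (Od j)
    then have "j \<in> J" using isL(1) by simp
    then show ?thesis unfolding x a Od using isL(2) by (rule Odz)
  next
    case (Ev j)
    then have j: "j \<in> J" using isL by simp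
    show ?thesis
    proof (cases "s \<in> T")
      case True
      have "raise j s g \<in> cvs.span (derivs f k)"
        using quad_derivs[OF Inv_fock[OF f] parity_wmat[OF ipar_raise] _ L(2)] r[OF j True] as(2)
        unfolding raise_def g_def by blast
      from IH[OF this] have "slice l (ann (Ev j, s) g)
          + bsign (par s) *\<^sub>C (\<Sum>i\<in>J. cre (Od i, fr j) (slice l (ann (Od i, s) g))) = 0"
        unfolding slice_raise[OF j True] .
      moreover have "(\<Sum>i\<in>J. cre (Od i, fr j) (slice l (ann (Od i, s) g))) = (\<Sum>i\<in>J. 0)"
        by (rule sum.cong[OF refl]) (simp only: Odz isL(2) cre_lin)
      ultimately show ?thesis
        unfolding x a Ev by (simp only: sum.neutral_const cvs.scale_zero_right add_0_right)
    next
      case False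
      \<comment> \<open>An unbarred direction inside the frame: here the matrix of
        \<open>gl(n)\<close> carrying \<open>Ev j\<close> to \<open>Ev t\<close> takes over from
        \<open>raise\<close>.\<close>
      then obtain t where t: "t \<in> J" "s = fr t" using isL by (auto simp: T_def)
      let ?M = "vmat (\<lambda>a b. 1 * single (Ev t) (Ev j) a b + (- 1) * single (Od j) (Od t) a b)"
      have pm: "parity_mat 0 ?M"
        using pe_mat_gl[of t j] unfolding pe_mat_def by (intro parity_vmat) (erule conjunct1)
      have "quad L ?M g \<in> cvs.span (derivs f k)"
        using quad_derivs[OF Inv_fock[OF f] pm InvD[OF f pe_mat_gl] L(2)] unfolding g_def as(2) .
      from IH[OF this] have "slice (Suc l) (quad L ?M g) = 0" .
      moreover have "Ev t \<in> I" "Ev j \<in> I" "Od j \<in> I" "Od t \<in> I" using t j by simp_all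
      ultimately have "slice l (ann (Ev j, fr t) g)
          + (- 1) *\<^sub>C (\<Sum>s\<in>S. cre (Od j, s) (slice l (ann (Od t, s) g))) = 0"
        by (simp only: quad_vmat_two slice_lin(4,5) slice_sum_Ev[OF t(1)] slice_sum_Od[OF j] cscale_one)
      moreover have "(\<Sum>s\<in>S. cre (Od j, s) (slice l (ann (Od t, s) g))) = (\<Sum>s\<in>S. 0)"
        by (rule sum.cong[OF refl]) (simp only: Odz[OF t(1)] cre_lin)
      ultimately show ?thesis
        unfolding x a Ev t(2) by (simp only: sum.neutral_const cvs.scale_zero_right add_0_right)
    qed
  qed
qed

lemma slice_inj:
  assumes "f \<in> Inv" "hom m f" "\<And>j s. j \<in> J \<Longrightarrow> s \<in> T \<Longrightarrow> raise j s f = 0" "slice m f = 0"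
  shows "f = 0"
proof
  fix w
  show "f w = 0 w"
  proof (cases "length w = m \<and> set w \<subseteq> L")
    case True
    \<comment> \<open>\<open>foldr\<close> differentiates along the last letter first, hence
      \<open>rev\<close>. After \<open>m\<close> derivatives, restriction leaves the coefficient
      \<open>f w\<close>.\<close>
    have "foldr ann (rev w) f \<in> derivs f m"
      using derivsI[of "rev w" f] True by (simp only: length_rev set_rev)
    from slice_derivs_zero[OF assms(1,3,4) _ this, of 0] have "f w *\<^sub>C vac = 0"
      by (simp only: slice_def hmap.simps foldr_ann rev_rev_ident append_Nil2 add_0_right)
    from fun_cong[OF this, of "[]"] show ?thesis by (simp add: vac_def)
  next
    case False
    then show ?thesis using assms(2) fock_support[OF Inv_fock[OF assms(1)], of w]
      unfolding hom_def zero_fun_apply by blast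
  qed
qed

subsection \<open>Lifting from the slice\<close>

lemma cre_G: "cre a (G u v h) = bsign (lpar a * (par u + par v + 1)) *\<^sub>C G u v (cre a h)"
proof -
  have "cre a (cre (i, u) (cre (bar i, v) h))
      = bsign (lpar a * (par u + par v + 1)) *\<^sub>C cre (i, u) (cre (bar i, v) (cre a h))" for i
  proof -
    have "sg a (i, u) * sg a (bar i, v) = bsign (lpar a * (par u + par v + 1))"
      unfolding sg_def lpar_def[of "(i, u)"] lpar_def[of "(bar i, v)"]
      using bit_cases[of "par i"] bit_cases[of "par u"] bit_cases[of "par v"] bit_cases[of "lpar a"]
      by (elim disjE) (simp_all add: bsign_def)
    then show ?thesis
      unfolding cre_cre[of a "(i, u)"] cre_cre[of a "(bar i, v)"] cre_lin cscale_cscale by (simp only:)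
  qed
  then show ?thesis
    unfolding G_def cre_lin cvs.scale_sum_right by (simp only: cscale_cscale mult.commute)
qed

lemma G_G: "G s t (G u v h) = bsign ((par s + par t + 1) * (par u + par v + 1)) *\<^sub>C G u v (G s t h)"
proof -
  have "cre (i, s) (cre (bar i, t) (G u v h))
      = bsign ((par s + par t + 1) * (par u + par v + 1)) *\<^sub>C G u v (cre (i, s) (cre (bar i, t) h))" for i
  proof -
    have "bsign (lpar (bar i, t) * (par u + par v + 1)) * bsign (lpar (i, s) * (par u + par v + 1))
        = bsign ((par s + par t + 1) * (par u + par v + 1))"
      unfolding lpar_def
      using bit_cases[of "par i"] bit_cases[of "par s"] bit_cases[of "par t"] bit_cases[of "par u + par v + 1"]
      by (elim disjE) (simp_all add: bsign_def)
    then show ?thesis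
      unfolding cre_G cre_lin cscale_cscale by (simp only:)
  qed
  then have "G s t (G u v h) = (\<Sum>i\<in>I. bsign ((par s + par t + 1) * (par u + par v + 1)) *\<^sub>C
      (bsign (par s * (par i + 1)) *\<^sub>C G u v (cre (i, s) (cre (bar i, t) h))))"
    unfolding G_def[of s t "G u v h"] by (simp only: cscale_cscale mult.commute)
  then show ?thesis
    unfolding G_def[of s t h] G_lin by (simp only: cvs.scale_sum_right)
qed

text \<open>Restricting the inner product of \<open>fr i\<close> and \<open>fr j\<close> yields both
  \<open>(Od i, fr j)\<close> and \<open>(Od j, fr i)\<close>. The factor 1/2 compensates this
  doubling; for an index outside the frame there is only one term.\<close>

definition half :: "sindex \<Rightarrow> complex" where "half s = (if s \<in> T then 1 else 1 / 2)"

text \<open>The substitution of inner products for odd variables that undoes restriction. Unbarred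
  letters never occur in a restricted state, so 0 serves as their image.\<close>

fun lift_op :: "letter \<Rightarrow> state \<Rightarrow> state" where
  "lift_op (Ev i, s) y = 0"
| "lift_op (Od i, s) y = half s *\<^sub>C G (fr i) s y"

definition lift :: "nat \<Rightarrow> state \<Rightarrow> state" where "lift = hmap L lift_op vac"

lemma clinear_lift_op: "clinear (lift_op a)"
proof (cases a)
  case (Pair i s)
  have "lift_op a = (\<lambda>y. 0)" if "i = Ev k" for k
    by (rule ext) (simp only: Pair that lift_op.simps)
  moreover have "lift_op a = (\<lambda>y. half s *\<^sub>C G (fr k) s y)" if "i = Od k" for k
    by (rule ext) (simp only: Pair that lift_op.simps)
  ultimately show ?thesis
    by (cases i) (simp_all only: clinear_compose_cscale clinear_G clinear_const0)
qed

lemma clinear_lift: "clinear (lift r)"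
  unfolding lift_def by (rule clinear_hmap[OF clinear_lift_op])

lemmas lift_lin = clin[OF clinear_lift]

text \<open>Frame vectors are even, so the inner product of \<open>fr i\<close> and \<open>s\<close>
  has the parity of the letter \<open>(Od i, s)\<close>, and the substitution respects the sign
  rule.\<close>

lemma lift_op_commute: "lift_op b (lift_op a y) = sg a b *\<^sub>C lift_op a (lift_op b y)"
proof (cases a, cases b)
  fix i s j t assume a: "a = (i, s)" and b: "b = (j, t)"
  show ?thesis
  proof (cases "(\<exists>k. i = Ev k) \<or> (\<exists>k. j = Ev k)")
    case True
    then show ?thesis
      unfolding a b by (cases i; cases j) (simp_all only: lift_op.simps G_lin cvs.scale_zero_right sindex.distinct simp_thms)
  next
    case False
    then obtain k l where i: "i = Od k" and j: "j = Od l" by (metis sindex.exhaust)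
    have "sg a b = bsign ((par (fr l) + par t + 1) * (par (fr k) + par s + 1))"
      unfolding a b i j sg_def lpar_def using bit_cases[of "par s"] bit_cases[of "par t"]
      by (elim disjE) (simp_all add: bsign_def)
    then show ?thesis
      unfolding a b i j lift_op.simps G_lin G_G[of "fr l" t "fr k" s] by (simp only: cscale_cscale ac_simps)
  qed
qed

lemma lift_cre: "a \<in> L \<Longrightarrow> lift (Suc r) (cre a h) = lift_op a (lift r h)"
  unfolding lift_def by (rule hmap_cre[OF clinear_lift_op finite_L _ lift_op_commute])

lemma lift_R: "lift r h \<in> R (2 * r)"
proof (induction r arbitrary: h)
  case 0
  have "vac \<in> R (2 * 0)" by (rule R_base) simp
  then show ?case unfolding lift_def hmap.simps by (rule R_scale)
next
  case (Suc r)
  have 2: "2 * Suc r = Suc (Suc (2 * r))" by simp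
  have *: "lift_op b y \<in> R (Suc (Suc (2 * r)))" if "b \<in> L" "y \<in> R (2 * r)" for b y
  proof -
    obtain i s where b: "b = (i, s)" by (cases b)
    then have isL: "i \<in> I" "s \<in> S" using that by simp_all
    show ?thesis
    proof (cases i)
      case (Ev k)
      then show ?thesis unfolding b by (simp only: lift_op.simps R_zero)
    next
      case (Od k)
      then have "fr k \<in> S" using isL by simp
      then show ?thesis unfolding b Od lift_op.simps using that(2) isL(2) by (intro R_scale G_R)
    qed
  qed
  show ?case
    unfolding 2 lift_def hmap.simps(2)
    by (intro R_scale R_sum * Suc[unfolded lift_def])
qed

lemma raise_G:
  assumes "j \<in> J" "s \<in> T" "i \<in> J" "t \<in> S"
  shows "raise j s (G (fr i) t h) = (bsign (par s) * of_bool (t = s)) *\<^sub>C G (fr i) (fr j) h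
    + bsign (par s * (par t + 1)) *\<^sub>C G (fr i) t (raise j s h)"
proof -
  have "(bsign (par s) * single (fr j) s u (fr i)) *\<^sub>C G u t h
      + (bsign (par s + par s * par (fr i)) * single (fr j) s u t) *\<^sub>C G (fr i) u h
      = of_bool (u = fr j) *\<^sub>C ((bsign (par s) * of_bool (t = s)) *\<^sub>C G (fr i) u h)" for u
  proof -
    have "single (fr j) s u (fr i) = 0"
      using T_fr(1)[OF assms(2,3)] by (simp add: single_def)
    moreover have "bsign (par s + par s * par (fr i)) * single (fr j) s u t
        = of_bool (u = fr j) * (bsign (par s) * of_bool (t = s))"
      by (simp add: single_def)
    ultimately show ?thesis
      by (simp only: mult_zero_right cvs.scale_zero_left add_0_left cscale_cscale)
  qed
  then have "(\<Sum>u\<in>S. (bsign (par s) * single (fr j) s u (fr i)) *\<^sub>C G u t h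
      + (bsign (par s + par s * par (fr i)) * single (fr j) s u t) *\<^sub>C G (fr i) u h)
      = (bsign (par s) * of_bool (t = s)) *\<^sub>C G (fr i) (fr j) h"
    by (simp only: sum_of_bool_cscale finite_S fr_S assms if_True)
  then show ?thesis
    unfolding raise_def quad_wmat_G[OF ipar_raise fr_S[OF assms(3)] assms(4)] by (simp only: par_fr add_0_left)
qed

lemma raise_lin: "raise j s 0 = 0" "raise j s (f - g) = raise j s f - raise j s g"
  "raise j s (c *\<^sub>C f) = c *\<^sub>C raise j s f" "raise j s (\<Sum>i\<in>A. F i) = (\<Sum>i\<in>A. raise j s (F i))"
  unfolding raise_def by (simp_all only: quad_lin)

text \<open>This is the operator \<open>Z\<close> of \<open>slice_positivity\<close>, up to the
  order of the indices of \<open>sig\<close>.\<close>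

definition tot :: "nat \<Rightarrow> sindex \<Rightarrow> state \<Rightarrow> state" where
  "tot j s h = (\<Sum>k\<in>J. sig k j (ann (Od k, s) h))"

lemma tot_lin: "tot j s (c *\<^sub>C h) = c *\<^sub>C tot j s h" "tot j s (\<Sum>i\<in>A. F i) = (\<Sum>i\<in>A. tot j s (F i))"
  unfolding tot_def ann_lin sig_lin by (simp only: cvs.scale_sum_right, rule sum.swap)

lemma sig_add: "sig i j (x + y) = sig i j x + sig i j y"
  unfolding sig_def cre_lin by (simp only: ac_simps)

lemma sig_cre: "sig i j (cre b y) = bsign (lpar b) *\<^sub>C cre b (sig i j y)"
proof -
  have "sg (Od k, fr l) b = bsign (lpar b)" for k l
    by (simp add: sg_def lpar_def)
  then show ?thesis
    unfolding sig_def cre_cre[of "(Od _, fr _)" b] cre_lin cscale_add_right by (simp only:)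
qed

lemma tot_cre:
  "tot j s (cre b x) = (\<Sum>k\<in>J. of_bool (b = (Od k, s)) *\<^sub>C sig k j x)
    + bsign (lpar b * par s) *\<^sub>C cre b (tot j s x)"
proof -
  have "sg b (Od k, s) * bsign (lpar b) = bsign (lpar b * par s)" for k
    unfolding sg_def lpar_def[of "(Od _, _)"]
    using bit_cases[of "par s"] bit_cases[of "lpar b"]
    by (elim disjE) (simp_all add: bsign_def)
  then have "sig k j (ann (Od k, s) (cre b x)) = of_bool (b = (Od k, s)) *\<^sub>C sig k j x
      + bsign (lpar b * par s) *\<^sub>C cre b (sig k j (ann (Od k, s) x))" for k
    unfolding ann_cre sig_add sig_lin sig_cre cscale_cscale by (simp only:)
  then show ?thesis
    unfolding tot_def cre_lin cvs.scale_sum_right by (simp only: sum.distrib)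
qed

lemma lift_sig:
  assumes "i \<in> J" "j \<in> J"
  shows "lift (Suc r) (sig i j x) = G (fr i) (fr j) (lift r x)"
proof -
  have h: "half (fr k) = 1 / 2" if "k \<in> J" for k
    using T_fr(2)[OF that] by (simp add: half_def)
  have "G (fr j) (fr i) y = G (fr i) (fr j) y" for y
    unfolding G_swap[of "fr j"] by (simp only: par_fr mult_zero_left bsign_simps cscale_one)
  then have "lift (Suc r) (sig i j x) = (1 / 2) *\<^sub>C G (fr i) (fr j) (lift r x) + (1 / 2) *\<^sub>C G (fr i) (fr j) (lift r x)"
    unfolding sig_def using assms by (simp only: lift_lin lift_cre mem_L Od_I fr_S lift_op.simps h simp_thms)
  also have "\<dots> = (1 / 2 + 1 / 2) *\<^sub>C G (fr i) (fr j) (lift r x)" by (rule cscale_add_left[symmetric])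
  finally show ?thesis by (simp add: cscale_one)
qed

text \<open>It suffices to compare one letter, since both operators obey the same Leibniz rule.
  \<open>raise j s\<close> turns the inner product of \<open>fr k\<close> and \<open>s\<close> into
  that of \<open>fr k\<close> and \<open>fr j\<close>, which is the lift of \<open>sig k j\<close>.
  Euler's identity reduces a general state to the form \<open>cre b x\<close>.\<close>

lemma raise_lift:
  assumes "j \<in> J" "s \<in> T" "h \<in> fock L" "hom r h"
  shows "raise j s (lift r h) = bsign (par s) *\<^sub>C lift r (tot j s h)"
  using assms(3,4)
proof (induction r arbitrary: h)
  case 0
  have "tot j s h [] = 0" by (simp add: tot_def sum_fun_apply sig_def)
  then show ?case
    unfolding lift_def hmap.simps raise_lin
    by (simp only: raise_def quad_vac cvs.scale_zero_right cvs.scale_zero_left)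
next
  case (Suc r)
  have step: "raise j s (lift (Suc r) (cre b x)) = bsign (par s) *\<^sub>C lift (Suc r) (tot j s (cre b x))"
    if x: "x \<in> fock L" "hom r x" and "b \<in> L" for b x
  proof -
    have R: "lift (Suc r) (tot j s (cre b x)) = (\<Sum>k\<in>J. of_bool (b = (Od k, s)) *\<^sub>C G (fr k) (fr j) (lift r x))
        + bsign (lpar b * par s) *\<^sub>C lift_op b (lift r (tot j s x))"
    proof -
      have "(\<Sum>k\<in>J. of_bool (b = (Od k, s)) *\<^sub>C lift (Suc r) (sig k j x))
        = (\<Sum>k\<in>J. of_bool (b = (Od k, s)) *\<^sub>C G (fr k) (fr j) (lift r x))"
        by (rule sum.cong[OF refl]) (simp only: lift_sig assms(1))
      then show ?thesis
        unfolding tot_cre lift_lin lift_cre[OF that(3)] by (simp only:)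
    qed
    obtain i t where b: "b = (i, t)" by (cases b)
    then have it: "i \<in> I" "t \<in> S" using that by simp_all
    show ?thesis
    proof (cases i)
      case (Ev k)
      have 0: "(\<Sum>k\<in>J. of_bool (b = (Od k, s)) *\<^sub>C G (fr k) (fr j) (lift r x)) = 0"
        unfolding b Ev prod.inject by (simp only: sindex.distinct simp_thms of_bool_eq cvs.scale_zero_left sum.neutral_const)
      show ?thesis
        unfolding R 0 lift_cre[OF that(3)] unfolding b Ev lift_op.simps raise_lin
        by (simp only: cvs.scale_zero_right add_0_right)
    next
      case (Od k)
      have k: "k \<in> J" using it Od by simp
      have "(\<Sum>k'\<in>J. of_bool (b = (Od k', s)) *\<^sub>C G (fr k') (fr j) (lift r x))
        = (\<Sum>k'\<in>J. of_bool (k' = k) *\<^sub>C (of_bool (t = s) *\<^sub>C G (fr k') (fr j) (lift r x)))"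
        by (rule sum.cong[OF refl]) (simp add: b Od)
      also have "\<dots> = of_bool (t = s) *\<^sub>C G (fr k) (fr j) (lift r x)"
        by (simp only: sum_of_bool_cscale finite_J k if_True)
      finally have 1: "(\<Sum>k'\<in>J. of_bool (b = (Od k', s)) *\<^sub>C G (fr k') (fr j) (lift r x))
        = of_bool (t = s) *\<^sub>C G (fr k) (fr j) (lift r x)" .
      have 2: "half t * (bsign (par s) * of_bool (t = s)) = bsign (par s) * of_bool (t = s)"
        using assms(2) by (simp add: half_def)
      have 3: "bsign (lpar b * par s) = bsign (par s * (par t + 1))"
        unfolding b Od lpar_def by (simp add: ac_simps)
      show ?thesis
        unfolding R 1 3 lift_cre[OF that(3)] unfolding b Od lift_op.simps raise_lin
          raise_G[OF assms(1,2) k it(2)] Suc.IH[OF x]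
        by (simp only: cscale_add_right cscale_cscale 2 G_lin) (simp only: ac_simps)
    qed
  qed
  have "of_nat (Suc r) *\<^sub>C (raise j s (lift (Suc r) h)) = raise j s (lift (Suc r) (of_nat (Suc r) *\<^sub>C h))"
    by (simp only: raise_lin lift_lin)
  also have "\<dots> = (\<Sum>b\<in>L. raise j s (lift (Suc r) (cre b (ann b h))))"
    unfolding euler_hom[OF Suc.prems(1) finite_L Suc.prems(2), symmetric] lift_lin raise_lin ..
  also have "\<dots> = (\<Sum>b\<in>L. bsign (par s) *\<^sub>C lift (Suc r) (tot j s (cre b (ann b h))))"
    by (intro sum.cong refl step fock_ann Suc.prems hom_ann)
  also have "\<dots> = bsign (par s) *\<^sub>C lift (Suc r) (tot j s (of_nat (Suc r) *\<^sub>C h))"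
    unfolding euler_hom[OF Suc.prems(1) finite_L Suc.prems(2), symmetric] lift_lin tot_lin cvs.scale_sum_right ..
  also have "\<dots> = of_nat (Suc r) *\<^sub>C (bsign (par s) *\<^sub>C lift (Suc r) (tot j s h))"
    by (simp only: tot_lin lift_lin cscale_cscale mult.commute)
  finally show ?case by (simp only: cvs.scale_left_imp_eq of_nat_neq_0 cvs.scale_cancel_left simp_thms)
qed

lemma slice_G:
  assumes "i \<in> J" "s \<in> S"
  shows "slice (Suc (Suc m)) (G (fr i) s h) = cre (Od i, s) (slice m h)
    + (\<Sum>j\<in>J. of_bool (s = fr j) *\<^sub>C cre (Od j, fr i) (slice m h))"
proof -
  have "slice (Suc (Suc m)) (cre (Ev k, fr i) (cre (Od k, s) h)) = of_bool (i = k) *\<^sub>C cre (Od k, s) (slice m h)"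
    if "k \<in> J" for k
    using assms that by (simp only: slice_cre mem_L Ev_I Od_I fr_S simp_thms slice_op.simps fr_eq_iff)
  then have 1: "(\<Sum>k\<in>J. slice (Suc (Suc m)) (cre (Ev k, fr i) (cre (Od k, s) h))) = cre (Od i, s) (slice m h)"
    using assms by (simp only: sum_of_bool_cscale finite_J if_True cong: sum.cong)
  have "slice (Suc (Suc m)) (cre (Od k, fr i) (cre (Ev k, s) h)) = of_bool (s = fr k) *\<^sub>C cre (Od k, fr i) (slice m h)"
    if "k \<in> J" for k
    using assms that by (simp only: slice_cre mem_L Ev_I Od_I fr_S simp_thms slice_op.simps cre_lin)
  then have 2: "(\<Sum>k\<in>J. slice (Suc (Suc m)) (cre (Od k, fr i) (cre (Ev k, s) h)))
      = (\<Sum>j\<in>J. of_bool (s = fr j) *\<^sub>C cre (Od j, fr i) (slice m h))"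
    by (intro sum.cong refl)
  show ?thesis
    unfolding G_def par_fr mult_zero_left bsign_simps cscale_one sum_I bar.simps slice_lin 1 2 ..
qed

text \<open>Euler's identity reduces the claim to single letters. Outside the frame a letter comes
  back unchanged; a frame letter comes back as half of itself plus half of its transpose, which the
  symmetry of the derivatives of \<open>h\<close> makes good in the sum.\<close>

lemma slice_lift:
  assumes "h \<in> fock L" "hom r h"
    and "\<And>i j. i \<in> J \<Longrightarrow> j \<in> J \<Longrightarrow> ann (Od i, fr j) h = ann (Od j, fr i) h"
    and "\<And>i s. ann (Ev i, s) h = 0"
  shows "slice (2 * r) (lift r h) = h"
  using assms
proof (induction r arbitrary: h)
  case 0
  show ?case
  proof
    show "slice (2 * 0) (lift 0 h) w = h w" for w
      using 0(2) unfolding hom_def by (cases "w = []") (auto simp: slice_def lift_def vac_def)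
  qed
next
  case (Suc r)
  have sym: "ssymm h" by (rule fock_ssymm[OF Suc.prems(1)])
  have y: "slice (2 * r) (lift r (ann b h)) = ann b h" for b
  proof (rule Suc.IH)
    show "ann b h \<in> fock L" "hom r (ann b h)"
      by (rule fock_ann[OF Suc.prems(1)], rule hom_ann[OF Suc.prems(2)])
    show "ann (Od i, fr j) (ann b h) = ann (Od j, fr i) (ann b h)" if "i \<in> J" "j \<in> J" for i j
    proof -
      have "sg (Od i, fr j) b = sg (Od j, fr i) b" by (simp add: sg_def lpar_def)
      then show ?thesis
        unfolding ann_ann[OF sym, of _ b] Suc.prems(3)[OF that] by (simp only:)
    qed
    show "ann (Ev i, s) (ann b h) = 0" for i s
      unfolding ann_ann[OF sym, of _ b] Suc.prems(4) ann_lin by (rule cvs.scale_zero_right)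
  qed
  have 2: "2 * Suc r = Suc (Suc (2 * r))" by simp
  let ?c = "\<lambda>i s. cre (Od i, s) (ann (Od i, s) h)"
  have fr: "slice (2 * Suc r) (lift_op (Od i, fr j) (lift r (ann (Od i, fr j) h)))
      = (1 / 2) *\<^sub>C ?c i (fr j) + (1 / 2) *\<^sub>C ?c j (fr i)" if "i \<in> J" "j \<in> J" for i j
  proof -
    have "half (fr j) = 1 / 2" using T_fr(2)[OF that(2)] by (simp add: half_def)
    moreover have "(\<Sum>k\<in>J. of_bool (fr j = fr k) *\<^sub>C cre (Od k, fr i) (ann (Od i, fr j) h)) = ?c j (fr i)"
      by (simp only: fr_eq_iff sum_of_bool_cscale finite_J that if_True Suc.prems(3)[OF that])
    ultimately show ?thesis
      unfolding lift_op.simps slice_lin 2 slice_G[OF that(1) fr_S[OF that(2)]] y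
      by (simp only: cscale_add_right)
  qed
  have T: "slice (2 * Suc r) (lift_op (Od i, s) (lift r (ann (Od i, s) h))) = ?c i s"
    if "i \<in> J" "s \<in> T" for i s
  proof -
    have "half s = 1" using that by (simp add: half_def)
    moreover have "(\<Sum>k\<in>J. of_bool (s = fr k) *\<^sub>C cre (Od k, fr i) (ann (Od i, s) h)) = (\<Sum>k\<in>J. 0)"
      by (rule sum.cong[OF refl]) (simp only: T_fr(1)[OF that(2)] of_bool_eq cvs.scale_zero_left)
    ultimately show ?thesis
      unfolding lift_op.simps slice_lin 2 slice_G[OF that(1) T_S[OF that(2)]] y
      by (simp only: cscale_one sum.neutral_const add_0_right)
  qed
  have sumL: "(\<Sum>b\<in>L. F b) = (\<Sum>i\<in>J. \<Sum>j\<in>J. F (Od i, fr j)) + (\<Sum>i\<in>J. \<Sum>s\<in>T. F (Od i, s))"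
    if "\<And>i s. F (Ev i, s) = 0" for F :: "letter \<Rightarrow> state"
    unfolding sum_L sum_I sum_S that by (simp only: sum.neutral_const add_0_left sum.distrib)
  have "(\<Sum>b\<in>L. slice (2 * Suc r) (lift_op b (lift r (ann b h))))
    = (\<Sum>i\<in>J. \<Sum>j\<in>J. slice (2 * Suc r) (lift_op (Od i, fr j) (lift r (ann (Od i, fr j) h))))
      + (\<Sum>i\<in>J. \<Sum>s\<in>T. slice (2 * Suc r) (lift_op (Od i, s) (lift r (ann (Od i, s) h))))"
    by (rule sumL) (simp only: lift_op.simps slice_lin)
  also have "(\<Sum>i\<in>J. \<Sum>s\<in>T. slice (2 * Suc r) (lift_op (Od i, s) (lift r (ann (Od i, s) h))))
      = (\<Sum>i\<in>J. \<Sum>s\<in>T. ?c i s)"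
    by (intro sum.cong refl T)
  also have "(\<Sum>i\<in>J. \<Sum>j\<in>J. slice (2 * Suc r) (lift_op (Od i, fr j) (lift r (ann (Od i, fr j) h))))
      = (\<Sum>i\<in>J. \<Sum>j\<in>J. (1 / 2) *\<^sub>C ?c i (fr j) + (1 / 2) *\<^sub>C ?c j (fr i))"
    by (intro sum.cong refl fr)
  also have "\<dots> = (\<Sum>i\<in>J. \<Sum>j\<in>J. (1 / 2) *\<^sub>C ?c i (fr j)) + (\<Sum>i\<in>J. \<Sum>j\<in>J. (1 / 2) *\<^sub>C ?c j (fr i))"
    by (simp only: sum.distrib)
  \<comment> \<open>Renaming \<open>i\<close> and \<open>j\<close> turns the transposed half into
    the other half, and together they give the full Euler sum over frame letters.\<close>
  also have "(\<Sum>i\<in>J. \<Sum>j\<in>J. (1 / 2) *\<^sub>C ?c j (fr i)) = (\<Sum>i\<in>J. \<Sum>j\<in>J. (1 / 2) *\<^sub>C ?c i (fr j))"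
    by (rule sum.swap)
  also have "(\<Sum>i\<in>J. \<Sum>j\<in>J. (1 / 2) *\<^sub>C ?c i (fr j)) + (\<Sum>i\<in>J. \<Sum>j\<in>J. (1 / 2) *\<^sub>C ?c i (fr j))
      = (\<Sum>i\<in>J. \<Sum>j\<in>J. ?c i (fr j))"
    unfolding sum.distrib[symmetric] cscale_add_left[symmetric] by (simp add: cscale_one)
  also have "(\<Sum>i\<in>J. \<Sum>j\<in>J. ?c i (fr j)) + (\<Sum>i\<in>J. \<Sum>s\<in>T. ?c i s) = (\<Sum>b\<in>L. cre b (ann b h))"
    by (rule sumL[symmetric]) (simp only: Suc.prems(4) cre_lin)
  also have "\<dots> = of_nat (Suc r) *\<^sub>C h" by (rule euler_hom[OF Suc.prems(1) finite_L Suc.prems(2)])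
  finally have "(\<Sum>b\<in>L. slice (2 * Suc r) (lift_op b (lift r (ann b h)))) = of_nat (Suc r) *\<^sub>C h" .
  moreover have "slice (2 * Suc r) (lift (Suc r) h)
      = (1 / of_nat (Suc r)) *\<^sub>C (\<Sum>b\<in>L. slice (2 * Suc r) (lift_op b (lift r (ann b h))))"
    unfolding lift_def hmap.simps(2) slice_lin ..
  ultimately show ?case by (simp only: cscale_cscale) (simp add: cscale_one del: of_nat_Suc)
qed


subsection \<open>The first fundamental theorem in Fock space\<close>

text \<open>The diagonal equations of \<open>gl(n)\<close> say that an invariant contains as many
  barred as unbarred letters. Restriction keeps the barred ones, so the number operator of
  \<open>f\<close> becomes twice that of its restriction.\<close>

lemma slice_length:
  assumes "f \<in> Inv" "hom (Suc k) f" "slice (Suc k) f w \<noteq> 0"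
  shows "2 * length w = Suc k"
proof -
  define g where "g = slice (Suc k) f"
  have gf: "g \<in> fock L" unfolding g_def by (rule slice_fock)
  have "(\<Sum>a\<in>L. cre a (ann a f)) = (\<Sum>j\<in>J. \<Sum>s\<in>S. cre (Od j, s) (ann (Od j, s) f))
      + (\<Sum>j\<in>J. \<Sum>s\<in>S. cre (Od j, s) (ann (Od j, s) f))"
  proof -
    have "(\<Sum>j\<in>J. \<Sum>s\<in>S. cre (Ev j, s) (ann (Ev j, s) f)) = (\<Sum>j\<in>J. \<Sum>s\<in>S. cre (Od j, s) (ann (Od j, s) f))"
      by (rule sum.cong[OF refl]) (rule Inv_gl[OF assms(1)])
    then show ?thesis unfolding sum_L sum_I by (simp only:)
  qed
  then have "slice (Suc k) (of_nat (Suc k) *\<^sub>C f)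
      = slice (Suc k) ((\<Sum>j\<in>J. \<Sum>s\<in>S. cre (Od j, s) (ann (Od j, s) f))
      + (\<Sum>j\<in>J. \<Sum>s\<in>S. cre (Od j, s) (ann (Od j, s) f)))"
    unfolding euler_hom[OF Inv_fock[OF assms(1)] finite_L assms(2)] by (simp only:)
  moreover have "slice (Suc k) (\<Sum>j\<in>J. \<Sum>s\<in>S. cre (Od j, s) (ann (Od j, s) f))
      = (\<Sum>j\<in>J. \<Sum>s\<in>S. cre (Od j, s) (ann (Od j, s) g))"
  proof -
    have "slice (Suc k) (\<Sum>s\<in>S. cre (Od j, s) (ann (Od j, s) f)) = (\<Sum>s\<in>S. cre (Od j, s) (ann (Od j, s) g))"
      if "j \<in> J" for j
      unfolding slice_sum_Od[OF that] g_def
      by (rule sum.cong[OF refl]) (simp only: slice_ann[OF Inv_fock[OF assms(1)] that])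
    then show ?thesis unfolding clinear_sum[OF clinear_slice, where A = J] by (intro sum.cong refl)
  qed
  moreover have "(\<Sum>a\<in>L. cre a (ann a g)) = (\<Sum>j\<in>J. \<Sum>s\<in>S. cre (Od j, s) (ann (Od j, s) g))"
  proof -
    have "ann (Ev j, s) g = 0" for j s unfolding g_def by (rule ann_Ev_slice)
    then show ?thesis unfolding sum_L sum_I by (simp only: cre_lin sum.neutral_const add_0_left)
  qed
  ultimately have "of_nat (Suc k) *\<^sub>C g = (\<Sum>a\<in>L. cre a (ann a g)) + (\<Sum>a\<in>L. cre a (ann a g))"
    unfolding g_def by (simp only: slice_lin)
  from fun_cong[OF this, of w] have "of_nat (Suc k) * g w = of_nat (2 * length w) * g w"
    unfolding plus_fun_apply euler[OF gf finite_L] by (simp add: algebra_simps)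
  then show ?thesis using assms(3) unfolding g_def by (simp del: of_nat_Suc of_nat_mult)
qed

lemma tot_slice_zero:
  assumes "f \<in> Inv" "\<And>j s. j \<in> J \<Longrightarrow> s \<in> T \<Longrightarrow> raise j s f = 0" "j \<in> J" "s \<in> T"
  shows "tot j s (slice (Suc k) f) = 0"
proof -
  have "(\<Sum>i\<in>J. sig j i (ann (Od i, s) (slice (Suc k) f))) = 0"
    by (rule slice_positivity[OF slice_fock slice_Inv_c[OF assms(1,2)] assms(3,4)])
  then show ?thesis unfolding tot_def by (simp only: sig_swap[of _ j])
qed

text \<open>The candidate is the lift \<open>h\<close> of the restriction \<open>g\<close>. By
  \<open>raise_lift\<close> and \<open>tot_slice_zero\<close> it is killed by every
  \<open>raise\<close>, so \<open>slice_inj\<close> applies to \<open>f - h\<close>.\<close>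

lemma slice_theorem:
  assumes "f \<in> Inv" "hom m f" "\<And>j s. j \<in> J \<Longrightarrow> s \<in> T \<Longrightarrow> raise j s f = 0"
  shows "f \<in> R m"
proof (cases m)
  case 0
  define c where "c = f []"
  have f: "f = c *\<^sub>C vac"
  proof
    show "f w = (c *\<^sub>C vac) w" for w
      using assms(2) unfolding 0 hom_def by (cases "w = []") (auto simp: vac_def c_def)
  qed
  have "vac \<in> R 0" by (rule R_base) simp
  then show ?thesis unfolding 0 f by (rule R_scale)
next
  case (Suc k)
  define g where "g = slice m f"
  have gf: "g \<in> fock L" unfolding g_def by (rule slice_fock)
  show ?thesis
  \<comment> \<open>The degree \<open>r\<close> of \<open>g\<close> is read off a word at which
    \<open>g\<close> is nonzero; the case \<open>g = 0\<close> is settled by injectivity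
    alone.\<close>
  proof (cases "g = 0")
    case True
    have "f = 0" by (rule slice_inj[OF assms True[unfolded g_def]])
    then show ?thesis using R_zero by (simp only:)
  next
    case False
    have len: "2 * length w = m" if "g w \<noteq> 0" for w
      using slice_length[OF assms(1), of k w] assms(2) that unfolding g_def Suc by blast
    obtain w where w: "g w \<noteq> 0" using False by (metis ext zero_fun_apply)
    define r where "r = length w"
    have m: "m = 2 * r" using len[OF w] by (simp add: r_def)
    have hg: "hom r g" unfolding hom_def using len m by fastforce
    define h where "h = lift r g"
    have hR: "h \<in> R m" unfolding h_def m by (rule lift_R)
    have hI: "h \<in> Inv" using hR R_Inv by blast
    have sh: "slice m h = g"
      unfolding h_def m
    proof (rule slice_lift[OF gf hg])
      show "ann (Od i, fr j) g = ann (Od j, fr i) g" if "i \<in> J" "j \<in> J" for i j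
        unfolding g_def Suc by (rule slice_Inv_b[OF assms(1) that])
      show "ann (Ev i, s) g = 0" for i s
        unfolding g_def by (rule ann_Ev_slice)
    qed
    have "f - h = 0"
    proof (rule slice_inj)
      show "f - h \<in> Inv" by (rule cvs.subspace_diff[OF subspace_Inv assms(1) hI])
      show "hom m (f - h)" by (rule hom_diff[OF assms(2) R_hom[OF hR]])
      show "slice m (f - h) = 0" unfolding slice_lin sh g_def by (rule diff_self)
      fix j s assume js: "j \<in> J" "s \<in> T"
      have t0: "tot j s g = 0"
        unfolding g_def Suc by (rule tot_slice_zero[OF assms(1) _ js]) (rule assms(3))
      have "raise j s h = 0"
        unfolding h_def raise_lift[OF js gf hg] t0 by (simp only: lift_lin cvs.scale_zero_right)
      then show "raise j s (f - h) = 0" unfolding raise_lin assms(3)[OF js] by (simp only: diff_self)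
    qed
    then have "f = h" by (simp only: right_minus_eq)
    then show ?thesis using hR by (simp only:)
  qed
qed

section \<open>Orthogonality and induction on the number of letters outside the frame\<close>

lemma ip_R_zero:
  assumes "x \<in> R m" "\<And>b. b \<in> Rgen m \<Longrightarrow> ip L m b f = 0"
  shows "ip L m x f = 0"
  using assms(1) unfolding R_def
proof (induction rule: cvs.span_induct_alt)
  case base
  show ?case by (rule ip_lin_left)
next
  case (step c x y)
  show ?case unfolding ip_lin_left step(2) assms(2)[OF step(1)] by simp
qed

text \<open>The measure behind the existence of a vector killed by all \<open>raise j s\<close>:
  each such operator trades one letter outside the frame for a frame letter.\<close>

definition nonframe :: "letter list \<Rightarrow> nat" where
  "nonframe w = length (filter (\<lambda>a. snd a \<in> T) w)"

lemma nonframe_raise: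
  assumes "j \<in> J" "s \<in> T" "\<And>w. f w \<noteq> 0 \<Longrightarrow> nonframe w < Suc c" "raise j s f w \<noteq> 0"
  shows "nonframe w < c"
proof -
  have step: "nonframe w < c" if nz: "cre (i, fr j) (ann (i, s) f) w \<noteq> 0" for i
  proof -
    obtain u v where w: "w = u @ (i, fr j) # v" and "ann (i, s) f (u @ v) \<noteq> 0"
      using cre_nonzero[OF nz] by blast
    then have "nonframe ((i, s) # u @ v) < Suc c" using assms(3) by (simp only: ann_def)
    then show ?thesis using assms(2) T_fr(2)[OF assms(1)] unfolding w nonframe_def by simp
  qed
  show ?thesis
  proof (rule ccontr)
    assume "\<not> nonframe w < c"
    then have "cre (i, fr j) (ann (i, s) f) w = 0" for i using step by blast
    then have "raise j s f w = 0"
      unfolding raise_eq[OF assms(1,2)] by (simp add: sum_fun_apply)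
    then show False using assms(4) by blast
  qed
qed

text \<open>By the induction hypothesis every \<open>raise j s f\<close> already vanishes, since it
  is again invariant and orthogonal but has a smaller bound. This puts \<open>f\<close> in the scope
  of \<open>slice_theorem\<close>.\<close>

lemma orthogonal_zero:
  assumes "f \<in> Inv" "hom m f" "\<And>b. b \<in> Rgen m \<Longrightarrow> ip L m b f = 0"
    and "\<And>w. f w \<noteq> 0 \<Longrightarrow> nonframe w < c"
  shows "f = 0"
  using assms
proof (induction c arbitrary: f)
  case 0
  then have "f w = 0" for w by blast
  then show ?case by (intro ext) (simp only: zero_fun_apply)
next
  case (Suc c)
  have "raise j s f = 0" if js: "j \<in> J" "s \<in> T" for j s
  proof (rule Suc.IH)
    show "raise j s f \<in> Inv" unfolding raise_def by (rule quad_wmat_Inv[OF Suc.prems(1) ipar_raise])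
    show "hom m (raise j s f)" unfolding raise_def by (rule hom_quad[OF Suc.prems(2)])
    show "nonframe w < c" if "raise j s f w \<noteq> 0" for w
      by (rule nonframe_raise[OF js Suc.prems(4) that])
    fix b assume b: "b \<in> Rgen m"
    \<comment> \<open>The Fischer adjoint of \<open>raise j s\<close> is the polarization by the
      transposed matrix unit, which maps the left argument into \<open>R m\<close>.\<close>
    define M where "M = wmat (par s) (\<lambda>u v. single (fr j) s v u)"
    have "cnj (single u v x y) = single u v x y" for u v x y :: sindex
      by (simp add: single_def)
    then have M: "(\<lambda>a b. cnj (wmat (par s) (single (fr j) s) b a)) = M"
    proof (intro ext)
      show "cnj (wmat (par s) (single (fr j) s) b a) = M a b" for a b
        unfolding M_def wmat_def complex_cnj_mult bsign_simps \<open>\<And>u v x y. cnj (single u v x y) = single u v x y\<close>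
        by (cases "fst a = fst b") simp_all
    qed
    have "ip L m b (raise j s f) = ip L m (quad L M b) f"
      unfolding raise_def M[symmetric]
      by (rule quad_adjoint[OF finite_L fock_ssymm[OF Inv_fock[OF Rgen_Inv[OF b]]]
            fock_ssymm[OF Inv_fock[OF Suc.prems(1)]]])
    also have "\<dots> = 0"
    proof (rule ip_R_zero[OF _ Suc.prems(3)])
      have "ipar (par s) (\<lambda>u v. single (fr j) s v u)" by (simp add: ipar_def single_def)
      then show "quad L M b \<in> R m" unfolding M_def using b by (rule quad_wmat_Rgen)
    qed
    finally show "ip L m b (raise j s f) = 0" .
  qed
  then have "f \<in> R m" by (rule slice_theorem[OF Suc.prems(1,2)])
  then have "ip L m f f = 0" by (rule ip_R_zero[OF _ Suc.prems(3)])
  then have Re: "Re (ip L m f f) = 0" by simp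
  have "f w = 0" for w
  proof (cases "length w = m")
    case True
    show ?thesis
      by (rule ip_definite[OF finite_L fock_support[OF Inv_fock[OF Suc.prems(1)]] Re True])
  next
    case False
    then show ?thesis using Suc.prems(2) unfolding hom_def by blast
  qed
  then show ?case by (intro ext) (simp only: zero_fun_apply)
qed

theorem fft:
  assumes "f \<in> Inv" "hom m f"
  shows "f \<in> R m"
proof -
  have "Rgen m \<subseteq> fock L" using Rgen_Inv Inv_fock by blast
  from ip_projection[OF finite_Rgen this finite_L, of m f]
  obtain r where "r \<in> cvs.span (Rgen m)" and orth: "\<And>b. b \<in> Rgen m \<Longrightarrow> ip L m b (f - r) = 0" by blast
  then have r: "r \<in> R m" unfolding R_def by blast
  have h: "hom m (f - r)" by (rule hom_diff[OF assms(2) R_hom[OF r]])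
  have "f - r = 0"
  proof (rule orthogonal_zero[OF _ h orth])
    show "f - r \<in> Inv" using r R_Inv by (intro cvs.subspace_diff[OF subspace_Inv assms(1)]) blast
    show "nonframe w < Suc m" if "(f - r) w \<noteq> 0" for w
    proof -
      have "length w = m" using h that unfolding hom_def by blast
      then show ?thesis unfolding nonframe_def using length_filter_le[of _ w] by (simp add: le_imp_less_Suc)
    qed
  qed
  then have "f = r" by (simp only: right_minus_eq)
  then show ?thesis using r by (simp only:)
qed

end

section \<open>The algebra of invariants\<close>

lemma dual_eqI: "(\<And>v. dual_app f v = dual_app g v) \<Longrightarrow> f = g"
  by (simp add: dual_app_inject[symmetric] fun_eq_iff)

lemma dual_app_plus [simp]: "dual_app (f + g) v = dual_app f v + dual_app g v"
  by transfer simp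

lemma dual_app_scale [simp]: "dual_app (c *\<^sub>C f) v = c * dual_app f v"
  by transfer simp

lemma dual_app_0 [simp]: "dual_app 0 v = 0"
  by transfer simp

lemma dual_app_zero [simp]: "dual_app f 0 = 0"
  using dual_app_cscale[of f 0 0] by simp

lemma dual_app_hcomp [simp]: "dual_app (hcomp k f) v = dual_app f (hcomp k v)"
  by transfer simp

lemma dual_app_sum: "dual_app (\<Sum>i\<in>A. F i) v = (\<Sum>i\<in>A. dual_app (F i) v)"
  by (induction A rule: infinite_finite_induct) simp_all

lemma dual_app_sum_right: "dual_app f (\<Sum>i\<in>A. F i) = (\<Sum>i\<in>A. dual_app f (F i))"
  by (induction A rule: infinite_finite_induct) (simp_all add: dual_app_add)

lemma gl_part_dual_act:
  assumes "clinear A"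
  shows "gl_part k (dual_act A) = dual_act (gl_part k A)"
proof (intro ext dual_eqI)
  fix f v
  note lin = clinear_gl_part[OF assms, of k]
  show "dual_app (gl_part k (dual_act A) f) v = dual_app (dual_act (gl_part k A) f) v"
    unfolding gl_part_def[of k "dual_act A"] dual_app_dual_act[OF lin] gl_part_gl_part[OF assms]
    using bit_cases[of k]
    by (elim disjE)
      (simp_all add: dual_app_dual_act[OF assms] twist_def gl_part_def hcomp_hcomp hcomp_add
        dual_app_add dual_app_cscale clin[OF assms] algebra_simps)
qed

lemma tens_split: "v \<otimes>\<^sub>C w = v \<otimes>\<^sub>C hcomp 0 w + v \<otimes>\<^sub>C hcomp 1 w"
  by (simp only: tens_add_right[symmetric] hcomp_sum)

lemma tens_diff_left: "(v - v') \<otimes>\<^sub>C w = v \<otimes>\<^sub>C w - v' \<otimes>\<^sub>C w"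
  using tens_add_left[of "v - v'" v' w] by simp

lemma gl_part_tleft:
  fixes A :: "'a::superspace \<Rightarrow> 'a"
  assumes "clinear A"
  shows "gl_part k (tleft A :: ('a, 'b::superspace) tensor \<Rightarrow> _) = tleft (gl_part k A)"
proof
  fix x :: "('a, 'b) tensor"
  note lin = clinear_gl_part[OF assms, of k]
  show "gl_part k (tleft A) x = tleft (gl_part k A) x"
  proof (induction x rule: tensor_induct)
    case (tens v w)
    show ?case
      unfolding tleft_tens[OF lin] tens_split[of "gl_part k A v" w] gl_part_def[of k "tleft A"]
      using bit_cases[of k]
      by (elim disjE)
        (simp_all add: hcomp_tens hcomp_add clin[OF clinear_tleft[OF assms]] tleft_tens[OF assms]
          hcomp_hcomp gl_part_def tens_add_left)
  next
    case (add a b)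
    then show ?case
      by (simp only: clinear_add[OF clinear_gl_part[OF clinear_tleft[OF assms]]]
          clinear_add[OF clinear_tleft[OF lin]])
  qed
qed

lemma tright_gl_part: "clinear B \<Longrightarrow> tright (gl_part k B) (v \<otimes>\<^sub>C w) = twist k v \<otimes>\<^sub>C gl_part k B w"
  using bit_cases[of k]
  by (elim disjE) (simp_all add: tright_tens[OF clinear_gl_part] gl_part_gl_part)

lemma gl_part_tright:
  fixes B :: "'b::superspace \<Rightarrow> 'b"
  assumes "clinear B"
  shows "gl_part k (tright B :: ('a::superspace, 'b) tensor \<Rightarrow> _) = tright (gl_part k B)"
proof
  fix x :: "('a, 'b) tensor"
  note lin = clinear_gl_part[OF assms, of k]
  show "gl_part k (tright B) x = tright (gl_part k B) x"
  proof (induction x rule: tensor_induct)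
    case (tens v w)
    show ?case
      unfolding tright_gl_part[OF assms] gl_part_def[of k "tright B"]
      using bit_cases[of k]
      by (elim disjE)
        (simp_all add: hcomp_tens hcomp_add clin[OF clinear_tright[OF assms]] tright_tens[OF assms]
          hcomp_hcomp twist_def hcomp_cscale gl_part_def tens_simps cscale_add_right clin[OF assms]
          tens_diff_left clinear_diff[OF clinear_hcomp] algebra_simps)
  next
    case (add a b)
    then show ?case
      by (simp only: clinear_add[OF clinear_gl_part[OF clinear_tright[OF assms]]]
          clinear_add[OF clinear_tright[OF lin]])
  qed
qed

lemma homog_tens:
  assumes "v \<in> homog j" "w \<in> homog k"
  shows "v \<otimes>\<^sub>C w \<in> homog (j + k)"
  unfolding homog_def mem_Collect_eq hcomp_tens hcomp_homog[OF assms(1)] hcomp_homog[OF assms(2)]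
  using bit_cases[of j] bit_cases[of k] by (elim disjE) simp_all

lemma homog_add: "v \<in> homog j \<Longrightarrow> w \<in> homog j \<Longrightarrow> v + w \<in> homog j"
  by (simp add: homog_def hcomp_add)

lemma homog_sum: "(\<And>i. i \<in> A \<Longrightarrow> F i \<in> homog j) \<Longrightarrow> (\<Sum>i\<in>A. F i) \<in> homog j"
  by (induction A rule: infinite_finite_induct) (simp_all add: homog_add, simp_all add: homog_def)

lemma basis_mem_homog: "homogeneous_basis p q e \<Longrightarrow> i \<in> indices p q \<Longrightarrow> e i \<in> homog (par i)"
  by (simp add: homogeneous_basis_def)

lemma dual_eq_basisI:
  fixes e :: "sindex \<Rightarrow> 'a::superspace"
  assumes "homogeneous_basis p q e" "\<And>j. j \<in> indices p q \<Longrightarrow> dual_app f (e j) = dual_app g (e j)"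
  shows "f = g"
proof (rule dual_eqI)
  fix v :: 'a
  have "v \<in> cvs.span (e ` indices p q)" using assms(1) by (simp add: homogeneous_basis_def)
  then show "dual_app f v = dual_app g v"
    by (induction rule: cvs.span_induct_alt) (auto simp: dual_app_add dual_app_cscale assms(2))
qed

lemma dual_basis_homog:
  assumes "homogeneous_basis p q e"
  shows "dual_basis p q e i \<in> homog (par i)"
  unfolding homog_def mem_Collect_eq
proof (rule dual_eq_basisI[OF assms])
  fix j assume j: "j \<in> indices p q"
  then show "dual_app (hcomp (par i) (dual_basis p q e i)) (e j) = dual_app (dual_basis p q e i) (e j)"
    by (auto simp: hcomp_homog[OF basis_mem_homog[OF assms j]] dual_basis_apply[OF assms j])
qed

lemma odd_form_homog:
  assumes "homogeneous_basis n n e"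
  shows "odd_form n e \<in> homog 1"
  unfolding odd_form_def Let_def
proof (intro homog_sum homog_add)
  fix i
  show "dual_basis n n e (Ev i) \<otimes>\<^sub>C dual_basis n n e (Od i) \<in> homog 1"
    using homog_tens[OF dual_basis_homog[OF assms] dual_basis_homog[OF assms], of "Ev i" "Od i"] by simp
  show "dual_basis n n e (Od i) \<otimes>\<^sub>C dual_basis n n e (Ev i) \<in> homog 1"
    using homog_tens[OF dual_basis_homog[OF assms] dual_basis_homog[OF assms], of "Od i" "Ev i"] by simp
qed

lemma pe_clinear: "A \<in> pe n e \<Longrightarrow> clinear A"
  by (simp add: pe_def gl_def)

text \<open>Because \<open>odd_form n e\<close> is homogeneous, the two parity components of an
  operator send it into opposite parities and must annihilate it separately.\<close>

lemma pe_gl_part: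
  assumes "homogeneous_basis n n e" "A \<in> pe n e"
  shows "gl_part k A \<in> pe n e"
proof -
  note A = pe_clinear[OF assms(2)]
  note D = clinear_dual_act[OF A]
  let ?w = "odd_form n e"
  have "tleft (dual_act (gl_part k A)) ?w + tright (dual_act (gl_part k A)) ?w
      = gl_part k (tleft (dual_act A)) ?w + gl_part k (tright (dual_act A)) ?w"
    by (simp only: gl_part_dual_act[OF A] gl_part_tleft[OF D] gl_part_tright[OF D])
  also have "\<dots> = hcomp (k + 1) (tleft (dual_act A) ?w + tright (dual_act A) ?w)"
    by (simp only: gl_part_homog[OF clinear_tleft[OF D] odd_form_homog[OF assms(1)]]
          gl_part_homog[OF clinear_tright[OF D] odd_form_homog[OF assms(1)]] hcomp_add)
  also have "\<dots> = 0" using assms(2) by (simp add: pe_def)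
  finally show ?thesis using clinear_gl_part[OF A] by (simp add: pe_def gl_def)
qed

lemma ssym_rep: "\<exists>a'. a = abs_ssym a'"
  by (metis Quotient_abs_rep[OF Quotient_ssym])

lemma sder_parts:
  assumes "clinear T"
  shows "sder T a = (\<Sum>k\<in>{0, 1}. sder (gl_part k T) a)"
proof -
  obtain a' where a: "a = abs_ssym a'" using ssym_rep by blast
  show ?thesis unfolding a sder_abs[OF assms] sder_gl_part[OF assms] ..
qed

lemma subspace_invariants:
  assumes "g \<subseteq> Collect clinear"
  shows "cvs.subspace (invariants g)"
proof (rule cvs.subspaceI)
  have lin: "clinear (gl_act_V A)" if "A \<in> g" for A
    unfolding gl_act_V_def using assms that by (intro clinear_sder clinear_tleft clinear_dual_act) blast
  show "0 \<in> invariants g" by (simp add: invariants_def clinear_zero[OF lin])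
  show "x + y \<in> invariants g" if "x \<in> invariants g" "y \<in> invariants g" for x y
    using that by (simp add: invariants_def clinear_add[OF lin])
  show "c *\<^sub>C x \<in> invariants g" if "x \<in> invariants g" for c x
    using that by (simp add: invariants_def clinear_cscale[OF lin])
qed

lemma gl_act_V_gl_part:
  assumes "clinear A"
  shows "sder (gl_part k (tleft (dual_act A))) a = gl_act_V (gl_part k A) a"
  unfolding gl_act_V_def gl_part_tleft[OF clinear_dual_act[OF assms]] gl_part_dual_act[OF assms] ..

text \<open>The Leibniz rule holds for each parity component separately, with its own sign;
  \<open>pe_gl_part\<close> ensures that each component annihilates both factors.\<close>

lemma subalgebra_invariants_pe:
  fixes e :: "sindex \<Rightarrow> 'v::superspace"
  assumes "homogeneous_basis n n e"
  shows "subalgebra (invariants (pe n e) :: ('v dual, 'w::superspace) tensor ssym set)"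
  unfolding subalgebra_def
proof (intro conjI ballI)
  show "cvs.subspace (invariants (pe n e) :: ('v dual, 'w) tensor ssym set)"
    by (rule subspace_invariants) (use pe_clinear in blast)
  show "(1 :: ('v dual, 'w) tensor ssym) \<in> invariants (pe n e)"
    by (simp add: invariants_def gl_act_V_def sder_one clinear_tleft clinear_dual_act pe_clinear)
  fix a b :: "('v dual, 'w) tensor ssym"
  assume a: "a \<in> invariants (pe n e)" and b: "b \<in> invariants (pe n e)"
  obtain a' b' where ab: "a = abs_ssym a'" "b = abs_ssym b'" using ssym_rep by blast
  have "gl_act_V A (a * b) = 0" if A: "A \<in> pe n e" for A
  proof -
    let ?T = "tleft (dual_act A) :: ('v dual, 'w) tensor \<Rightarrow> _"
    note lin = pe_clinear[OF A]
    have T: "clinear ?T" by (intro clinear_tleft clinear_dual_act lin)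
    have "sder_free k ?T a' = 0 \<and> sder_free k ?T b' = 0" for k
      using a b pe_gl_part[OF assms A, of k] sder_gl_part[OF T, of k]
      by (auto simp: ab invariants_def gl_act_V_gl_part[OF lin])
    then show ?thesis
      by (simp add: gl_act_V_def ab times_ssym.abs_eq sder_abs[OF T] sder_free_mult)
  qed
  then show "a * b \<in> invariants (pe n e)" by (simp add: invariants_def)
qed

lemma sgen_zero [simp]: "sgen 0 = 0"
  by (rule clinear_zero[OF clinear_sgen])

lemma gl_part_const0: "gl_part k (\<lambda>_. 0) = (\<lambda>_. 0)"
  by (simp add: gl_part_def fun_eq_iff)

lemma sder_const0: "sder (\<lambda>_. 0) a = 0"
proof (induction a rule: ssym_induct)
  case (one c)
  show ?case by (simp add: clin[OF clinear_sder[OF clinear_const0]] sder_one[OF clinear_const0])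
next
  case (sgen_mult u a)
  then show ?case by (simp add: sder_sgen_mult[OF clinear_const0] gl_part_const0)
next
  case (add a b)
  then show ?case by (simp add: clin[OF clinear_sder[OF clinear_const0]])
qed

lemma sder_homog_sgen_mult:
  assumes "clinear T" "gl_part k T = T"
  shows "sder T (sgen u * a) = sgen (T u) * a + sgen (twist k u) * sder T a"
proof -
  have "gl_part j T = (if j = k then T else (\<lambda>_. 0))" for j
    using gl_part_gl_part[OF assms(1), of j k] unfolding assms(2) .
  then show ?thesis
    using bit_cases[of k]
    by (elim disjE) (simp_all add: sder_sgen_mult[OF assms(1)] sder_const0)
qed

lemma twist_parity:
  assumes "clinear T" "gl_part k T = T"
  shows "twist l (T v) = bsign (k * l) *\<^sub>C T (twist l v)"
proof -
  have h: "T (hcomp j v) \<in> homog (k + j)" for j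
  proof -
    have "hcomp j v \<in> homog j" by (simp add: homog_def hcomp_hcomp)
    from gl_part_hom[OF assms(1) this, of k] show ?thesis by (simp only: assms(2))
  qed
  have "T v = T (hcomp 0 v) + T (hcomp 1 v)"
    by (simp only: clinear_add[OF assms(1), symmetric] hcomp_sum)
  then have "twist l (T v) = bsign (l * (k + 0)) *\<^sub>C T (hcomp 0 v) + bsign (l * (k + 1)) *\<^sub>C T (hcomp 1 v)"
    by (simp only: clinear_add[OF clinear_twist] twist_homog[OF h])
  moreover have "T (twist l v) = T (hcomp 0 v) + bsign l *\<^sub>C T (hcomp 1 v)"
    by (simp add: twist_def clin[OF assms(1)])
  ultimately show ?thesis
    using bit_cases[of k] bit_cases[of l] by (elim disjE) (simp_all add: cscale_add_right)
qed

lemma twist_twist: "twist k (twist l u) = twist l (twist k u)"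
  by (simp add: twist_def hcomp_add hcomp_cscale hcomp_hcomp mult.commute)

lemma sder_supercommute:
  assumes T: "clinear T" "gl_part k T = T" and U: "clinear U" "gl_part l U = U"
    and comm: "\<And>u. T (U u) = bsign (k * l) *\<^sub>C U (T u)"
  shows "sder T (sder U a) = bsign (k * l) *\<^sub>C sder U (sder T a)"
proof (induction a rule: ssym_induct)
  case (one c)
  show ?case
    by (simp add: clin[OF clinear_sder[OF T(1)]] clin[OF clinear_sder[OF U(1)]] sder_one[OF T(1)] sder_one[OF U(1)])
next
  case (sgen_mult u a)
  have tT: "twist l (T u) = bsign (k * l) *\<^sub>C T (twist l u)" by (rule twist_parity[OF T])
  have tU: "twist k (U u) = bsign (k * l) *\<^sub>C U (twist k u)"
    using twist_parity[OF U, of k u] by (simp only: mult.commute)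
  note S = sder_homog_sgen_mult[OF T] sder_homog_sgen_mult[OF U]
  show ?case
    by (simp add: S clinear_add[OF clinear_sder[OF T(1)]] clinear_add[OF clinear_sder[OF U(1)]]
        sgen_mult comm tT tU twist_twist[of k l] clinear_cscale[OF clinear_sgen]
        ssym_scale_mult_left ssym_scale_mult_right cscale_add_right ac_simps)
next
  case (add a b)
  then show ?case
    by (simp only: clinear_add[OF clinear_sder[OF T(1)]] clinear_add[OF clinear_sder[OF U(1)]] cscale_add_right)
qed

text \<open>The sign comes from \<open>twist l\<close> in \<open>tright\<close>, through which an
  operator of parity \<open>k\<close> on the left factor has to pass.\<close>

lemma tleft_tright_supercommute:
  assumes T: "clinear T" "gl_part k T = T" and U: "clinear U"
  shows "tleft T (tright (gl_part l U) x) = bsign (k * l) *\<^sub>C tright (gl_part l U) (tleft T x)"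
proof (induction x rule: tensor_induct)
  case (tens v w)
  show ?case
    by (simp add: tright_gl_part[OF U] tleft_tens[OF T(1)] twist_parity[OF T] tens_cscale_left)
next
  case (add a b)
  then show ?case
    by (simp only: clinear_add[OF clinear_tleft[OF T(1)]]
        clinear_add[OF clinear_tright[OF clinear_gl_part[OF U]]] cscale_add_right)
qed

lemma gl_act_W_invariants:
  assumes "homogeneous_basis n n e" "B \<in> gl" "a \<in> invariants (pe n e)"
  shows "gl_act_W B a \<in> invariants (pe n e)"
proof -
  have B: "clinear B" using assms(2) by (simp add: gl_def)
  have "gl_act_V A (gl_act_W B a) = 0" if A: "A \<in> pe n e" for A
  proof -
    note lin = pe_clinear[OF A]
    have 0: "sder (tleft (dual_act (gl_part k A))) (sder (tright (gl_part l B)) a) = 0" for k l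
    proof -
      have lk: "clinear (gl_part k A)" by (rule clinear_gl_part[OF lin])
      have h: "gl_part k (dual_act (gl_part k A)) = dual_act (gl_part k A)"
        unfolding gl_part_dual_act[OF lk] by (simp add: gl_part_gl_part[OF lin])
      have "sder (tleft (dual_act (gl_part k A))) (sder (tright (gl_part l B)) a)
        = bsign (k * l) *\<^sub>C sder (tright (gl_part l B)) (sder (tleft (dual_act (gl_part k A))) a)"
      proof (rule sder_supercommute)
        show "clinear (tleft (dual_act (gl_part k A)) :: ('a dual, 'b) tensor \<Rightarrow> _)"
          by (intro clinear_tleft clinear_dual_act lk)
        show "clinear (tright (gl_part l B) :: ('a dual, 'b) tensor \<Rightarrow> _)"
          by (intro clinear_tright clinear_gl_part B)
        show "gl_part k (tleft (dual_act (gl_part k A)) :: ('a dual, 'b) tensor \<Rightarrow> _) = tleft (dual_act (gl_part k A))"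
          unfolding gl_part_tleft[OF clinear_dual_act[OF lk]] h ..
        show "gl_part l (tright (gl_part l B) :: ('a dual, 'b) tensor \<Rightarrow> _) = tright (gl_part l B)"
          unfolding gl_part_tright[OF clinear_gl_part[OF B]] by (simp add: gl_part_gl_part[OF B])
        show "tleft (dual_act (gl_part k A)) (tright (gl_part l B) x)
          = bsign (k * l) *\<^sub>C tright (gl_part l B) (tleft (dual_act (gl_part k A)) x)" for x :: "('a dual, 'b) tensor"
          by (rule tleft_tright_supercommute[OF clinear_dual_act[OF lk] h B])
      qed
      also have "sder (tleft (dual_act (gl_part k A))) a = 0"
        using assms(3) pe_gl_part[OF assms(1) A, of k] by (simp add: invariants_def gl_act_V_def)
      finally show ?thesis
        by (simp add: clinear_zero[OF clinear_sder[OF clinear_tright[OF clinear_gl_part[OF B]]]])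
    qed
    have lT: "clinear (tleft (dual_act A) :: ('a dual, 'b) tensor \<Rightarrow> _)"
      by (intro clinear_tleft clinear_dual_act lin)
    have "gl_act_V A (gl_act_W B a)
      = (\<Sum>k\<in>{0, 1}. \<Sum>l\<in>{0, 1}. sder (gl_part k (tleft (dual_act A))) (sder (gl_part l (tright B)) a))"
      unfolding gl_act_V_def gl_act_W_def sder_parts[OF lT] sder_parts[OF clinear_tright[OF B]]
      by (simp only: clinear_sum[OF clinear_sder[OF clinear_gl_part[OF lT]]])
    then show ?thesis
      unfolding gl_part_tleft[OF clinear_dual_act[OF lin]] gl_part_dual_act[OF lin] gl_part_tright[OF B]
      by (simp add: 0)
  qed
  then show ?thesis by (simp add: invariants_def)
qed

lemma polarizations_invariants:
  fixes e :: "sindex \<Rightarrow> 'v::superspace"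
  assumes "homogeneous_basis n n e" "P \<in> polarizations"
    "(a :: ('v dual, 'w::superspace) tensor ssym) \<in> invariants (pe n e)"
  shows "P a \<in> invariants (pe n e)"
  using assms(2,3)
proof (induction arbitrary: a rule: polarizations.induct)
  case (2 B)
  then show ?case by (simp add: gl_act_W_invariants[OF assms(1)])
next
  case (4 P Q)
  have "cvs.subspace (invariants (pe n e) :: ('v dual, 'w) tensor ssym set)"
    by (rule subspace_invariants) (use pe_clinear in blast)
  then show ?case using 4 by (simp add: cvs.subspace_add)
next
  case (5 P c)
  have "cvs.subspace (invariants (pe n e) :: ('v dual, 'w) tensor ssym set)"
    by (rule subspace_invariants) (use pe_clinear in blast)
  then show ?case using 5 by (simp add: cvs.subspace_scale)
qed simp_all

section \<open>Invariance of the inner products\<close>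

definition pairing :: "bit \<Rightarrow> 'w \<Rightarrow> 'w \<Rightarrow> ('v::superspace dual, 'v dual) tensor \<Rightarrow> ('v dual, 'w::superspace) tensor ssym"
  where "pairing j x y = tensor_lift (\<lambda>f g. sgen (f \<otimes>\<^sub>C x) * sgen (twist j g \<otimes>\<^sub>C y))"

lemma cbilinear_pairing: "cbilinear (\<lambda>f g. sgen (f \<otimes>\<^sub>C x) * sgen (twist j g \<otimes>\<^sub>C y))"
  by (rule cbilinearI)
    (simp_all add: tens_simps clin[OF clinear_sgen] clin[OF clinear_twist] distrib_left distrib_right
      ssym_scale_mult_left ssym_scale_mult_right)

lemma pairing_tens: "pairing j x y (f \<otimes>\<^sub>C g) = sgen (f \<otimes>\<^sub>C x) * sgen (twist j g \<otimes>\<^sub>C y)"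
  unfolding pairing_def by (rule tensor_lift_tens[OF cbilinear_pairing])

lemma clinear_pairing: "clinear (pairing j x y)"
  unfolding pairing_def by (rule clinear_tensor_lift[OF cbilinear_pairing])

lemma twist_tens:
  assumes "x \<in> homog j"
  shows "twist k (f \<otimes>\<^sub>C x) = bsign (k * j) *\<^sub>C (twist k f \<otimes>\<^sub>C x)"
  using bit_cases[of j] bit_cases[of k]
  by (elim disjE)
    (simp_all add: twist_def hcomp_tens hcomp_homog[OF assms] tens_simps tens_diff_left)

text \<open>The \<open>twist j\<close> in \<open>pairing\<close> accounts for exchanging
  \<open>x\<close> with the second functional, which makes the pairing equivariant. Inner products
  are the images of \<open>odd_form n e\<close>, so the definition of \<open>pe\<close> yields their
  invariance.\<close>

lemma sder_pairing:
  assumes "x \<in> homog j" "clinear A"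
  shows "sder (tleft A) (pairing j x y t) = pairing j x y (tleft A t + tright A t)"
proof (induction t rule: tensor_induct)
  case (tens f g)
  note T = clinear_tleft[OF assms(2)]
  have "sder (tleft A) (sgen (f \<otimes>\<^sub>C x) * sgen (twist j g \<otimes>\<^sub>C y)) = sgen (A f \<otimes>\<^sub>C x) * sgen (twist j g \<otimes>\<^sub>C y)
      + (\<Sum>k\<in>{0, 1}. sgen (twist k (f \<otimes>\<^sub>C x)) * sgen (gl_part k A (twist j g) \<otimes>\<^sub>C y))"
  proof -
    have "sder (gl_part k (tleft A)) (sgen (twist j g \<otimes>\<^sub>C y)) = sgen (gl_part k A (twist j g) \<otimes>\<^sub>C y)" for k
    proof -
      note Tk = clinear_tleft[OF clinear_gl_part[OF assms(2)]]
      have "sder (tleft (gl_part k A)) (sgen (twist j g \<otimes>\<^sub>C y) * 1) = sgen (gl_part k A (twist j g) \<otimes>\<^sub>C y) * 1"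
        unfolding sder_sgen_mult[OF Tk] tleft_tens[OF clinear_gl_part[OF assms(2)]]
        by (simp add: sder_one[OF clinear_gl_part[OF Tk]])
      then show ?thesis unfolding gl_part_tleft[OF assms(2)] by simp
    qed
    then show ?thesis unfolding sder_sgen_mult[OF T] tleft_tens[OF assms(2)] by simp
  qed
  moreover have "sgen (twist k (f \<otimes>\<^sub>C x)) * sgen (gl_part k A (twist j g) \<otimes>\<^sub>C y)
      = sgen (twist k f \<otimes>\<^sub>C x) * sgen (twist j (gl_part k A g) \<otimes>\<^sub>C y)" for k
  proof -
    have "gl_part k (gl_part k A) = gl_part k A" by (simp add: gl_part_gl_part[OF assms(2)])
    from twist_parity[OF clinear_gl_part[OF assms(2)] this, of j g]
    show ?thesis
      by (simp add: twist_tens[OF assms(1)] tens_cscale_left clin[OF clinear_sgen]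
          ssym_scale_mult_left ssym_scale_mult_right)
  qed
  ultimately show ?case
    by (simp add: pairing_tens tleft_tens[OF assms(2)] tright_tens[OF assms(2)] clin[OF clinear_pairing] add.assoc)
next
  case (add a b)
  then show ?case
    by (simp add: clin[OF clinear_pairing] clin[OF clinear_sder[OF clinear_tleft[OF assms(2)]]]
      clin[OF clinear_tleft[OF assms(2)]] clin[OF clinear_tright[OF assms(2)]] ac_simps)
qed

lemma inner_product_eq_pairing:
  assumes "homogeneous_basis n n e"
  shows "inner_product n e w s t = pairing (par s) (w s) (w t) (odd_form n e)"
  unfolding odd_form_def inner_product_def xgen_def Let_def clin[OF clinear_pairing] pairing_tens
    twist_homog[OF dual_basis_homog[OF assms]]
  by (simp add: tens_cscale_left clin[OF clinear_sgen] ssym_scale_mult_right)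

lemma inner_product_invariant:
  assumes "homogeneous_basis n n e" "w s \<in> homog (par s)"
  shows "inner_product n e w s t \<in> invariants (pe n e)"
proof -
  have "gl_act_V A (pairing (par s) (w s) (w t) (odd_form n e)) = 0" if A: "A \<in> pe n e" for A
    unfolding gl_act_V_def sder_pairing[OF assms(2) clinear_dual_act[OF pe_clinear[OF A]]]
    using A by (simp add: pe_def clin[OF clinear_pairing])
  then show ?thesis by (simp add: invariants_def inner_product_eq_pairing[OF assms(1)])
qed

section \<open>Comparison with Fock space\<close>

definition part :: "nat \<Rightarrow> state \<Rightarrow> state" where
  "part m f w = (if length w = m then f w else 0)"

lemma hom_part: "hom m (part m f)"
  by (simp add: hom_def part_def)

lemma cre_part: "cre a (part m f) = part (Suc m) (cre a f)"
proof
  show "cre a (part m f) w = part (Suc m) (cre a f) w" for w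
  proof (cases "length w = Suc m")
    case True
    have "cre a (part k f) w = cre a f w" if "length w = Suc k" for k f
      using that
    proof (induction w arbitrary: k f)
      case (Cons b w)
      show ?case
      proof (cases k)
        case 0
        then show ?thesis using Cons.prems by (simp add: part_def)
      next
        case (Suc l)
        have "ann b (part (Suc l) f) = part l (ann b f)"
          by (rule ext) (simp add: ann_def part_def)
        moreover have "length w = Suc l" using Cons.prems Suc by simp
        moreover from this have "part (Suc l) f w = f w" by (simp add: part_def)
        ultimately show ?thesis unfolding Suc cre.simps by (simp only: Cons.IH)
      qed
    qed simp
    from this[OF True] have "cre a (part m f) w = cre a f w" .
    then show ?thesis using True unfolding part_def[of "Suc m"] by (simp only: simp_thms if_True)
  next
    case False
    then show ?thesis using hom_cre[OF hom_part, of m a f] by (auto simp: hom_def part_def)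
  qed
qed

lemma ann_part: "ann b (part (Suc m) f) = part m (ann b f)" "ann b (part 0 f) = 0"
  by (rule ext, simp add: ann_def part_def)+

lemma part_lin: "part m (c *\<^sub>C f) = c *\<^sub>C part m f" "part m (\<Sum>i\<in>A. F i) = (\<Sum>i\<in>A. part m (F i))"
  "part m 0 = 0"
  by (rule ext, simp add: part_def sum_fun_apply)+

lemma quad_part: "quad L M (part m f) = part m (quad L M f)"
proof (cases m)
  case 0
  have "part 0 (cre a g) = 0" for a g
  proof
    show "part 0 (cre a g) w = 0 w" for w by (cases w) (simp_all add: part_def)
  qed
  then show ?thesis unfolding 0 quad_def ann_part cre_lin part_lin by (simp only: cvs.scale_zero_right)
next
  case (Suc k)
  show ?thesis unfolding Suc quad_def ann_part cre_part part_lin ..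
qed

lemma fock_part: "f \<in> fock L \<Longrightarrow> part m f \<in> fock L"
proof -
  assume f: "f \<in> fock L"
  have "ssymm (part m f)"
    unfolding ssymm_def
  proof (intro allI)
    show "part m f (u @ a # b # v) = sg a b * part m f (u @ b # a # v)" for u a b v
      using ssymmD[OF fock_ssymm[OF f], of u a b v] by (simp add: part_def)
  qed
  moreover have "set w \<subseteq> L" if "part m f w \<noteq> 0" for w
    using that fock_support[OF f, of w] unfolding part_def by (cases "length w = m") simp_all
  ultimately show ?thesis unfolding fock_def by blast
qed

lemma hmap_part: "hmap L Op z m (part m f) = hmap L Op z m f"
proof (induction m arbitrary: f)
  case 0
  show ?case by (simp add: part_def)
next
  case (Suc m)
  show ?case unfolding hmap.simps(2) ann_part Suc ..
qed

locale superspaces = frame n p q for n p q :: nat +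
  fixes e :: "sindex \<Rightarrow> 'v::superspace" and w :: "sindex \<Rightarrow> 'w::superspace"
  assumes e: "homogeneous_basis n n e" and w: "homogeneous_basis p q w"
begin

text \<open>The indices belonging to W itself; \<open>S\<close> extends them by the even frame
  indices beyond \<open>p\<close>.\<close>

definition S0 where "S0 = indices p q"
definition L0 where "L0 = I \<times> S0"

lemma finite_S0 [simp]: "finite S0" and finite_L0 [simp]: "finite L0"
  by (simp_all add: S0_def L0_def indices_def)

lemma S0_S: "s \<in> S0 \<Longrightarrow> s \<in> S"
  by (auto simp: S0_def S_def indices_def)

lemma L0_L: "a \<in> L0 \<Longrightarrow> a \<in> L"
  by (cases a) (simp add: L0_def S0_S)

lemma mem_L0 [simp]: "(i, s) \<in> L0 \<longleftrightarrow> i \<in> I \<and> s \<in> S0"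
  by (simp add: L0_def)

abbreviation "e' \<equiv> dual_basis n n e"
abbreviation "w' \<equiv> dual_basis p q w"

lemma e'_apply: "j \<in> I \<Longrightarrow> dual_app (e' i) (e j) = of_bool (i = j)"
  by (simp add: I_def dual_basis_apply[OF e])

lemma w'_apply: "t \<in> S0 \<Longrightarrow> dual_app (w' s) (w t) = of_bool (s = t)"
  by (simp add: S0_def dual_basis_apply[OF w])

lemma sum_of_bool_mult:
  fixes F :: "'z \<Rightarrow> complex"
  assumes "finite A" "b \<in> A"
  shows "(\<Sum>a\<in>A. F a * of_bool (a = b)) = F b"
  using sum_of_bool_cscale(1)[OF assms(1), of b F] assms(2) by (simp add: mult.commute)

lemma dual_expand: "f = (\<Sum>i\<in>I. dual_app f (e i) *\<^sub>C e' i)"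
proof (rule dual_eq_basisI[OF e])
  fix j assume "j \<in> indices n n"
  then have j: "j \<in> I" by (simp add: I_def)
  show "dual_app f (e j) = dual_app (\<Sum>i\<in>I. dual_app f (e i) *\<^sub>C e' i) (e j)"
    by (simp add: dual_app_sum e'_apply[OF j] sum_of_bool_mult j)
qed

lemma basis_expand:
  fixes b :: "sindex \<Rightarrow> 'a::superspace"
  assumes "homogeneous_basis k l b"
  shows "v = (\<Sum>i\<in>indices k l. dual_app (dual_basis k l b i) v *\<^sub>C b i)"
proof -
  have fin: "finite (indices k l)" by (simp add: indices_def)
  have "v \<in> cvs.span (b ` indices k l)" using assms by (simp add: homogeneous_basis_def)
  then show ?thesis
  proof (induction rule: cvs.span_induct_alt)
    case base
    show ?case by simp
  next
    case (step c x y)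
    from step(1) obtain j where j: "j \<in> indices k l" "x = b j" by blast
    have "(\<Sum>i\<in>indices k l. dual_app (dual_basis k l b i) (c *\<^sub>C x + y) *\<^sub>C b i)
      = c *\<^sub>C (\<Sum>i\<in>indices k l. of_bool (i = j) *\<^sub>C b i)
        + (\<Sum>i\<in>indices k l. dual_app (dual_basis k l b i) y *\<^sub>C b i)"
      by (simp add: dual_app_add dual_app_cscale j(2) dual_basis_apply[OF assms j(1)]
          cscale_add_left sum.distrib cvs.scale_sum_right of_bool_def)
    also have "\<dots> = c *\<^sub>C x + y" using step(2) by (simp add: sum_of_bool_cscale(1)[OF fin] j)
    finally show ?case by simp
  qed
qed

section \<open>Coordinates with respect to the generators, and creation operators for arbitrary
  vectors\<close>

definition gen :: "letter \<Rightarrow> ('v dual, 'w) tensor" where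
  "gen a = e' (fst a) \<otimes>\<^sub>C w (snd a)"

definition coord :: "letter \<Rightarrow> ('v dual, 'w) tensor \<Rightarrow> complex" where
  "coord a = tensor_lift (\<lambda>f v. dual_app f (e (fst a)) * dual_app (w' (snd a)) v)"

lemma cbilinear_coord:
  "cbilinear (\<lambda>f v. dual_app f (e (fst a)) * dual_app (w' (snd a)) v :: complex)"
  by (rule cbilinearI) (simp_all add: dual_app_add dual_app_cscale algebra_simps)

lemma clinear_coord: "clinear (coord a)"
  unfolding coord_def by (rule clinear_tensor_lift[OF cbilinear_coord])

lemmas coord_lin = clin[OF clinear_coord]

lemma coord_tens: "coord a (f \<otimes>\<^sub>C v) = dual_app f (e (fst a)) * dual_app (w' (snd a)) v"
  unfolding coord_def by (rule tensor_lift_tens[OF cbilinear_coord])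

lemma coord_gen: "a \<in> L0 \<Longrightarrow> b \<in> L0 \<Longrightarrow> coord a (gen b) = of_bool (a = b)"
  by (cases a; cases b) (auto simp: gen_def coord_tens e'_apply w'_apply)

lemma tens_sum_left: "(\<Sum>i\<in>A. F i) \<otimes>\<^sub>C x = (\<Sum>i\<in>A. F i \<otimes>\<^sub>C x)"
  by (induction A rule: infinite_finite_induct) (simp_all add: tens_add_left)

lemma tens_sum_right: "x \<otimes>\<^sub>C (\<Sum>i\<in>A. F i) = (\<Sum>i\<in>A. x \<otimes>\<^sub>C F i)"
  by (induction A rule: infinite_finite_induct) (simp_all add: tens_add_right)

lemma gen_expand: "u = (\<Sum>a\<in>L0. coord a u *\<^sub>C gen a)"
proof (induction u rule: tensor_induct)
  case (tens f v)
  have "f \<otimes>\<^sub>C v = (\<Sum>i\<in>I. dual_app f (e i) *\<^sub>C e' i) \<otimes>\<^sub>C (\<Sum>s\<in>S0. dual_app (w' s) v *\<^sub>C w s)"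
    by (simp only: dual_expand[symmetric] basis_expand[OF w, symmetric] S0_def)
  also have "\<dots> = (\<Sum>s\<in>S0. \<Sum>i\<in>I. coord (i, s) (f \<otimes>\<^sub>C v) *\<^sub>C gen (i, s))"
    by (simp only: tens_sum_left tens_sum_right tens_cscale_left tens_cscale_right coord_tens gen_def
        fst_conv snd_conv cscale_cscale cvs.scale_sum_right mult.commute)
  also have "\<dots> = (\<Sum>i\<in>I. \<Sum>s\<in>S0. coord (i, s) (f \<otimes>\<^sub>C v) *\<^sub>C gen (i, s))"
    by (rule sum.swap)
  also have "\<dots> = (\<Sum>a\<in>L0. coord a (f \<otimes>\<^sub>C v) *\<^sub>C gen a)"
    unfolding L0_def by (simp add: sum.cartesian_product)
  finally show ?case .
next
  case (add u u')
  then show ?case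
    by (simp only: coord_lin cscale_add_left sum.distrib)
qed

lemma gen_homog:
  assumes "a \<in> L0"
  shows "gen a \<in> homog (lpar a)"
  unfolding gen_def lpar_def
  by (rule homog_tens[OF dual_basis_homog[OF e] basis_mem_homog[OF w]])
    (use assms in \<open>simp add: L0_def S0_def mem_Times_iff\<close>)

lemma coord_homog:
  assumes "u \<in> homog j" "a \<in> L0" "coord a u \<noteq> 0"
  shows "lpar a = j"
proof (rule ccontr)
  assume ne: "lpar a \<noteq> j"
  have "coord a (hcomp j u) = (\<Sum>b\<in>L0. coord b u * coord a (hcomp j (gen b)))"
    by (subst gen_expand[of u])
      (simp only: clinear_sum[OF clinear_hcomp] clinear_cscale[OF clinear_hcomp] coord_lin cscale_complex_def)
  also have "\<dots> = (\<Sum>b\<in>L0. 0)"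
  proof (rule sum.cong[OF refl])
    fix b assume b: "b \<in> L0"
    show "coord b u * coord a (hcomp j (gen b)) = 0"
      unfolding hcomp_homog[OF gen_homog[OF b]] using ne b assms(2)
      by (auto simp: coord_gen coord_lin)
  qed
  finally have "coord a (hcomp j u) = 0" by simp
  then show False using assms(1,3) by (simp add: homog_def)
qed

definition crev :: "('v dual, 'w) tensor \<Rightarrow> state \<Rightarrow> state" where
  "crev u h = (\<Sum>a\<in>L0. coord a u *\<^sub>C cre a h)"

lemma clinear_crev: "clinear (crev u)"
proof -
  have "crev u = (\<lambda>h. \<Sum>a\<in>L0. coord a u *\<^sub>C cre a h)" by (rule ext) (rule crev_def)
  then show ?thesis
    by (simp only:) (intro clinear_compose_sum clinear_compose_cscale clinear_cre)
qed

lemma crev_add: "crev (u + v) h = crev u h + crev v h"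
  and crev_cscale: "crev (c *\<^sub>C u) h = c *\<^sub>C crev u h"
  and crev_sum: "crev (\<Sum>i\<in>A. F i) h = (\<Sum>i\<in>A. crev (F i) h)"
  unfolding crev_def coord_lin
  by (simp_all only: cscale_add_left sum.distrib cscale_complex_def cscale_cscale[symmetric]
      cvs.scale_sum_right[symmetric] cvs.scale_sum_left) (rule sum.swap)

lemma crev_gen:
  assumes "b \<in> L0"
  shows "crev (gen b) h = cre b h"
proof -
  have "crev (gen b) h = (\<Sum>a\<in>L0. of_bool (a = b) *\<^sub>C cre a h)"
    unfolding crev_def by (rule sum.cong[OF refl]) (simp only: coord_gen assms)
  then show ?thesis by (simp only: sum_of_bool_cscale finite_L0 assms if_True)
qed

lemma crev_crev:
  assumes "u \<in> homog j" "v \<in> homog k"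
  shows "crev u (crev v h) = bsign (j * k) *\<^sub>C crev v (crev u h)"
proof -
  have "coord a u *\<^sub>C (coord b v *\<^sub>C cre a (cre b h)) = bsign (j * k) *\<^sub>C (coord b v *\<^sub>C (coord a u *\<^sub>C cre b (cre a h)))"
    if "a \<in> L0" "b \<in> L0" for a b
  proof (cases "coord a u = 0 \<or> coord b v = 0")
    case True
    then show ?thesis by (elim disjE) (simp_all only: cvs.scale_zero_left cvs.scale_zero_right)
  next
    case False
    then have "sg a b = bsign (j * k)"
      unfolding sg_def using coord_homog[OF assms(1) that(1)] coord_homog[OF assms(2) that(2)] by simp
    then show ?thesis unfolding cre_cre[of a b] cscale_cscale by (simp only: ac_simps)
  qed
  then have "(\<Sum>a\<in>L0. \<Sum>b\<in>L0. coord a u *\<^sub>C (coord b v *\<^sub>C cre a (cre b h)))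
    = (\<Sum>a\<in>L0. \<Sum>b\<in>L0. bsign (j * k) *\<^sub>C (coord b v *\<^sub>C (coord a u *\<^sub>C cre b (cre a h))))"
    by (intro sum.cong refl)
  also have "\<dots> = (\<Sum>b\<in>L0. \<Sum>a\<in>L0. bsign (j * k) *\<^sub>C (coord b v *\<^sub>C (coord a u *\<^sub>C cre b (cre a h))))"
    by (rule sum.swap)
  finally show ?thesis
    unfolding crev_def cre_lin by (simp only: cvs.scale_sum_right)
qed

section \<open>The map from the symmetric superalgebra to Fock space\<close>

definition opw :: "('v dual, 'w) tensor free_alg \<Rightarrow> state \<Rightarrow> state" where
  "opw a h = lext (\<lambda>x. foldr crev (letters x) h) a"

lemma clinear_foldr_crev: "clinear (foldr crev us)"
proof (induction us)
  case Nil
  show ?case unfolding foldr.simps(1) id_def by (rule clinear_id)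
next
  case (Cons u us)
  have "foldr crev (u # us) = (\<lambda>h. crev u (foldr crev us h))" by (rule ext) (simp only: foldr.simps o_apply)
  then show ?case by (simp only: clinear_compose[OF clinear_crev Cons])
qed

lemma opw_single: "opw (Poly_Mapping.single x c) h = c *\<^sub>C foldr crev (letters x) h"
  unfolding opw_def by (rule lext_single)

lemma opw_add: "opw (a + b) h = opw a h + opw b h"
  unfolding opw_def by (rule lext_add)

lemma opw_right: "opw a (h + h') = opw a h + opw a h'" "opw a (c *\<^sub>C h) = c *\<^sub>C opw a h"
  unfolding opw_def lext_def clin[OF clinear_foldr_crev]
  by (simp_all only: cscale_add_right sum.distrib cvs.scale_sum_right cscale_cscale mult.commute)

lemma opw_mult: "opw (a * b) h = opw a (opw b h)"
proof (induction a rule: pm_induct)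
  case (single x c)
  show ?case
  proof (induction b rule: pm_induct)
    case (single y d)
    show ?case
      unfolding mult_single opw_single plus_word_def word.sel foldr_append o_apply
        clin[OF clinear_foldr_crev] by (simp only: cscale_cscale)
  next
    case (add b b')
    then show ?case by (simp only: distrib_left opw_add opw_right)
  qed
next
  case (add a a')
  then show ?case by (simp only: distrib_right opw_add)
qed

lemma opw_fgen: "opw (fgen u) h = crev u h"
  unfolding fgen_def opw_single by (simp only: word.sel foldr.simps o_apply id_apply cscale_one)

lemma opw_diff: "opw (a - b) h = opw a h - opw b h"
  unfolding opw_def by (rule lext_diff)

lemma opw_pmscale: "opw (pmscale c a) h = c *\<^sub>C opw a h"
  unfolding opw_def by (rule lext_pmscale)

lemma opw_ideal: "a \<in> ssym_ideal \<Longrightarrow> opw a h = 0"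
proof (induction arbitrary: h rule: ssym_ideal.induct)
  case (fgen_add u v)
  show ?case unfolding opw_diff opw_fgen crev_add by (simp only: add_diff_cancel_left' diff_self)
next
  case (fgen_cscale c u)
  show ?case unfolding opw_diff opw_pmscale opw_fgen crev_cscale by (rule diff_self)
next
  case (fgen_commute u j v k)
  show ?case
    unfolding opw_diff opw_pmscale opw_mult opw_fgen crev_crev[OF fgen_commute] by (rule diff_self)
next
  case (ideal_add a b)
  then show ?case by (simp only: opw_add add_0_left)
next
  case (ideal_mult a l r)
  have "opw l 0 = 0" using opw_right(2)[of l 0 0] by (simp only: cvs.scale_zero_left)
  then show ?case by (simp only: opw_mult ideal_mult)
qed

text \<open>The free algebra acts on states by creation operators. These satisfy the relations of
  \<open>ssym_ideal\<close>, so the result on the vacuum does not depend on the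
  representative.\<close>

definition Phi :: "('v dual, 'w) tensor ssym \<Rightarrow> state" where
  "Phi a = opw (rep_ssym a) vac"

lemma Phi_abs: "Phi (abs_ssym a) = opw a vac"
proof -
  have "ssym_eq (rep_ssym (abs_ssym a)) a"
    by (rule Quotient3_rep_abs[OF Quotient3_ssym]) (simp add: ssym_eq_def ideal_zero)
  then have "opw (rep_ssym (abs_ssym a) - a) vac = 0"
    unfolding ssym_eq_def by (rule opw_ideal)
  then show ?thesis unfolding Phi_def opw_diff by (simp only: right_minus_eq)
qed

lemma clinear_Phi: "clinear Phi"
proof (rule clinearI)
  fix a b :: "('v dual, 'w) tensor ssym" and c
  obtain a' b' where ab: "a = abs_ssym a'" "b = abs_ssym b'" using ssym_rep by blast
  show "Phi (a + b) = Phi a + Phi b" unfolding ab plus_ssym.abs_eq Phi_abs by (rule opw_add)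
  show "Phi (c *\<^sub>C a) = c *\<^sub>C Phi a" unfolding ab cscale_ssym.abs_eq Phi_abs by (rule opw_pmscale)
qed

lemmas Phi_lin = clin[OF clinear_Phi]

lemma Phi_one: "Phi 1 = vac"
proof -
  have "opw 1 vac = vac"
    unfolding single_one[symmetric] opw_single zero_word_def word.sel
    by (simp only: foldr.simps id_apply cscale_one)
  then show ?thesis unfolding one_ssym_def Phi_abs .
qed

lemma Phi_sgen_mult: "Phi (sgen u * a) = crev u (Phi a)"
proof -
  obtain a' where a: "a = abs_ssym a'" using ssym_rep by blast
  show ?thesis unfolding a sgen.abs_eq times_ssym.abs_eq Phi_abs opw_mult opw_fgen ..
qed

lemma gen_induct:
  assumes "cvs.subspace N" "1 \<in> N" "\<And>b a. b \<in> L0 \<Longrightarrow> a \<in> N \<Longrightarrow> sgen (gen b) * a \<in> N"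
  shows "a \<in> N"
proof (induction a rule: ssym_induct)
  case (one c)
  show ?case by (rule cvs.subspace_scale[OF assms(1,2)])
next
  case (sgen_mult u a)
  have "sgen u * a = (\<Sum>b\<in>L0. coord b u *\<^sub>C (sgen (gen b) * a))"
    by (subst gen_expand[of u])
      (simp only: clin[OF clinear_sgen] sum_distrib_right ssym_scale_mult_left)
  then show ?case
    using sgen_mult by (simp only:) (intro cvs.subspace_sum[OF assms(1)] cvs.subspace_scale[OF assms(1)] assms(3))
next
  case (add a b)
  then show ?case by (rule cvs.subspace_add[OF assms(1)])
qed

lemma Phi_fock: "Phi a \<in> fock L"
proof -
  have "a \<in> {a. Phi a \<in> fock L}"
  proof (rule gen_induct)
    show "cvs.subspace {a. Phi a \<in> fock L}"
      by (rule cvs.subspaceI)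
        (simp_all only: mem_Collect_eq Phi_lin cvs.subspace_0[OF subspace_fock] fock_add fock_cscale)
    show "1 \<in> {a. Phi a \<in> fock L}" by (simp only: mem_Collect_eq Phi_one fock_vac)
    show "sgen (gen b) * a \<in> {a. Phi a \<in> fock L}" if "b \<in> L0" "a \<in> {a. Phi a \<in> fock L}" for a b
      using that by (simp only: mem_Collect_eq Phi_sgen_mult crev_gen fock_cre L0_L)
  qed
  then show ?thesis by (simp only: mem_Collect_eq)
qed

text \<open>Both sides follow the same Leibniz rule of parity \<open>k\<close> and agree on the
  generators, where column \<open>j\<close> of \<open>\<mu>\<close> describes the action.\<close>

lemma Phi_gl_act_V:
  assumes A: "clinear A" "gl_part k A = A" and \<mu>: "ipar k \<mu>"
    and act: "\<And>j. j \<in> I \<Longrightarrow> dual_act A (e' j) = (\<Sum>i\<in>I. \<mu> i j *\<^sub>C e' i)"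
  shows "Phi (gl_act_V A a) = quad L (vmat \<mu>) (Phi a)"
proof -
  let ?T = "tleft (dual_act A) :: ('v dual, 'w) tensor \<Rightarrow> _"
  let ?N = "{a. Phi (gl_act_V A a) = quad L (vmat \<mu>) (Phi a)}"
  note D = clinear_dual_act[OF A(1)]
  note T = clinear_tleft[OF D]
  have Tk: "gl_part k ?T = ?T"
    unfolding gl_part_tleft[OF D] gl_part_dual_act[OF A(1)] A(2) ..
  have lin: "clinear (gl_act_V A :: ('v dual, 'w) tensor ssym \<Rightarrow> _)"
    unfolding gl_act_V_def by (rule clinear_sder[OF T])
  have "a \<in> ?N"
  proof (rule gen_induct)
    show "cvs.subspace ?N"
      by (rule cvs.subspaceI) (simp_all only: mem_Collect_eq clin[OF lin] Phi_lin quad_lin)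
    show "1 \<in> ?N"
      unfolding mem_Collect_eq gl_act_V_def sder_one[OF T] Phi_lin Phi_one quad_vac ..
  next
    fix b a assume b: "b \<in> L0" and a: "a \<in> ?N"
    obtain j t where bj: "b = (j, t)" by (cases b)
    then have jt: "j \<in> I" "t \<in> S0" using b by simp_all
    have "?T (gen b) = (\<Sum>i\<in>I. \<mu> i j *\<^sub>C gen (i, t))"
      unfolding gen_def tleft_tens[OF D] bj fst_conv snd_conv act[OF jt(1)]
      by (simp only: tens_sum_left tens_cscale_left)
    then have "Phi (sgen (?T (gen b)) * a) = (\<Sum>i\<in>I. \<mu> i j *\<^sub>C crev (gen (i, t)) (Phi a))"
      by (simp only: Phi_sgen_mult crev_sum crev_cscale)
    also have "\<dots> = (\<Sum>i\<in>I. \<mu> i j *\<^sub>C cre (i, t) (Phi a))"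
      by (rule sum.cong[OF refl]) (simp only: crev_gen mem_L0 jt simp_thms)
    also have "\<dots> = (\<Sum>a'\<in>L. vmat \<mu> a' b *\<^sub>C cre a' (Phi a))"
      unfolding bj by (rule vmat_col[OF S0_S[OF jt(2)], symmetric])
    finally have 1: "Phi (sgen (?T (gen b)) * a) = (\<Sum>a'\<in>L. vmat \<mu> a' b *\<^sub>C cre a' (Phi a))" .
    have 2: "Phi (sgen (twist k (gen b)) * gl_act_V A a) = bsign (k * lpar b) *\<^sub>C cre b (quad L (vmat \<mu>) (Phi a))"
      using a unfolding twist_homog[OF gen_homog[OF b]] Phi_sgen_mult crev_cscale crev_gen[OF b]
      by (simp only: mem_Collect_eq)
    have "Phi (gl_act_V A (sgen (gen b) * a)) = quad L (vmat \<mu>) (cre b (Phi a))"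
      unfolding gl_act_V_def sder_homog_sgen_mult[OF T Tk]
      unfolding gl_act_V_def[symmetric] Phi_lin 1 2 quad_cre[OF finite_L L0_L[OF b] parity_vmat[OF \<mu>]] ..
    then show "sgen (gen b) * a \<in> ?N"
      by (simp only: mem_Collect_eq Phi_sgen_mult crev_gen[OF b])
  qed
  then show ?thesis by (simp only: mem_Collect_eq)
qed


section \<open>Matrices annihilating the odd form as elements of \<open>pe(V)\<close>\<close>

text \<open>The scalar prefactor inverts the sign in the contragredient action, so that \<open>mat_op k \<mu>\<close> acts
  on \<open>V\<^sup>*\<close> by the matrix \<open>\<mu>\<close>.\<close>

definition mat_op :: "bit \<Rightarrow> (sindex \<Rightarrow> sindex \<Rightarrow> complex) \<Rightarrow> 'v \<Rightarrow> 'v" where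
  "mat_op k \<mu> v = (\<Sum>j\<in>I. (- bsign (k * par j) * (\<Sum>i\<in>I. \<mu> i j * dual_app (e' i) v)) *\<^sub>C e j)"

lemma clinear_mat_op: "clinear (mat_op k \<mu>)"
  by (rule clinearI)
    (simp_all add: mat_op_def dual_app_add dual_app_cscale distrib_left sum.distrib cscale_add_left
      cvs.scale_sum_right sum_distrib_left algebra_simps)

lemma linear_eq_basisI:
  fixes F G :: "'v \<Rightarrow> 'v"
  assumes "clinear F" "clinear G" "\<And>j. j \<in> I \<Longrightarrow> F (e j) = G (e j)"
  shows "F = G"
proof
  fix v
  have v: "v = (\<Sum>i\<in>I. dual_app (e' i) v *\<^sub>C e i)"
    unfolding I_def by (rule basis_expand[OF e])
  have "F v = (\<Sum>i\<in>I. dual_app (e' i) v *\<^sub>C F (e i))"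
    by (subst v) (simp only: clin[OF assms(1)])
  also have "\<dots> = (\<Sum>i\<in>I. dual_app (e' i) v *\<^sub>C G (e i))"
    by (rule sum.cong[OF refl]) (simp only: assms(3))
  also have "\<dots> = G v"
    by (subst (2) v) (simp only: clin[OF assms(2)])
  finally show "F v = G v" .
qed

lemma mat_op_basis:
  assumes "l \<in> I"
  shows "mat_op k \<mu> (e l) = (\<Sum>j\<in>I. (- bsign (k * par j) * \<mu> l j) *\<^sub>C e j)"
  unfolding mat_op_def by (simp only: e'_apply[OF assms] sum_of_bool_mult[OF finite_I assms])

lemma gl_part_mat_op:
  assumes "ipar k \<mu>"
  shows "gl_part k (mat_op k \<mu>) = mat_op k \<mu>"
proof (rule linear_eq_basisI[OF clinear_gl_part[OF clinear_mat_op] clinear_mat_op])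
  fix l assume l: "l \<in> I"
  have "e l \<in> homog (par l)" using l by (intro basis_mem_homog[OF e]) (simp add: I_def)
  then have "gl_part k (mat_op k \<mu>) (e l) = hcomp (k + par l) (mat_op k \<mu> (e l))"
    by (rule gl_part_homog[OF clinear_mat_op])
  also have "\<dots> = mat_op k \<mu> (e l)"
    unfolding mat_op_basis[OF l] clin[OF clinear_hcomp]
  proof (rule sum.cong[OF refl])
    fix j assume j: "j \<in> I"
    have ej: "e j \<in> homog (par j)" using j by (intro basis_mem_homog[OF e]) (simp add: I_def)
    show "(- bsign (k * par j) * \<mu> l j) *\<^sub>C hcomp (k + par l) (e j) = (- bsign (k * par j) * \<mu> l j) *\<^sub>C e j"
    proof (cases "\<mu> l j = 0")
      case True
      then show ?thesis by simp
    next
      case False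
      have "k = par l + par j" by (rule iparD[OF assms False])
      then have "k + par l = par j"
        using bit_cases[of "par l"] bit_cases[of "par j"] by (elim disjE) simp_all
      then show ?thesis by (simp only: hcomp_homog[OF ej] simp_thms if_True)
    qed
  qed
  finally show "gl_part k (mat_op k \<mu>) (e l) = mat_op k \<mu> (e l)" .
qed

lemma dual_act_mat_op:
  assumes "ipar k \<mu>" "j \<in> I"
  shows "dual_act (mat_op k \<mu>) (e' j) = (\<Sum>i\<in>I. \<mu> i j *\<^sub>C e' i)"
proof (rule dual_eqI)
  fix v
  have part: "gl_part l (mat_op k \<mu>) = (if l = k then mat_op k \<mu> else (\<lambda>_. 0))" for l
    using gl_part_gl_part[OF clinear_mat_op, of l k k \<mu>] unfolding gl_part_mat_op[OF assms(1)] .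
  have "dual_app (dual_act (mat_op k \<mu>) (e' j)) v = - dual_app (twist k (e' j)) (mat_op k \<mu> v)"
    unfolding dual_app_dual_act[OF clinear_mat_op] part
    using bit_cases[of k] by (elim disjE) simp_all
  also have "\<dots> = - (bsign (k * par j) * dual_app (e' j) (mat_op k \<mu> v))"
    unfolding twist_homog[OF dual_basis_homog[OF e]] by simp
  also have "dual_app (e' j) (mat_op k \<mu> v) = - bsign (k * par j) * (\<Sum>i\<in>I. \<mu> i j * dual_app (e' i) v)"
  proof -
    have "dual_app (e' j) (mat_op k \<mu> v)
      = (\<Sum>l\<in>I. - bsign (k * par l) * (\<Sum>i\<in>I. \<mu> i l * dual_app (e' i) v) * dual_app (e' j) (e l))"
      unfolding mat_op_def dual_app_sum_right dual_app_cscale ..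
    also have "\<dots> = (\<Sum>l\<in>I. - bsign (k * par l) * (\<Sum>i\<in>I. \<mu> i l * dual_app (e' i) v) * of_bool (l = j))"
      by (rule sum.cong[OF refl]) (simp only: e'_apply eq_commute[of j])
    finally show ?thesis by (simp only: sum_of_bool_mult[OF finite_I assms(2)])
  qed
  finally show "dual_app (dual_act (mat_op k \<mu>) (e' j)) v = dual_app (\<Sum>i\<in>I. \<mu> i j *\<^sub>C e' i) v"
    by (simp add: dual_app_sum)
qed

lemma odd_form_eq: "odd_form n e = (\<Sum>i\<in>I. e' i \<otimes>\<^sub>C e' (bar i))"
  unfolding odd_form_def Let_def sum_I bar.simps sum.distrib J_def ..

text \<open>The equation in \<open>pe_mat\<close> is exactly the vanishing of the coefficient of
  \<open>e' i\<close> tensor \<open>e' j\<close> in the image of the odd form; the sign comes from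
  passing the first factor.\<close>

lemma mat_op_pe:
  assumes "pe_mat n k \<mu>"
  shows "mat_op k \<mu> \<in> pe n e"
proof -
  have ip: "ipar k \<mu>" using assms by (simp add: pe_mat_def)
  note lin = clinear_mat_op[of k \<mu>]
  note D = clinear_dual_act[OF lin]
  have Dk: "gl_part k (dual_act (mat_op k \<mu>)) = dual_act (mat_op k \<mu>)"
    unfolding gl_part_dual_act[OF lin] gl_part_mat_op[OF ip] ..
  have part: "gl_part l (dual_act (mat_op k \<mu>)) = (if l = k then dual_act (mat_op k \<mu>) else (\<lambda>_. 0))" for l
    using gl_part_gl_part[OF D, of l k] unfolding Dk .
  have tr: "tright (dual_act (mat_op k \<mu>)) (f \<otimes>\<^sub>C g) = twist k f \<otimes>\<^sub>C dual_act (mat_op k \<mu>) g" for f g :: "'v dual"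
    unfolding tright_tens[OF D] part using bit_cases[of k] by (elim disjE) simp_all
  have "tleft (dual_act (mat_op k \<mu>)) (odd_form n e)
      = (\<Sum>i\<in>I. \<Sum>j\<in>I. \<mu> j i *\<^sub>C (e' j \<otimes>\<^sub>C e' (bar i)))"
    unfolding odd_form_eq clin[OF clinear_tleft[OF D]] tleft_tens[OF D]
    by (rule sum.cong[OF refl]) (simp only: dual_act_mat_op[OF ip] tens_sum_left tens_cscale_left)
  also have "\<dots> = (\<Sum>i\<in>I. \<Sum>j\<in>I. \<mu> i (bar j) *\<^sub>C (e' i \<otimes>\<^sub>C e' j))"
  proof -
    let ?F = "\<lambda>i j. \<mu> i (bar j) *\<^sub>C (e' i \<otimes>\<^sub>C e' j)"
    have "(\<Sum>i\<in>I. \<Sum>j\<in>I. ?F j (bar i)) = (\<Sum>i\<in>I. \<Sum>j\<in>I. ?F j i)"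
      by (rule sum_I_bar)
    also have "\<dots> = (\<Sum>i\<in>I. \<Sum>j\<in>I. ?F i j)" by (rule sum.swap)
    finally show ?thesis by (simp only: bar_bar)
  qed
  finally have 1: "tleft (dual_act (mat_op k \<mu>)) (odd_form n e) = (\<Sum>i\<in>I. \<Sum>j\<in>I. \<mu> i (bar j) *\<^sub>C (e' i \<otimes>\<^sub>C e' j))" .
  have 2: "tright (dual_act (mat_op k \<mu>)) (odd_form n e)
      = (\<Sum>i\<in>I. \<Sum>j\<in>I. (bsign (k * par i) * \<mu> j (bar i)) *\<^sub>C (e' i \<otimes>\<^sub>C e' j))"
    unfolding odd_form_eq clin[OF clinear_tright[OF D]] tr
    by (rule sum.cong[OF refl])
      (simp only: dual_act_mat_op[OF ip] bar_I tens_sum_right tens_cscale_left tens_cscale_right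
        twist_homog[OF dual_basis_homog[OF e]] cvs.scale_sum_right cscale_cscale mult.commute)
  have "tleft (dual_act (mat_op k \<mu>)) (odd_form n e) + tright (dual_act (mat_op k \<mu>)) (odd_form n e)
      = (\<Sum>i\<in>I. \<Sum>j\<in>I. (\<mu> i (bar j) + bsign (k * par i) * \<mu> j (bar i)) *\<^sub>C (e' i \<otimes>\<^sub>C e' j))"
    unfolding 1 2 cscale_add_left sum.distrib ..
  also have "\<dots> = (\<Sum>i\<in>I. \<Sum>j\<in>I. 0)"
    using assms by (intro sum.cong refl) (simp add: pe_mat_def I_def)
  finally show ?thesis using lin by (simp add: pe_def gl_def)
qed

lemma Phi_Inv:
  assumes "a \<in> invariants (pe n e)"
  shows "Phi a \<in> Inv"
proof (rule InvI[OF Phi_fock])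
  fix k \<mu> assume \<mu>: "pe_mat n k \<mu>"
  then have ip: "ipar k \<mu>" by (simp add: pe_mat_def)
  have "gl_act_V (mat_op k \<mu>) a = 0"
    using assms mat_op_pe[OF \<mu>] by (simp add: invariants_def)
  then show "quad L (vmat \<mu>) (Phi a) = 0"
    using Phi_gl_act_V[OF clinear_mat_op gl_part_mat_op[OF ip] ip dual_act_mat_op[OF ip], of a]
    by (simp only: Phi_lin)
qed

text \<open>Sending frame letters to 0 undoes the enlargement of W: an inner product involving a
  frame vector dies, any other is kept.\<close>

definition psi_op :: "letter \<Rightarrow> ('v dual, 'w) tensor ssym \<Rightarrow> ('v dual, 'w) tensor ssym" where
  "psi_op a y = (if a \<in> L0 then sgen (gen a) * y else 0)"

definition psi :: "nat \<Rightarrow> state \<Rightarrow> ('v dual, 'w) tensor ssym" where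
  "psi = hmap L psi_op 1"

lemma clinear_psi_op: "clinear (psi_op a)"
  by (rule clinearI) (simp_all add: psi_op_def distrib_left ssym_scale_mult_right)

lemma clinear_psi: "clinear (psi m)"
  unfolding psi_def by (rule clinear_hmap[OF clinear_psi_op])

lemmas psi_lin = clin[OF clinear_psi]

lemma psi_op_commute: "psi_op b (psi_op a y) = sg a b *\<^sub>C psi_op a (psi_op b y)"
proof (cases "a \<in> L0 \<and> b \<in> L0")
  case True
  then have "sgen (gen b) * sgen (gen a) = sg a b *\<^sub>C (sgen (gen a) * sgen (gen b))"
    using sgen_commute[OF gen_homog gen_homog, of b a] by (simp add: sg_def mult.commute)
  then have "sgen (gen b) * sgen (gen a) * y = sg a b *\<^sub>C (sgen (gen a) * sgen (gen b) * y)"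
    by (simp only: ssym_scale_mult_left)
  then show ?thesis using True by (simp add: psi_op_def mult.assoc)
next
  case False
  then show ?thesis by (auto simp: psi_op_def)
qed

lemma psi_cre: "a \<in> L \<Longrightarrow> psi (Suc m) (cre a h) = psi_op a (psi m h)"
  unfolding psi_def by (rule hmap_cre[OF clinear_psi_op finite_L _ psi_op_commute])

lemma psi_G:
  assumes "s \<in> S" "t \<in> S"
  shows "psi (Suc (Suc m)) (G s t h)
    = (if s \<in> S0 \<and> t \<in> S0 then inner_product n e w s t * psi m h else 0)"
proof -
  have "psi (Suc (Suc m)) (G s t h)
      = (\<Sum>i\<in>I. bsign (par s * (par i + 1)) *\<^sub>C psi_op (i, s) (psi_op (bar i, t) (psi m h)))"
    unfolding G_def psi_lin using assms by (intro sum.cong refl) (simp only: psi_cre mem_L bar_I simp_thms)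
  also have "\<dots> = (if s \<in> S0 \<and> t \<in> S0 then inner_product n e w s t * psi m h else 0)"
  proof (cases "s \<in> S0 \<and> t \<in> S0")
    case True
    have "(\<Sum>i\<in>I. bsign (par s * (par i + 1)) *\<^sub>C psi_op (i, s) (psi_op (bar i, t) (psi m h)))
      = (\<Sum>i\<in>I. (bsign (par s * (par i + 1)) *\<^sub>C (sgen (gen (i, s)) * sgen (gen (bar i, t)))) * psi m h)"
      using True by (intro sum.cong refl) (simp add: psi_op_def ssym_scale_mult_left mult.assoc)
    also have "\<dots> = inner_product n e w s t * psi m h"
      unfolding sum_distrib_right[symmetric] sum_I inner_product_def Let_def xgen_def gen_def fst_conv snd_conv
        J_def[symmetric] sum.distrib by simp
    finally show ?thesis using True by simp
  next
    case False
    have "psi_op (i, s) (psi_op (bar i, t) (psi m h)) = 0" for i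
      using False clinear_zero[OF clinear_psi_op] by (auto simp: psi_op_def)
    then show ?thesis using False by (simp only: cvs.scale_zero_right sum.neutral_const if_False)
  qed
  finally show ?thesis .
qed

lemma psi_R:
  assumes N: "subalgebra N" and M: "\<And>s t. s \<in> S0 \<Longrightarrow> t \<in> S0 \<Longrightarrow> inner_product n e w s t \<in> N"
    and "f \<in> R m"
  shows "psi m f \<in> N"
proof -
  have sub: "cvs.subspace N" and one: "1 \<in> N" and mult: "\<And>a b. a \<in> N \<Longrightarrow> b \<in> N \<Longrightarrow> a * b \<in> N"
    using N by (simp_all add: subalgebra_def)
  have base: "psi m h \<in> N" if "h \<in> Rgen m" for m h
    using that
  proof (induction m arbitrary: h rule: Rgen.induct)
    case 1
    then have "h = vac" unfolding Rgen.simps by (rule singletonD)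
    moreover have "psi 0 vac = 1" by (simp add: psi_def vac_def)
    ultimately show ?case using one by (simp only:)
  next
    case 2
    then show ?case unfolding Rgen.simps by (rule emptyE)
  next
    case (3 m)
    from "3.prems" obtain s t h' where h: "s \<in> S" "t \<in> S" "h' \<in> Rgen m" "h = G s t h'"
      by (rule Rgen_SucE)
    have "psi m h' \<in> N" by (rule "3.IH"[OF h(1,2,3)])
    then show ?case
      unfolding h(4) psi_G[OF h(1,2)] using mult M cvs.subspace_0[OF sub] by simp
  qed
  show ?thesis
    using assms(3) unfolding R_def
  proof (induction rule: cvs.span_induct_alt)
    case base
    show ?case unfolding psi_lin by (rule cvs.subspace_0[OF sub])
  next
    case (step c x y)
    show ?case unfolding psi_lin
      by (intro cvs.subspace_add[OF sub] cvs.subspace_scale[OF sub] step(2) base step(1))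
  qed
qed

text \<open>\<open>psi m\<close> reads only the component of degree m, and \<open>Phi a\<close> has
  finitely many components, so the partial sums become constant. The claim is phrased for all large
  bounds so that it survives sums and multiplication by a generator, which shifts degrees by
  one.\<close>

lemma psi_Phi: "\<exists>M0. \<forall>M\<ge>M0. (\<Sum>m<M. psi m (Phi a)) = a"
proof -
  let ?N = "{a. \<exists>M0. \<forall>M\<ge>M0. (\<Sum>m<M. psi m (Phi a)) = a}"
  have "a \<in> ?N"
  proof (rule gen_induct)
    show "cvs.subspace ?N"
    proof (rule cvs.subspaceI)
      show "0 \<in> ?N" by (simp only: mem_Collect_eq Phi_lin psi_lin sum.neutral_const) simp
    next
      fix x y assume "x \<in> ?N" "y \<in> ?N"
      then obtain M1 M2 where "\<And>M. M \<ge> M1 \<Longrightarrow> (\<Sum>m<M. psi m (Phi x)) = x"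
        "\<And>M. M \<ge> M2 \<Longrightarrow> (\<Sum>m<M. psi m (Phi y)) = y" by blast
      then have "(\<Sum>m<M. psi m (Phi (x + y))) = x + y" if "M \<ge> max M1 M2" for M
        using that by (simp only: Phi_lin psi_lin sum.distrib max.bounded_iff)
      then show "x + y \<in> ?N" by blast
    next
      fix c x assume "x \<in> ?N"
      then obtain M1 where "\<And>M. M \<ge> M1 \<Longrightarrow> (\<Sum>m<M. psi m (Phi x)) = x" by blast
      then have "(\<Sum>m<M. psi m (Phi (c *\<^sub>C x))) = c *\<^sub>C x" if "M \<ge> M1" for M
        using that by (simp only: Phi_lin psi_lin cvs.scale_sum_right[symmetric])
      then show "c *\<^sub>C x \<in> ?N" by blast
    qed
  next
    have 0: "psi 0 vac = 1" by (simp add: psi_def vac_def)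
    have S: "psi (Suc m) vac = 0" for m
    proof -
      have "hmap L psi_op 1 m (ann b vac) = 0" for b
        unfolding ann_vac using clinear_zero[OF clinear_psi, of m] by (simp only: psi_def)
      then show ?thesis
        unfolding psi_def hmap.simps(2) by (simp only: clinear_zero[OF clinear_psi_op] sum.neutral_const cvs.scale_zero_right)
    qed
    have "(\<Sum>m<M. psi m (Phi 1)) = 1" if M: "M \<ge> 1" for M
    proof -
      obtain k where "M = Suc k" using M by (cases M) auto
      then show ?thesis by (simp only: Phi_one sum.lessThan_Suc_shift 0 S sum.neutral_const add_0_right)
    qed
    then show "1 \<in> ?N" by blast
  next
    fix b a assume b: "b \<in> L0" and "a \<in> ?N"
    then obtain M1 where M1: "\<And>M. M \<ge> M1 \<Longrightarrow> (\<Sum>m<M. psi m (Phi a)) = a" by blast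
    have "(\<Sum>m<M. psi m (Phi (sgen (gen b) * a))) = sgen (gen b) * a" if M: "M \<ge> Suc M1" for M
    proof -
      obtain k where k: "M = Suc k" "k \<ge> M1" using M by (cases M) auto
      have "psi 0 (cre b (Phi a)) = 0" by (simp add: psi_def)
      moreover have "psi (Suc m) (cre b (Phi a)) = sgen (gen b) * psi m (Phi a)" for m
        unfolding psi_cre[OF L0_L[OF b]] psi_op_def using b by (simp only: if_True)
      ultimately show ?thesis
        by (simp only: k(1) Phi_sgen_mult crev_gen[OF b] sum.lessThan_Suc_shift add_0_left
            sum_distrib_left[symmetric] M1[OF k(2)])
    qed
    then show "sgen (gen b) * a \<in> ?N" by blast
  qed
  then show ?thesis by (simp only: mem_Collect_eq)
qed

text \<open>The operators \<open>quad\<close> preserve degree, so each homogeneous component of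
  \<open>Phi a\<close> is invariant and \<open>fft\<close> applies to it. Then \<open>psi\<close>
  carries products of inner products back into \<open>N\<close>.\<close>

lemma invariants_generated:
  assumes "a \<in> invariants (pe n e)" "subalgebra N"
    and "\<And>s t. s \<in> S0 \<Longrightarrow> t \<in> S0 \<Longrightarrow> inner_product n e w s t \<in> N"
  shows "a \<in> N"
proof -
  have "psi m (Phi a) \<in> N" for m
  proof -
    have "part m (Phi a) \<in> Inv"
      by (intro InvI fock_part Phi_fock) (simp only: quad_part InvD[OF Phi_Inv[OF assms(1)]] part_lin)
    then have "part m (Phi a) \<in> R m" by (rule fft[OF _ hom_part])
    from psi_R[OF assms(2) _ this] have "psi m (part m (Phi a)) \<in> N" using assms(3) by blast
    then show ?thesis unfolding psi_def hmap_part .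
  qed
  then have "(\<Sum>m<M. psi m (Phi a)) \<in> N" for M
    using assms(2) by (intro cvs.subspace_sum) (simp_all only: subalgebra_def)
  then show ?thesis using psi_Phi[of a] by (metis order_refl)
qed

end

theorem theorem1p4p1:
  fixes n p q :: nat
    and e :: "sindex \<Rightarrow> 'v::superspace"
    and w :: "sindex \<Rightarrow> 'w::superspace"
  assumes "homogeneous_basis n n e"
    and "homogeneous_basis p q w"
  shows "basic_set (pe n e)
    {inner_product n e w s t | s t. s \<in> indices p q \<and> t \<in> indices p q}"
proof -
  interpret superspaces n p q e w
    by unfold_locales (fact assms)+
  let ?A = "invariants (pe n e) :: ('v dual, 'w) tensor ssym set"
  let ?M = "{inner_product n e w s t | s t. s \<in> indices p q \<and> t \<in> indices p q}"
  have M: "?M \<subseteq> ?A"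
  proof
    fix x assume "x \<in> ?M"
    then obtain s t where "x = inner_product n e w s t" "s \<in> indices p q" by blast
    then show "x \<in> ?A"
      by (simp only: inner_product_invariant[where w = w, OF assms(1) basis_mem_homog[OF assms(2)]])
  qed
  \<comment> \<open>One inclusion: every competing \<open>N\<close> contains all invariants. The
    other holds because the invariants are themselves such an \<open>N\<close>.\<close>
  have "a \<in> N" if "a \<in> ?A" "subalgebra N" "?M \<subseteq> N" for a N
  proof (rule invariants_generated[OF that(1,2)])
    show "inner_product n e w s t \<in> N" if "s \<in> S0" "t \<in> S0" for s t
      using that \<open>?M \<subseteq> N\<close> unfolding S0_def by blast
  qed
  moreover have "subalgebra ?A" by (rule subalgebra_invariants_pe[OF assms(1)])
  moreover have "P ` ?A \<subseteq> ?A" if "P \<in> polarizations" for P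
    using polarizations_invariants[OF assms(1) that] by blast
  ultimately show ?thesis
    unfolding basic_set_def using M by blast
qed

end
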